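(* Let $\beta\in[1,2)$ be fixed. Let $\mathbf{X}=(X_t)_{t\ge0}$ be a symmetric Lévy process in $\mathbb{R}^d$ with the triplet $(0,0,\nu)$. Suppose that there is a measure $\eta$ on $\mathbb{R}^d\setminus\{0\}$ such that $$\lim_{s\to0^+}\frac{\nu(sG)}{\nu(B_s^c)}=\eta(G)\quad\text{for } G\subset\mathbb{R}^d\setminus\{0\}\text{ with }\eta(\partial G)=0,$$ where $V(t)=\nu(B_{1/t}^c)$ is regularly varying at infinity of index $\alpha\in(\beta,2)$. Let $g$ be a bounded function on $\mathbb{R}^d$, $\mu$ a finite Borel measure on $\mathbb{R}^d$, and $r(x)=\int_{\mathbb{R}^d}g(x+y)\,\mu(dy)$. Assume that there is a real function $R_\beta$ defined on the sphere $\mathbb{S}^{d-1}$ such that $$\lim_{t\to0^+}\sup_{\theta\in\mathbb{S}^{d-1}}\left|\frac{r(t\theta)+r(-t\theta)-2r(0)}{t^\beta}-R_\beta(\theta)\right|=0 .$$ Moreover, suppose that, for some constant $L>0$, $r$ satisfies $$|r(x)+r(-x)-2r(0)|\le L\|x\|^\beta\quad\text{for all }x\in\mathbb{R}^d.$$ Let $H_g^\mu(t)=\int_{\mathbb{R}^d}\mathbb{E}^xg(X_t)\,\mu(dx)$, $t\ge0$. Then $$\lim_{t\to0^+}[V^-(1/t)]^\beta\left(H_g^\mu(t)-H_g^\mu(0)\right)=\frac12\int_{\mathbb{R}^d}R_\beta\left(\frac{x}{\|x\|}\right)\|x\|^\beta\,p_\eta(x)\,dx,$$ where the density function $p_\eta$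 is uniquely determined by the formula $$e^{-\int_{\mathbb{R}^d}(1-\cos\langle\xi,y\rangle)\,\eta(dy)}=\int_{\mathbb{R}^d}e^{i\langle\xi,x\rangle}\,p_\eta(x)\,dx .$$
   Context: $\|\cdot\|$ and $\langle\cdot,\cdot\rangle$ are the Euclidean norm and scalar product on $\mathbb{R}^d$; $\mathbb{S}^{d-1}$ is the unit sphere; $B_R=\{x\in\mathbb{R}^d:\|x\|\le R\}$ and $B_R^c$ is its complement; $sG=\{sx:x\in G\}$; $\partial G$ is the boundary of $G$. Sets $G$ and the function $g$ are understood to be Borel. $\mathbf{X}$ starts at $X_0=0$. That $\mathbf{X}$ is symmetric with triplet $(0,0,\nu)$ means that it has no Gaussian part and no drift, that $\nu$ is a symmetric Lévy measure ($\nu(\{0\})=0$ and $\int_{\mathbb{R}^d}(1\wedge\|y\|^2)\,\nu(dy)<\infty$), and that $\mathbb{E}\,e^{i\langle x,X_t\rangle}=e^{-t\psi(x)}$ with $\psi(x)=\int_{\mathbb{R}^d}(1-\cos\langle x,y\rangle)\,\nu(dy)$. A function $V$ is regularly varying at infinity of index $\alpha$ if $\lim_{s\to\infty}V(\lambda s)/V(s)=\lambda^\alpha$ for every $\lambda>0$. The generalized inverse of $V$ is $V^-(u)=\inf\{x\ge0:V(x)\ge u\}$. $\mathbb{E}^x$ denotes expectation for the process started at $x$, i.e. $\mathbb{E}^xg(X_t)=\mathbb{E}\,g(x+X_t)$.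
   Formalization: The existence of the density p_η is assumed (its uniqueness is proved), because it can fail: if ν is a symmetric stable measure carried by a line in the plane, all hypotheses hold but the law determined by the formula has no density. *)

theory Defs
  imports "HOL-Probability.Probability"
begin

definition levy_measure :: "'a::euclidean_space measure \<Rightarrow> bool" where
  "levy_measure \<nu> \<longleftrightarrow>
     sets \<nu> = sets borel \<and> emeasure \<nu> {0} = 0 \<and>
     (\<integral>\<^sup>+ y. ennreal (min 1 ((norm y)\<^sup>2)) \<partial>\<nu>) < \<infinity>"

definition symmetric_measure :: "'a::euclidean_space measure \<Rightarrow> bool" where
  "symmetric_measure \<nu> \<longleftrightarrow> (\<forall>A\<in>sets \<nu>. emeasure \<nu> (uminus ` A) = emeasure \<nu> A)"

text \<open>The clauses are, in order: start at the origin, independent increments, stationary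
  increments, stochastic continuity, almost surely cadlag paths. Only times in \<open>[0, \<infinity>)\<close> matter.\<close>

definition levy_process :: "'w measure \<Rightarrow> (real \<Rightarrow> 'w \<Rightarrow> 'a::euclidean_space) \<Rightarrow> bool" where
  "levy_process M X \<longleftrightarrow>
     prob_space M \<and>
     (\<forall>t\<ge>0. X t \<in> borel_measurable M) \<and>
     (AE \<omega> in M. X 0 \<omega> = 0) \<and>
     (\<forall>(n::nat) (t::nat \<Rightarrow> real). 0 \<le> t 0 \<longrightarrow> (\<forall>i<n. t i \<le> t (Suc i)) \<longrightarrow>
        prob_space.indep_vars M (\<lambda>_. borel) (\<lambda>i \<omega>. X (t (Suc i)) \<omega> - X (t i) \<omega>) {..<n}) \<and>
     (\<forall>s\<ge>0. \<forall>t\<ge>0.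
        distr M borel (\<lambda>\<omega>. X (s + t) \<omega> - X s \<omega>) = distr M borel (X t)) \<and>
     (\<forall>t\<ge>0. \<forall>\<epsilon>>0.
        ((\<lambda>s. measure M {\<omega> \<in> space M. norm (X s \<omega> - X t \<omega>) > \<epsilon>}) \<longlongrightarrow> 0) (at t within {0..})) \<and>
     (AE \<omega> in M. \<forall>t\<ge>0.
        ((\<lambda>s. X s \<omega>) \<longlongrightarrow> X t \<omega>) (at_right t) \<and>
        (t > 0 \<longrightarrow> (\<exists>l. ((\<lambda>s. X s \<omega>) \<longlongrightarrow> l) (at_left t))))"

definition cos_exponent :: "'a::euclidean_space measure \<Rightarrow> 'a \<Rightarrow> real" where
  "cos_exponent \<nu> x = (\<integral>y. (1 - cos (x \<bullet> y)) \<partial>\<nu>)"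

text \<open>A symmetric Levy process with triplet \<open>(0, 0, \<nu>)\<close>: no Gaussian part and no drift.\<close>

definition symmetric_levy_process ::
    "'w measure \<Rightarrow> (real \<Rightarrow> 'w \<Rightarrow> 'a::euclidean_space) \<Rightarrow> 'a measure \<Rightarrow> bool" where
  "symmetric_levy_process M X \<nu> \<longleftrightarrow>
     levy_process M X \<and> levy_measure \<nu> \<and> symmetric_measure \<nu> \<and>
     (\<forall>t\<ge>0. \<forall>x. (\<integral>\<omega>. iexp (x \<bullet> X t \<omega>) \<partial>M) = of_real (exp (- t * cos_exponent \<nu> x)))"

text \<open>\<open>V(t) = \<nu>(B\<^bsub>1/t\<^esub>\<^sup>c)\<close>; the value at \<open>t = 0\<close> follows the convention \<open>1/0 = \<infinity>\<close>, for which
  the complement of the ball is empty (in HOL, \<open>1/0 = 0\<close>).\<close>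

definition tail_fun :: "'a::euclidean_space measure \<Rightarrow> real \<Rightarrow> real" where
  "tail_fun \<nu> t = (if t > 0 then measure \<nu> (- cball 0 (1 / t)) else 0)"

definition regularly_varying :: "(real \<Rightarrow> real) \<Rightarrow> real \<Rightarrow> bool" where
  "regularly_varying V \<alpha> \<longleftrightarrow> (\<forall>c>0. ((\<lambda>s. V (c * s) / V s) \<longlongrightarrow> c powr \<alpha>) at_top)"

definition gen_inverse :: "(real \<Rightarrow> real) \<Rightarrow> real \<Rightarrow> real" where
  "gen_inverse V u = Inf {x. 0 \<le> x \<and> V x \<ge> u}"

text \<open>A measure \<open>\<eta>\<close> on \<open>\<real>\<^sup>d\<close> without the origin is encoded as a Borel measure on the whole space
  that does not charge the origin; then \<open>\<eta>(\<partial>G)\<close> does not depend on the ambient space in which the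
  boundary is taken. No finiteness is imposed on \<open>\<eta>\<close>, so the limit is taken in \<open>[0, \<infinity>]\<close>.\<close>

definition tail_limit_measure :: "'a::euclidean_space measure \<Rightarrow> 'a measure \<Rightarrow> bool" where
  "tail_limit_measure \<nu> \<eta> \<longleftrightarrow>
     sets \<eta> = sets borel \<and> emeasure \<eta> {0} = 0 \<and>
     (\<forall>G\<in>sets borel. 0 \<notin> G \<longrightarrow> emeasure \<eta> (frontier G) = 0 \<longrightarrow>
        ((\<lambda>s. emeasure \<nu> ((\<lambda>x. s *\<^sub>R x) ` G) / emeasure \<nu> (- cball 0 s)) \<longlongrightarrow> emeasure \<eta> G)
          (at_right 0))"

text \<open>\<open>p\<close> is a probability density whose Fourier transform is \<open>exp (-\<integral>(1 - cos\<langle>\<xi>, y\<rangle>) \<eta>(dy))\<close>. The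
  integrability clause says that the exponent is a genuine finite integral and not the default
  value 0 of the Bochner integral.\<close>

definition limit_density :: "'a::euclidean_space measure \<Rightarrow> ('a \<Rightarrow> real) \<Rightarrow> bool" where
  "limit_density \<eta> p \<longleftrightarrow>
     p \<in> borel_measurable borel \<and> (\<forall>x. 0 \<le> p x) \<and> (\<integral>\<^sup>+ x. ennreal (p x) \<partial>lborel) = 1 \<and>
     (\<forall>\<xi>. integrable \<eta> (\<lambda>y. 1 - cos (\<xi> \<bullet> y)) \<and>
        of_real (exp (- cos_exponent \<eta> \<xi>)) = (\<integral>x. iexp (\<xi> \<bullet> x) * of_real (p x) \<partial>lborel))"

definition shift_avg :: "('a::euclidean_space \<Rightarrow> real) \<Rightarrow> 'a measure \<Rightarrow> 'a \<Rightarrow> real" where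
  "shift_avg g \<mu> x = (\<integral>y. g (x + y) \<partial>\<mu>)"

definition heat_content ::
    "'w measure \<Rightarrow> (real \<Rightarrow> 'w \<Rightarrow> 'a::euclidean_space) \<Rightarrow> ('a \<Rightarrow> real) \<Rightarrow> 'a measure \<Rightarrow> real \<Rightarrow> real"
  where "heat_content M X g \<mu> t = (\<integral>x. (\<integral>\<omega>. g (x + X t \<omega>) \<partial>M) \<partial>\<mu>)"

end

theory Submission
  imports Defs
begin

text \<open>
  Put \<open>u = V\<^sup>-(1/t)\<close>, \<open>Y\<^sub>t = u X\<^sub>t\<close> and \<open>Q(x) = r(x) + r(-x) - 2 r(0)\<close>. Fubini gives
  \<open>H(t) - H(0) = E r(X\<^sub>t) - r(0)\<close>, and since \<open>X\<^sub>t\<close> is symmetric this is \<open>E Q(X\<^sub>t) / 2\<close>. So the claim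
  is about the limit of \<open>E [u\<^sup>\<beta> Q(Y\<^sub>t / u)]\<close>, whose integrand converges pointwise to
  \<open>R(y / |y|) |y|\<^sup>\<beta>\<close>.

  Weak convergence of \<open>Y\<^sub>t\<close> would not suffice: \<open>g\<close> is only Borel, and \<open>R\<close> may be discontinuous
  everywhere. Instead the densities of \<open>Y\<^sub>t\<close> converge. The characteristic function of \<open>Y\<^sub>t\<close> is
  \<open>exp (- t \<psi>(u \<xi>))\<close>. Three facts about the characteristic exponent \<open>\<psi>\<close> of \<open>\<nu>\<close> carry the proof.

  \<^item> \<open>\<psi>(s \<xi>) / V(s)\<close> tends to the exponent of \<open>\<eta>\<close> at \<open>\<xi>\<close> (\<open>cos_exponent_tendsto\<close>). Writing
    \<open>\<integral>(1 - cos) d\<nu>\<close> as an integral over \<open>l\<close> of the \<open>\<nu>\<close>-measures of the level sets \<open>{1 - cos > l}\<close>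
    turns each integrand into a quotient \<open>\<nu>(sG) / \<nu>(B\<^sub>s\<^sup>c)\<close>; the boundary of \<open>G\<close> lies in
    \<open>{1 - cos = l}\<close>, which is \<open>\<eta>\<close>-null for almost every \<open>l\<close>. A Potter bound dominates the integrand
    by \<open>l\<^sup>-\<^sup>\<gamma>\<^sup>/\<^sup>2\<close>, integrable at 0 because \<open>\<gamma> < 2\<close>.

  \<^item> \<open>\<psi>(s \<theta>) \<ge> c V(s)\<close> for all unit vectors \<open>\<theta>\<close> and large \<open>s\<close> (\<open>cos_exponent_lower_bound\<close>). The limit
    exponent is positive off the origin since a law with a density is not carried by countably many
    hyperplanes; compactness of the sphere makes this uniform. Together with \<open>\<alpha> > 1\<close> it bounds the
    characteristic functions of all \<open>Y\<^sub>t\<close>, \<open>t\<close> small, by one integrable function \<open>exp (c - c |\<xi>|)\<close>.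
    Fourier inversion (\<open>fourier_inversion\<close>) then yields even densities that are uniformly bounded and
    converge pointwise, which settles the integral over any ball.

  \<^item> \<open>\<psi>(s \<xi>)\<close> is at most a constant times \<open>max 1 |\<xi>|\<^sup>2 V(s)\<close> for large \<open>s\<close> (\<open>trunc_moment_le_tail\<close>).
    Through a Gaussian average of \<open>1 - \<phi>\<close> this gives \<open>P(|Y\<^sub>t| \<ge> x) \<le> D x\<^sup>-\<^sup>\<gamma>\<close>, \<open>\<beta> < \<gamma> < \<alpha>\<close>, but only for
    \<open>x\<close> up to a multiple \<open>A\<close> of \<open>u\<close>: the large jumps of \<open>X\<close> are unrestricted and \<open>X\<^sub>t\<close> need not have a
    moment of order \<open>\<beta>\<close>. Beyond \<open>A\<close> the boundedness of \<open>r\<close> takes over, for it gives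
    \<open>|u\<^sup>\<beta> Q(y / u)| \<le> C min(|y|, A)\<^sup>\<beta>\<close>; so the integrals over \<open>{|y| \<ge> K}\<close> are small uniformly in \<open>t\<close>
    (\<open>truncated_moment_tail\<close>).
\<close>

section \<open>Integrals as integrals of level sets\<close>

text \<open>Tonelli for the region below the graph of \<open>f\<close>. This is the form in which a statement about measures
  of sets becomes one about integrals.\<close>

lemma layer_cake:
  fixes f :: "'a \<Rightarrow> real"
  assumes "sigma_finite_measure M" and [measurable]: "f \<in> borel_measurable M"
  shows "(\<integral>\<^sup>+x. ennreal (f x) \<partial>M) =
    (\<integral>\<^sup>+l. indicator {0<..} l * emeasure M {x\<in>space M. l < f x} \<partial>lborel)"
proof -
  interpret sigma_finite_measure M by fact
  interpret pair_sigma_finite M lborel by standard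
  have "(\<integral>\<^sup>+x. ennreal (f x) \<partial>M) = (\<integral>\<^sup>+x. \<integral>\<^sup>+l. indicator {0<..<f x} l \<partial>lborel \<partial>M)"
    proof (rule nn_integral_cong)
    fix x show "ennreal (f x) = (\<integral>\<^sup>+l. indicator {0<..<f x} l \<partial>lborel)"
      by (cases "0 \<le> f x") (simp_all add: ennreal_neg)
  qed
  also have "\<dots> = (\<integral>\<^sup>+x. \<integral>\<^sup>+l. indicator {0<..} l * indicator {l. l < f x} l \<partial>lborel \<partial>M)"
    by (intro nn_integral_cong) (auto simp: indicator_def)
  also have "\<dots> = (\<integral>\<^sup>+l. \<integral>\<^sup>+x. indicator {0<..} l * indicator {l. l < f x} l \<partial>M \<partial>lborel)"
    by (rule Fubini'[symmetric]) (simp add: indicator_def)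
  also have "\<dots> = (\<integral>\<^sup>+l. indicator {0<..} l * emeasure M {x\<in>space M. l < f x} \<partial>lborel)"
  proof (rule nn_integral_cong)
    fix l :: real
    have "(\<integral>\<^sup>+x. indicator {0<..} l * indicator {l. l < f x} l \<partial>M)
        = indicator {0<..} l * (\<integral>\<^sup>+x. indicator {x\<in>space M. l < f x} x \<partial>M)"
      by (subst nn_integral_cmult[symmetric]) (auto simp: indicator_def intro!: nn_integral_cong)
    then show "(\<integral>\<^sup>+x. indicator {0<..} l * indicator {l. l < f x} l \<partial>M)
        = indicator {0<..} l * emeasure M {x\<in>space M. l < f x}" by simp
  qed
  finally show ?thesis .
qed

lemma layer_cake_integral:
  fixes f :: "'a \<Rightarrow> real"
  assumes M: "sigma_finite_measure M" and f: "integrable M f" and bd: "\<And>x. 0 \<le> f x" "\<And>x. f x \<le> c"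
  shows "(\<integral>x. f x \<partial>M) = (\<integral>l. indicator {0<..<c} l * measure M {x\<in>space M. l < f x} \<partial>lborel)"
    (is "_ = (\<integral>l. ?F l \<partial>lborel)")
    and "(\<lambda>l. measure M {x\<in>space M. l < f x}) \<in> borel_measurable borel"
    and "0 < l \<Longrightarrow> emeasure M {x\<in>space M. l < f x} < \<infinity>"
proof -
  interpret sigma_finite_measure M by fact
  have [measurable]: "f \<in> borel_measurable M" using f by auto
  have fin: "emeasure M {x\<in>space M. l < f x} < \<infinity>" if "0 < l" for l
  proof -
    have "ennreal l * emeasure M {x\<in>space M. l < f x} = (\<integral>\<^sup>+x. ennreal l * indicator {x\<in>space M. l < f x} x \<partial>M)"
      by (simp add: nn_integral_cmult_indicator)
    also have "\<dots> \<le> (\<integral>\<^sup>+x. ennreal (norm (f x)) \<partial>M)"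
      by (intro nn_integral_mono) (auto simp: indicator_def intro!: ennreal_leI)
    also have "\<dots> < \<infinity>" using f by (simp add: integrable_iff_bounded)
    finally show ?thesis using that by (auto simp: ennreal_mult_less_top)
  qed
  show "0 < l \<Longrightarrow> emeasure M {x\<in>space M. l < f x} < \<infinity>" by (rule fin)
  have "(\<lambda>l. emeasure M {x\<in>space M. l < f x}) \<in> borel_measurable borel" by measurable
  then show [measurable]: "(\<lambda>l. measure M {x\<in>space M. l < f x}) \<in> borel_measurable borel"
    unfolding measure_def by measurable
  have "(\<integral>x. f x \<partial>M) = enn2real (\<integral>\<^sup>+x. ennreal (f x) \<partial>M)"
    by (rule integral_eq_nn_integral) (auto simp: bd)
  also have "(\<integral>\<^sup>+x. ennreal (f x) \<partial>M) = (\<integral>\<^sup>+l. ennreal (?F l) \<partial>lborel)"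
    unfolding layer_cake[OF M \<open>f \<in> borel_measurable M\<close>]
  proof (rule nn_integral_cong)
    fix l :: real
    consider "l \<le> 0" | "0 < l" "l < c" | "c \<le> l" "0 < l" by linarith
    then show "indicator {0<..} l * emeasure M {x\<in>space M. l < f x} = ennreal (?F l)"
    proof cases
      case 2 then show ?thesis using fin[of l] by (simp add: emeasure_eq_ennreal_measure)
    next
      case 3
      then have e: "{x\<in>space M. l < f x} = {}" using bd(2) by (auto simp: not_less intro: order_trans)
      show ?thesis unfolding e by simp
    qed (simp add: indicator_def)
  qed
  also have "enn2real \<dots> = (\<integral>l. ?F l \<partial>lborel)"
    by (rule integral_eq_nn_integral[symmetric]) auto
  finally show "(\<integral>x. f x \<partial>M) = (\<integral>l. ?F l \<partial>lborel)" .
qed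

text \<open>By Tonelli the graph of \<open>f\<close> is null for the product with Lebesgue measure. Hence
  almost every superlevel set of a continuous function has a null boundary.\<close>

lemma AE_level_set_null:
  fixes f :: "'a \<Rightarrow> real"
  assumes "sigma_finite_measure M" and [measurable]: "f \<in> borel_measurable M"
  shows "AE l in lborel. emeasure M {x\<in>space M. f x = l} = 0"
proof -
  interpret sigma_finite_measure M by fact
  interpret pair_sigma_finite M lborel by standard
  have "(\<integral>\<^sup>+l. emeasure M {x\<in>space M. f x = l} \<partial>lborel) =
    (\<integral>\<^sup>+l. \<integral>\<^sup>+x. indicator {f x} l \<partial>M \<partial>lborel)"
  proof (rule nn_integral_cong)
    fix l :: real
    have "emeasure M {x\<in>space M. f x = l} = (\<integral>\<^sup>+x. indicator {x\<in>space M. f x = l} x \<partial>M)"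
      by simp
    also have "\<dots> = (\<integral>\<^sup>+x. indicator {f x} l \<partial>M)"
      by (rule nn_integral_cong) (auto simp: indicator_def)
    finally show "emeasure M {x\<in>space M. f x = l} = (\<integral>\<^sup>+x. indicator {f x} l \<partial>M)" .
  qed
  also have "\<dots> = (\<integral>\<^sup>+x. \<integral>\<^sup>+l. indicator {f x} l \<partial>lborel \<partial>M)"
    by (rule Fubini') (simp add: indicator_def)
  also have "\<dots> = 0" by simp
  finally have 0: "(\<integral>\<^sup>+l. emeasure M {x\<in>space M. f x = l} \<partial>lborel) = 0" .
  have "(\<lambda>l. emeasure M {x\<in>space M. f x = l}) \<in> borel_measurable lborel" by measurable
  from nn_integral_0_iff_AE[OF this] 0 show ?thesis by simp
qed

text \<open>Each set \<open>{f i \<ge> 1 / (n + 1)}\<close> has finite measure, and these sets cover the space up to \<open>N\<close>.\<close>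

lemma sigma_finiteI_countable_integrable:
  fixes f :: "'i \<Rightarrow> 'a \<Rightarrow> real"
  assumes I: "countable I" and f: "\<And>i. i \<in> I \<Longrightarrow> integrable M (f i)"
    and pos: "\<And>x. x \<in> space M - N \<Longrightarrow> \<exists>i\<in>I. 0 < f i x" and N: "N \<in> null_sets M"
  shows "sigma_finite_measure M"
proof
  let ?S = "\<lambda>i n. {x\<in>space M. inverse (real (Suc n)) \<le> f i x}"
  let ?A = "insert N ((\<lambda>(i,n). ?S i n) ` (I \<times> UNIV))"
  have m: "?S i n \<in> sets M" if "i \<in> I" for i n
    using borel_measurable_integrable[OF f[OF that]] by measurable
  have "emeasure M (?S i n) \<noteq> \<infinity>" if "i \<in> I" for i n
  proof -
    let ?c = "inverse (real (Suc n))"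
    note [measurable] = borel_measurable_integrable[OF f[OF that]]
    have "ennreal ?c * emeasure M (?S i n) = (\<integral>\<^sup>+x. ennreal ?c * indicator (?S i n) x \<partial>M)"
      by (simp add: nn_integral_cmult_indicator)
    also have "\<dots> \<le> (\<integral>\<^sup>+x. ennreal (norm (f i x)) \<partial>M)"
      by (intro nn_integral_mono) (auto simp: indicator_def intro!: ennreal_leI)
    also have "\<dots> < \<infinity>" using f[OF that] by (simp add: integrable_iff_bounded)
    finally show ?thesis by (auto simp: ennreal_mult_eq_top_iff ennreal_mult_less_top)
  qed
  then have fin: "\<forall>a\<in>?A. emeasure M a \<noteq> \<infinity>" using N by (auto simp: null_sets_def)
  have "space M \<subseteq> \<Union> ?A"
  proof
    fix x assume x: "x \<in> space M"
    show "x \<in> \<Union> ?A"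
    proof (cases "x \<in> N")
      case False
      then obtain i where i: "i \<in> I" "0 < f i x" using pos x by blast
      from reals_Archimedean[OF i(2)] obtain n where "inverse (real (Suc n)) < f i x" by auto
      then have "x \<in> ?S i n" using x by auto
      then show ?thesis using i(1) by (intro UnionI[of "?S i n"]) auto
    qed auto
  qed
  moreover have sub: "?A \<subseteq> sets M" using N m by auto
  moreover have "\<Union> ?A \<subseteq> space M" using sub sets.sets_into_space by blast
  ultimately show "\<exists>A. countable A \<and> A \<subseteq> sets M \<and> \<Union> A = space M \<and> (\<forall>a\<in>A. emeasure M a \<noteq> \<infinity>)"
    using fin I by (intro exI[of _ ?A]) auto
qed

section \<open>Regular variation\<close>

lemma dyadic_cell:
  assumes "1 \<le> (x::real)" obtains n where "2 ^ n \<le> x" "x < 2 ^ Suc n"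
proof -
  define n where "n = nat \<lfloor>log 2 x\<rfloor>"
  have "real n = real_of_int \<lfloor>log 2 x\<rfloor>" using assms by (simp add: n_def)
  then have n: "real n \<le> log 2 x" "log 2 x < real n + 1" by linarith+
  have "2 powr real n \<le> x" using n(1) assms by (simp add: powr_le_iff)
  moreover have "x < 2 powr (real (Suc n))" using n(2) assms by (simp add: less_powr_iff)
  ultimately show ?thesis using that[of n] by (simp add: powr_realpow powr_add)
qed

locale reg_var_mono =
  fixes V :: "real \<Rightarrow> real" and \<alpha> :: real
  assumes mono_V: "mono V" and nonneg_V: "\<And>x. 0 \<le> V x"
    and rv: "regularly_varying V \<alpha>" and alpha_pos: "0 < \<alpha>"
begin

lemma ratio_tendsto: "0 < c \<Longrightarrow> ((\<lambda>s. V (c * s) / V s) \<longlongrightarrow> c powr \<alpha>) at_top"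
  using rv by (simp add: regularly_varying_def)

lemma ev_pos: "\<exists>s0>0. \<forall>s\<ge>s0. 0 < V s"
proof -
  have "eventually (\<lambda>s. V (1 * s) / V s > 0) at_top"
    by (rule order_tendstoD[OF ratio_tendsto[of 1]]) auto
  then obtain s0 where "\<And>s. s \<ge> s0 \<Longrightarrow> V s / V s > 0"
    unfolding eventually_at_top_linorder by auto
  then have "0 < V s" if "s \<ge> max s0 1" for s
    using nonneg_V[of s] that by (cases "V s = 0") force+
  then show ?thesis by (intro exI[of _ "max s0 1"]) auto
qed

text \<open>Regular variation bounds \<open>V(2s) / V(s)\<close> by \<open>2\<^sup>\<gamma>\<close> for large \<open>s\<close>. Iterating over dyadic scales and
  filling the gaps by monotonicity costs one more factor \<open>2\<^sup>\<gamma>\<close>. The lower bound is obtained in the same way.\<close>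

lemma potter_upper:
  assumes "\<alpha> < \<gamma>"
  obtains s0 where "0 < s0" "\<And>s. s \<ge> s0 \<Longrightarrow> 0 < V s"
    "\<And>s x. s \<ge> s0 \<Longrightarrow> 1 \<le> x \<Longrightarrow> V (s * x) \<le> 2 powr \<gamma> * x powr \<gamma> * V s"
proof -
  from ev_pos obtain s1 where s1: "s1 > 0" "\<And>s. s \<ge> s1 \<Longrightarrow> 0 < V s" by auto
  have "eventually (\<lambda>s. V (2 * s) / V s < 2 powr \<gamma>) at_top"
    by (rule order_tendstoD[OF ratio_tendsto[of 2]]) (use assms in auto)
  then obtain s2 where s2: "\<And>s. s \<ge> s2 \<Longrightarrow> V (2 * s) / V s < 2 powr \<gamma>"
    unfolding eventually_at_top_linorder by auto
  define s0 where "s0 = max s1 s2"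
  have pos: "0 < V s" if "s \<ge> s0" for s using that s1 by (auto simp: s0_def)
  have s0: "s0 > 0" using s1 by (auto simp: s0_def)
  have iter: "V (2 ^ n * s) \<le> (2 powr \<gamma>) ^ n * V s" if "s \<ge> s0" for s n
  proof (induction n)
    case (Suc n)
    have "1 * s \<le> 2 ^ n * s" using that s0 by (intro mult_right_mono) auto
    then have ge: "2 ^ n * s \<ge> s0" using that by simp
    then have "V (2 * (2 ^ n * s)) \<le> 2 powr \<gamma> * V (2 ^ n * s)"
      using s2[of "2^n * s"] pos[OF ge] by (auto simp: s0_def field_simps)
    also have "\<dots> \<le> 2 powr \<gamma> * ((2 powr \<gamma>) ^ n * V s)"
      using Suc by (intro mult_left_mono) auto
    finally show ?case by (simp add: mult_ac)
  qed simp
  show ?thesis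
  proof (rule that[of s0])
    fix s x :: real assume s: "s \<ge> s0" and x: "1 \<le> x"
    from dyadic_cell[OF x] obtain n where n: "2 ^ n \<le> x" "x < 2 ^ Suc n" .
    have "\<gamma> > 0" using assms alpha_pos by simp
    have "V (s * x) \<le> V (2 ^ Suc n * s)"
      using n(2) s s0 by (intro monoD[OF mono_V]) (simp add: mult.commute)
    also have "\<dots> \<le> (2 powr \<gamma>) ^ Suc n * V s" by (rule iter[OF s])
    also have "(2 powr \<gamma>) ^ Suc n = 2 powr \<gamma> * (2 ^ n) powr \<gamma>"
      by (simp add: powr_powr powr_realpow[symmetric] mult.commute flip: powr_realpow)
    also have "2 powr \<gamma> * (2 ^ n) powr \<gamma> * V s \<le> 2 powr \<gamma> * x powr \<gamma> * V s"
      using n(1) \<open>\<gamma> > 0\<close> nonneg_V by (intro mult_right_mono mult_left_mono powr_mono2) auto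
    finally show "V (s * x) \<le> 2 powr \<gamma> * x powr \<gamma> * V s" .
  qed (use s0 pos in auto)
qed

lemma potter_lower:
  assumes "\<gamma> < \<alpha>" "0 \<le> \<gamma>"
  obtains s0 where "0 < s0" "\<And>s. s \<ge> s0 \<Longrightarrow> 0 < V s"
    "\<And>s x. s \<ge> s0 \<Longrightarrow> 1 \<le> x \<Longrightarrow> x powr \<gamma> * V s \<le> 2 powr \<gamma> * V (s * x)"
proof -
  from ev_pos obtain s1 where s1: "s1 > 0" "\<And>s. s \<ge> s1 \<Longrightarrow> 0 < V s" by auto
  have "eventually (\<lambda>s. V (2 * s) / V s > 2 powr \<gamma>) at_top"
    by (rule order_tendstoD[OF ratio_tendsto[of 2]]) (use assms in auto)
  then obtain s2 where s2: "\<And>s. s \<ge> s2 \<Longrightarrow> V (2 * s) / V s > 2 powr \<gamma>"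
    unfolding eventually_at_top_linorder by auto
  define s0 where "s0 = max s1 s2"
  have pos: "0 < V s" if "s \<ge> s0" for s using that s1 by (auto simp: s0_def)
  have s0: "s0 > 0" using s1 by (auto simp: s0_def)
  have iter: "(2 powr \<gamma>) ^ n * V s \<le> V (2 ^ n * s)" if "s \<ge> s0" for s n
  proof (induction n)
    case (Suc n)
    have "1 * s \<le> 2 ^ n * s" using that s0 by (intro mult_right_mono) auto
    then have ge: "2 ^ n * s \<ge> s0" using that by simp
    have "2 powr \<gamma> * ((2 powr \<gamma>) ^ n * V s) \<le> 2 powr \<gamma> * V (2 ^ n * s)"
      using Suc by (intro mult_left_mono) auto
    also have "\<dots> \<le> V (2 * (2 ^ n * s))"
      using s2[of "2^n * s"] ge pos[OF ge] by (auto simp: s0_def field_simps)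
    finally show ?case by (simp add: mult_ac)
  qed simp
  show ?thesis
  proof (rule that[of s0])
    fix s x :: real assume s: "s \<ge> s0" and x: "1 \<le> x"
    from dyadic_cell[OF x] obtain n where n: "2 ^ n \<le> x" "x < 2 ^ Suc n" .
    have "x powr \<gamma> * V s \<le> (2 ^ Suc n) powr \<gamma> * V s"
      using n x assms nonneg_V by (intro mult_right_mono powr_mono2) auto
    also have "(2 ^ Suc n) powr \<gamma> = 2 powr \<gamma> * (2 powr \<gamma>) ^ n"
      by (simp add: powr_mult powr_powr powr_realpow[symmetric] mult.commute flip: powr_realpow)
    also have "2 powr \<gamma> * (2 powr \<gamma>) ^ n * V s \<le> 2 powr \<gamma> * V (2 ^ n * s)"
      using iter[OF s, of n] by simp
    also have "\<dots> \<le> 2 powr \<gamma> * V (s * x)"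
      using n(1) s s0 by (intro mult_left_mono monoD[OF mono_V]) (auto simp: mult.commute)
    finally show "x powr \<gamma> * V s \<le> 2 powr \<gamma> * V (s * x)" .
  qed (use s0 pos in auto)
qed

lemma V_unbounded: "\<exists>x>0. y \<le> V x"
proof -
  obtain s0 where s0: "0 < s0" "\<And>s. s \<ge> s0 \<Longrightarrow> 0 < V s"
    "\<And>s x. s \<ge> s0 \<Longrightarrow> 1 \<le> x \<Longrightarrow> x powr (\<alpha>/2) * V s \<le> 2 powr (\<alpha>/2) * V (s * x)"
    using potter_lower[of "\<alpha>/2"] alpha_pos by auto
  define z where "z = max 1 (2 powr (\<alpha>/2) * y / V s0)"
  define x where "x = z powr (2 / \<alpha>)"
  have "z \<ge> 1" by (simp add: z_def)
  then have x: "x powr (\<alpha>/2) \<ge> 2 powr (\<alpha>/2) * y / V s0" "x \<ge> 1"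
    using alpha_pos by (auto simp: x_def powr_powr z_def ge_one_powr_ge_zero)
  have "2 powr (\<alpha>/2) * y \<le> x powr (\<alpha>/2) * V s0" using x(1) s0(2)[of s0] by (simp add: field_simps)
  also have "\<dots> \<le> 2 powr (\<alpha>/2) * V (s0 * x)" using s0(3)[of s0 x] x by simp
  finally have "y \<le> V (s0 * x)" by simp
  then show ?thesis using s0 x by (intro exI[of _ "s0 * x"]) auto
qed

lemma gen_inverse_bounds:
  shows "x > gen_inverse V y \<Longrightarrow> y \<le> V x" and "0 \<le> x \<Longrightarrow> x < gen_inverse V y \<Longrightarrow> V x < y"
proof -
  let ?S = "{x. 0 \<le> x \<and> V x \<ge> y}"
  have ne: "?S \<noteq> {}" using V_unbounded[of y] by force
  have bdd: "bdd_below ?S" by (rule bdd_belowI[of _ 0]) auto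
  show "y \<le> V x" if "x > gen_inverse V y"
  proof -
    have "\<exists>z\<in>?S. z < x"
      using that unfolding gen_inverse_def cInf_less_iff[OF ne bdd] .
    then obtain z where "z \<in> ?S" "z < x" by blast
    then show ?thesis using monoD[OF mono_V, of z x] by auto
  qed
  show "V x < y" if "0 \<le> x" "x < gen_inverse V y"
  proof (rule ccontr)
    assume "\<not> V x < y"
    then have "x \<in> ?S" using that by auto
    then show False using cInf_lower[OF _ bdd, of x] that by (auto simp: gen_inverse_def)
  qed
qed

lemma gen_inverse_at_top: "filterlim (\<lambda>t. gen_inverse V (1 / t)) at_top (at_right 0)"
  unfolding filterlim_at_top
proof
  fix Z :: real
  have "filterlim (\<lambda>t::real. 1 / t) at_top (at_right 0)"
    by (simp add: filterlim_inverse_at_top_right flip: inverse_eq_divide)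
  then have "eventually (\<lambda>t. V Z < 1 / t) (at_right 0)"
    by (simp add: filterlim_at_top_dense)
  then show "eventually (\<lambda>t. Z \<le> gen_inverse V (1 / t)) (at_right 0)"
    by eventually_elim (use gen_inverse_bounds(1) in \<open>force simp: not_le[symmetric]\<close>)
qed

text \<open>\<open>V\<close> may jump over the value \<open>1/t\<close> at \<open>u = V\<^sup>-(1/t)\<close>, but \<open>V(cu) < 1/t \<le> V(c'u)\<close> whenever
  \<open>c < 1 < c'\<close>, and both \<open>V(cu)\<close> and \<open>V(c'u)\<close> are comparable with \<open>V(u)\<close> up to factors that tend to 1
  with \<open>c\<close> and \<open>c'\<close>.\<close>

lemma V_gen_inverse: "((\<lambda>t. t * V (gen_inverse V (1 / t))) \<longlongrightarrow> 1) (at_right 0)"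
proof (rule order_tendstoI)
  let ?u = "\<lambda>t. gen_inverse V (1 / t)"
  have lim: "((\<lambda>t. V (c * ?u t) / V (?u t)) \<longlongrightarrow> c powr \<alpha>) (at_right 0)" if "c > 0" for c
    by (rule filterlim_compose[OF ratio_tendsto[OF that] gen_inverse_at_top])
  have ev: "eventually (\<lambda>t. t > 0 \<and> ?u t > 0 \<and> V (?u t) > 0) (at_right 0)"
  proof -
    obtain s0 where s0: "s0 > 0" "\<And>s. s \<ge> s0 \<Longrightarrow> V s > 0" using ev_pos by auto
    have "eventually (\<lambda>t. ?u t \<ge> s0) (at_right 0)"
      using gen_inverse_at_top by (simp add: filterlim_at_top)
    with eventually_at_right_less[of 0] show ?thesis by eventually_elim (use s0 in force)
  qed
  have powr_near: "\<exists>c. P c \<and> c powr \<alpha> \<in> A" if "open A" "1 \<in> A" "eventually P (at 1 within T)"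
    "at 1 within T \<noteq> bot" for P A T
  proof -
    have "((\<lambda>c. c powr \<alpha>) \<longlongrightarrow> 1 powr \<alpha>) (at 1 within T)" by (intro tendsto_intros) auto
    then have "eventually (\<lambda>c. c powr \<alpha> \<in> A) (at 1 within T)"
      using that by (intro topological_tendstoD) auto
    from eventually_happens'[OF that(4) eventually_conj[OF that(3) this]] show ?thesis by auto
  qed
  fix a :: real
  {
    assume a: "a < 1"
    obtain c where c: "1 < c" "c powr \<alpha> \<in> {x. a * x < 1 \<and> x > 0}"
    proof -
      have "open {x::real. a * x < 1 \<and> x > 0}" by (intro open_Collect_conj open_Collect_less continuous_intros)
      then have "\<exists>c. (1::real) < c \<and> c powr \<alpha> \<in> {x. a * x < 1 \<and> x > 0}" using a
        by (intro powr_near[of _ _ "{1<..}"]) (auto simp: eventually_at_right_less)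
      then show ?thesis using that by auto
    qed
    have "((\<lambda>t. a * (V (c * ?u t) / V (?u t))) \<longlongrightarrow> a * c powr \<alpha>) (at_right 0)"
      using c by (intro tendsto_intros lim) auto
    then have "eventually (\<lambda>t. a * (V (c * ?u t) / V (?u t)) < 1) (at_right 0)"
      using c by (intro order_tendstoD) auto
    with ev show "eventually (\<lambda>t. a < t * V (?u t)) (at_right 0)"
    proof eventually_elim
      case (elim t)
      have 1: "1 / t \<le> V (c * ?u t)" using c elim by (intro gen_inverse_bounds) auto
      show ?case
      proof (cases "a \<le> 0")
        case True
        have "0 < t * V (?u t)" using elim by simp
        then show ?thesis using True by linarith
      next
        case False
        have "a * (1 / t) \<le> a * V (c * ?u t)" using 1 False by (intro mult_left_mono) auto
        also have "\<dots> < V (?u t)" using elim by (simp add: field_simps)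
        finally show ?thesis using elim by (simp add: field_simps)
      qed
    qed
  next
    assume a: "1 < a"
    obtain c where c: "0 < c" "c < 1" "c powr \<alpha> \<in> {x. a * x > 1}"
    proof -
      have "open {x::real. a * x > 1}" by (intro open_Collect_less continuous_intros)
      moreover have "eventually (\<lambda>c::real. 0 < c \<and> c < 1) (at_left 1)"
        by (auto simp: eventually_at_left[of 0 "1::real"] intro: exI[of _ 0])
      ultimately have "\<exists>c. (0 < c \<and> c < 1) \<and> c powr \<alpha> \<in> {x. a * x > 1}" using a
        by (intro powr_near[of _ _ "{..<1}"]) auto
      then show ?thesis using that by auto
    qed
    have "((\<lambda>t. a * (V (c * ?u t) / V (?u t))) \<longlongrightarrow> a * c powr \<alpha>) (at_right 0)"
      using c by (intro tendsto_intros lim) auto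
    then have "eventually (\<lambda>t. a * (V (c * ?u t) / V (?u t)) > 1) (at_right 0)"
      using c by (intro order_tendstoD) auto
    with ev show "eventually (\<lambda>t. t * V (?u t) < a) (at_right 0)"
    proof eventually_elim
      case (elim t)
      have 1: "V (c * ?u t) < 1 / t" using c elim by (intro gen_inverse_bounds) auto
      have "V (?u t) < a * V (c * ?u t)" using elim by (simp add: field_simps)
      also have "\<dots> < a * (1 / t)" using 1 a by (intro mult_strict_left_mono) auto
      finally show ?case using elim by (simp add: field_simps)
    qed
  }
qed

end

section \<open>Gaussian integrals and Fourier inversion\<close>

lemma
  fixes f :: "'a::euclidean_space \<Rightarrow> real \<Rightarrow> 'b::{real_normed_field,banach,second_countable_topology}"
  assumes f: "\<And>b. b \<in> Basis \<Longrightarrow> integrable lborel (f b)"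
  shows integrable_lborel_prod: "integrable lborel (\<lambda>x::'a. \<Prod>b\<in>Basis. f b (x \<bullet> b))"
    and integral_lborel_prod:
      "(\<integral>x. (\<Prod>b\<in>Basis. f b ((x::'a) \<bullet> b)) \<partial>lborel) = (\<Prod>b\<in>Basis. \<integral>t. f b t \<partial>lborel)"
proof -
  interpret product_sigma_finite "\<lambda>_::'a. lborel::real measure" by standard
  have [measurable]: "f b \<in> borel_measurable borel" if "b \<in> Basis" for b
    using borel_measurable_integrable[OF f[OF that]] by simp
  let ?T = "\<lambda>x. \<Sum>b\<in>Basis. x b *\<^sub>R (b::'a)"
  have T[measurable]: "?T \<in> measurable (\<Pi>\<^sub>M b\<in>Basis. lborel) borel" by measurable
  have eq: "(\<Prod>b\<in>Basis. f b (?T x \<bullet> b)) = (\<Prod>b\<in>Basis. f b (x b))" for x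
    by (intro prod.cong refl) simp
  have m: "(\<lambda>x::'a. \<Prod>b\<in>Basis. f b (x \<bullet> b)) \<in> borel_measurable borel" by measurable
  show "integrable lborel (\<lambda>x::'a. \<Prod>b\<in>Basis. f b (x \<bullet> b))"
    unfolding lborel_eq[where 'a='a] using m f
    by (subst integrable_distr_eq[OF T m]) (auto simp: eq intro!: product_integrable_prod)
  show "(\<integral>x. (\<Prod>b\<in>Basis. f b ((x::'a) \<bullet> b)) \<partial>lborel) = (\<Prod>b\<in>Basis. \<integral>t. f b t \<partial>lborel)"
    unfolding lborel_eq[where 'a='a] using f
    by (subst integral_distr[OF T m]) (simp add: eq product_integral_prod)
qed

text \<open>\<open>|x|\<close> dominates the mean of the coordinates' absolute values, so the function lies below a product
  of one-dimensional exponentials.\<close>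

lemma integrable_exp_neg_norm:
  assumes "0 < c"
  shows "integrable lborel (\<lambda>x::'a::euclidean_space. exp (- c * norm x))"
proof (rule Bochner_Integration.integrable_bound)
  define a where "a = c / DIM('a)"
  have a: "0 < a" using assms by (simp add: a_def)
  have 1: "integrable lborel (\<lambda>t::real. exp (- a * \<bar>t\<bar>))"
  proof (rule Bochner_Integration.integrable_bound)
    have "integrable lborel (\<lambda>t::real. inverse (1 + t\<^sup>2))"
      using integrable_inverse_1_plus_square by (simp add: set_integrable_def)
    then show "integrable lborel (\<lambda>t::real. (1 + 2 / a\<^sup>2) * inverse (1 + t\<^sup>2))" by simp
    show "AE t in lborel. norm (exp (- a * \<bar>t\<bar>)) \<le> norm ((1 + 2 / a\<^sup>2) * inverse (1 + t\<^sup>2))"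
    proof (rule AE_I2)
      fix t :: real
      have "1 + t\<^sup>2 \<le> (1 + 2 / a\<^sup>2) * (1 + a * \<bar>t\<bar> + (a * \<bar>t\<bar>)\<^sup>2 / 2)"
        using a by (simp add: power_mult_distrib field_simps)
      also have "\<dots> \<le> (1 + 2 / a\<^sup>2) * exp (a * \<bar>t\<bar>)"
        using exp_lower_Taylor_quadratic[of "a * \<bar>t\<bar>"] a by (intro mult_left_mono) auto
      finally show "norm (exp (- a * \<bar>t\<bar>)) \<le> norm ((1 + 2 / a\<^sup>2) * inverse (1 + t\<^sup>2))"
        by (simp add: exp_minus field_simps abs_of_pos add_pos_nonneg)
    qed
  qed simp
  show "integrable lborel (\<lambda>x::'a. \<Prod>b\<in>Basis. exp (- a * \<bar>x \<bullet> b\<bar>))"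
    by (rule integrable_lborel_prod[OF 1])
  show "AE x::'a in lborel. norm (exp (- c * norm x)) \<le> norm (\<Prod>b\<in>Basis. exp (- a * \<bar>x \<bullet> b\<bar>))"
  proof (rule AE_I2)
    fix x :: 'a
    have "(\<Sum>b\<in>Basis. a * \<bar>x \<bullet> b\<bar>) \<le> (\<Sum>b\<in>(Basis::'a set). a * norm x)"
      using a by (intro sum_mono mult_left_mono Basis_le_norm) auto
    also have "\<dots> = c * norm x" by (simp add: a_def)
    finally show "norm (exp (- c * norm x)) \<le> norm (\<Prod>b\<in>Basis. exp (- a * \<bar>x \<bullet> b\<bar>))"
      by (simp add: exp_sum[symmetric] abs_prod sum_negf)
  qed
qed simp

text \<open>The standard normal density on a Euclidean space. The closed form is what scaling arguments use; the
  product over the coordinates is \<open>gauss_eq_prod\<close>.\<close>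

definition gauss :: "'a::euclidean_space \<Rightarrow> real" where
  "gauss x = (2 * pi) powr (- (DIM('a) / 2)) * exp (- (norm x)\<^sup>2 / 2)"

lemma borel_measurable_gauss[measurable]: "gauss \<in> borel_measurable borel"
  unfolding gauss_def by measurable

lemma gauss_pos: "0 < gauss x" by (simp add: gauss_def)

lemma norm_sq_coord: "(norm x)\<^sup>2 = (\<Sum>b\<in>Basis. (x \<bullet> b)\<^sup>2)"
  unfolding power2_norm_eq_inner by (subst euclidean_inner) (simp add: power2_eq_square)

lemma abs_gauss[simp]: "\<bar>gauss x\<bar> = gauss x"
  using gauss_pos[of x] by simp

lemma gauss_scaled:
  "(2 * pi) powr (DIM('a) / 2) * gauss (z::'a::euclidean_space) = exp (- (norm z)\<^sup>2 / 2)"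
  by (simp add: gauss_def powr_minus)

lemma cos_gauss_le: "\<bar>cos s\<bar> * gauss x \<le> gauss x"
  using mult_mono[of "\<bar>cos s\<bar>" 1 "gauss x" "gauss x"] gauss_pos[of x] by simp

lemma gauss_le_0: "gauss (x::'a::euclidean_space) \<le> gauss (0::'a)"
  by (simp add: gauss_def)

lemma gauss_eq_prod: "gauss (x::'a::euclidean_space) = (\<Prod>b\<in>Basis. std_normal_density (x \<bullet> b))"
proof -
  have "(\<Prod>b\<in>Basis. std_normal_density (x \<bullet> b))
    = (\<Prod>b\<in>(Basis::'a set). (2*pi) powr (-(1/2))) * (\<Prod>b\<in>Basis. exp (- (x \<bullet> b)\<^sup>2 / 2))"
    by (simp add: std_normal_density_def prod.distrib prod_dividef power_one_over powr_minus_divide powr_half_sqrt)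
  also have "(\<Prod>b\<in>(Basis::'a set). (2*pi) powr (-(1/2))) = (2 * pi) powr (- (DIM('a) / 2))"
    by (simp add: powr_powr powr_realpow[symmetric] mult.commute flip: powr_realpow)
  also have "(\<Prod>b\<in>Basis. exp (- (x \<bullet> b)\<^sup>2 / 2)) = exp (- (norm x)\<^sup>2 / 2)"
    by (simp add: exp_sum[symmetric] sum_negf sum_divide_distrib[symmetric]
        norm_sq_coord)
  finally show ?thesis by (simp add: gauss_def)
qed

lemma integrable_gauss: "integrable lborel (gauss :: 'a::euclidean_space \<Rightarrow> real)"
  unfolding gauss_eq_prod[abs_def] by (rule integrable_lborel_prod) simp

lemma integral_gauss: "(\<integral>x. gauss (x::'a::euclidean_space) \<partial>lborel) = 1"
  unfolding gauss_eq_prod[abs_def] by (subst integral_lborel_prod) simp_all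

lemma gauss_fourier: "(\<integral>x. cos (z \<bullet> x) * gauss x \<partial>lborel) = exp (- (norm z)\<^sup>2 / 2)"
  for z :: "'a::euclidean_space"
proof -
  have int: "integrable lborel (\<lambda>t. iexp ((z \<bullet> b) * t) * of_real (std_normal_density t))" for b
    by (rule Bochner_Integration.integrable_bound[of _ std_normal_density]) (auto simp: norm_mult)
  have 1: "(\<integral>t. iexp (s * t) * of_real (std_normal_density t) \<partial>lborel) = of_real (exp (- s\<^sup>2 / 2))" for s
  proof -
    have "char std_normal_distribution s = (\<integral>t. std_normal_density t *\<^sub>R iexp (s * t) \<partial>lborel)"
      unfolding char_def by (subst integral_density) (auto simp: normal_density_nonneg)
    then show ?thesis by (simp add: char_std_normal_distribution scaleR_conv_of_real mult.commute)
  qed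
  have eq: "(\<Prod>b\<in>Basis. iexp ((z \<bullet> b) * (x \<bullet> b)) * of_real (std_normal_density (x \<bullet> b))) = iexp (z \<bullet> x) * of_real (gauss x)" for x
    by (simp add: gauss_eq_prod prod.distrib exp_sum[symmetric] euclidean_inner[of z x] sum_distrib_left)
  have "(\<integral>x. iexp (z \<bullet> x) * of_real (gauss x) \<partial>lborel) = (\<Prod>b\<in>Basis. of_real (exp (- (z \<bullet> b)\<^sup>2 / 2)))"
    unfolding eq[symmetric] by (subst integral_lborel_prod[OF int]) (intro prod.cong refl 1)
  also have "\<dots> = of_real (exp (- (norm z)\<^sup>2 / 2))"
    by (simp add: exp_sum[symmetric] sum_negf sum_divide_distrib[symmetric] of_real_prod[symmetric]
        norm_sq_coord del: of_real_prod)
  finally have *: "(\<integral>x. iexp (z \<bullet> x) * of_real (gauss x) \<partial>lborel) = of_real (exp (- (norm z)\<^sup>2 / 2))" .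
  have "integrable lborel (\<lambda>x. iexp (z \<bullet> x) * of_real (gauss x))"
    by (rule Bochner_Integration.integrable_bound[OF integrable_gauss]) (auto simp: norm_mult)
  from integral_Re[OF this, unfolded *] show ?thesis by (simp add: Re_exp)
qed


lemma abs_integral_le:
  fixes f :: "'a \<Rightarrow> real"
  assumes k: "integrable M k" and le: "\<And>x. \<bar>f x\<bar> \<le> k x"
  shows "\<bar>\<integral>x. f x \<partial>M\<bar> \<le> (\<integral>x. k x \<partial>M)"
proof (cases "integrable M f")
  case True
  have "\<bar>\<integral>x. f x \<partial>M\<bar> \<le> (\<integral>x. \<bar>f x\<bar> \<partial>M)" by (rule integral_abs_bound)
  also have "\<dots> \<le> (\<integral>x. k x \<partial>M)" using True k le by (intro integral_mono) auto
  finally show ?thesis .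
next
  case False
  have "0 \<le> k x" for x using le[of x] abs_ge_zero[of "f x"] by linarith
  then show ?thesis using False by (simp add: not_integrable_integral_eq)
qed

lemma integral_lborel_affine:
  fixes f :: "'a::euclidean_space \<Rightarrow> real"
  assumes [measurable]: "f \<in> borel_measurable borel" and c: "c \<noteq> 0"
  shows "(\<integral>x. f x \<partial>lborel) = \<bar>c\<bar> ^ DIM('a) * (\<integral>x. f (t + c *\<^sub>R x) \<partial>lborel)"
proof -
  have "(\<integral>x. f x \<partial>lborel) = (\<integral>x. f x \<partial>density (distr lborel borel (\<lambda>x. t + c *\<^sub>R x)) (\<lambda>_. \<bar>c\<bar> ^ DIM('a)))"
    using lborel_affine[OF c, of t] by (simp only:)
  also have "\<dots> = (\<integral>x. \<bar>c\<bar> ^ DIM('a) *\<^sub>R f x \<partial>distr lborel borel (\<lambda>x. t + c *\<^sub>R x))"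
    by (rule integral_density) auto
  also have "\<dots> = (\<integral>x. \<bar>c\<bar> ^ DIM('a) *\<^sub>R f (t + c *\<^sub>R x) \<partial>lborel)"
    by (rule integral_distr) auto
  finally show ?thesis by simp
qed

lemma integrable_lborel_affine:
  fixes f :: "'a::euclidean_space \<Rightarrow> real"
  assumes f: "integrable lborel f" and c: "c \<noteq> 0"
  shows "integrable lborel (\<lambda>x. f (t + c *\<^sub>R x))"
proof -
  have [measurable]: "f \<in> borel_measurable borel" using borel_measurable_integrable[OF f] by simp
  have "integrable (density (distr lborel borel (\<lambda>x. t + c *\<^sub>R x)) (\<lambda>_. \<bar>c\<bar> ^ DIM('a))) f"
    using f lborel_affine[OF c, of t] by (simp only:)
  then have "integrable (distr lborel borel (\<lambda>x. t + c *\<^sub>R x)) (\<lambda>x. \<bar>c\<bar> ^ DIM('a) *\<^sub>R f x)"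
    by (subst (asm) integrable_density) auto
  then have "integrable lborel (\<lambda>x. \<bar>c\<bar> ^ DIM('a) *\<^sub>R f (t + c *\<^sub>R x))"
    by (subst (asm) integrable_distr_eq) auto
  then show ?thesis using c by simp
qed

text \<open>One factor is a finite measure in every use below, so a bound that depends on the other variable
  alone makes the integrand integrable for the product.\<close>

lemma Fubini_dominated:
  fixes F :: "'a \<Rightarrow> 'b \<Rightarrow> real"
  assumes P: "finite_measure P" and N: "sigma_finite_measure N"
    and F: "case_prod F \<in> borel_measurable (P \<Otimes>\<^sub>M N)"
    and k: "integrable N k" "\<And>y x. \<bar>F y x\<bar> \<le> k x"
  shows "(\<integral>x. \<integral>y. F y x \<partial>P \<partial>N) = (\<integral>y. \<integral>x. F y x \<partial>N \<partial>P)"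
proof -
  interpret P: finite_measure P by fact
  interpret N: sigma_finite_measure N by fact
  interpret pair_sigma_finite P N by standard
  note [measurable] = F
  have i: "integrable N (F y)" if "y \<in> space P" for y
    using that k by (intro Bochner_Integration.integrable_bound[OF k(1)]) (auto intro!: AE_I2 order_trans[OF k(2) abs_ge_self])
  have m: "(\<lambda>y. \<integral>x. norm (F y x) \<partial>N) \<in> borel_measurable P" by measurable
  have "integrable (P \<Otimes>\<^sub>M N) (case_prod F)"
  proof (rule Fubini_integrable[OF F])
    have "norm (\<integral>x. norm (F y x) \<partial>N) \<le> (\<integral>x. k x \<partial>N)" if "y \<in> space P" for y
      using i[OF that] k by (auto intro!: integral_mono simp: integral_nonneg_AE)
    then show "integrable P (\<lambda>y. \<integral>x. norm (case (y, x) of (y, x) \<Rightarrow> F y x) \<partial>N)"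
      using m by (intro P.integrable_const_bound[where B="\<integral>x. k x \<partial>N"]) auto
  qed (use i in auto)
  from Fubini_integral[OF this] show ?thesis .
qed

text \<open>The inverse Fourier transform for real characteristic functions. Those are even, so only the cosine
  part survives, and the transform is real and even by construction.\<close>

definition inv_fourier :: "('a::euclidean_space \<Rightarrow> real) \<Rightarrow> 'a \<Rightarrow> real" where
  "inv_fourier \<phi> x = (2 * pi) powr (- real DIM('a)) * (\<integral>\<xi>. cos (x \<bullet> \<xi>) * \<phi> \<xi> \<partial>lborel)"

lemma borel_measurable_inv_fourier[measurable]:
  assumes [measurable]: "\<phi> \<in> borel_measurable borel"
  shows "inv_fourier \<phi> \<in> borel_measurable borel"
  unfolding inv_fourier_def[abs_def] by measurable

lemma abs_inv_fourier_le:
  fixes \<phi> :: "'a::euclidean_space \<Rightarrow> real"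
  assumes [measurable]: "\<phi> \<in> borel_measurable borel" and k: "integrable lborel k" "\<And>\<xi>. \<bar>\<phi> \<xi>\<bar> \<le> k \<xi>"
  shows "\<bar>inv_fourier \<phi> x\<bar> \<le> (2 * pi) powr (- real DIM('a)) * (\<integral>\<xi>. k \<xi> \<partial>lborel)"
proof -
  have b: "\<bar>cos (x \<bullet> \<xi>) * \<phi> \<xi>\<bar> \<le> k \<xi>" for \<xi>
    using k(2)[of \<xi>] mult_mono[of "\<bar>cos (x \<bullet> \<xi>)\<bar>" 1 "\<bar>\<phi> \<xi>\<bar>" "k \<xi>"] by (simp add: abs_mult)
  from abs_integral_le[OF k(1) b] show ?thesis by (simp add: inv_fourier_def abs_mult)
qed

context
  fixes P :: "'a::euclidean_space measure" and \<phi> :: "'a \<Rightarrow> real"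
  assumes P: "prob_space P" and sets_P[measurable_cong, simp]: "sets P = sets borel"
    and char: "\<And>\<xi>. (\<integral>x. iexp (\<xi> \<bullet> x) \<partial>P) = of_real (\<phi> \<xi>)"
begin

interpretation prob_space P by (rule P)

lemma char_cos_sin: "(\<integral>y. cos (\<xi> \<bullet> y) \<partial>P) = \<phi> \<xi>" "(\<integral>y. sin (\<xi> \<bullet> y) \<partial>P) = 0"
proof -
  have i: "integrable P (\<lambda>x. iexp (\<xi> \<bullet> x))"
    by (rule integrable_const_bound[where B=1]) auto
  from integral_Re[OF i] integral_Im[OF i] char[of \<xi>]
  show "(\<integral>y. cos (\<xi> \<bullet> y) \<partial>P) = \<phi> \<xi>" "(\<integral>y. sin (\<xi> \<bullet> y) \<partial>P) = 0"
    by (simp_all add: Re_exp Im_exp)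
qed

lemma char_cos_shift: "(\<integral>y. cos (\<xi> \<bullet> (x - y)) \<partial>P) = cos (x \<bullet> \<xi>) * \<phi> \<xi>"
proof -
  have "integrable P (\<lambda>y. cos (\<xi> \<bullet> y))" "integrable P (\<lambda>y. sin (\<xi> \<bullet> y))"
    by (auto intro!: integrable_const_bound[where B=1])
  then show ?thesis
    using char_cos_sin[of \<xi>]
    by (simp add: inner_diff_right cos_diff inner_commute)
qed

text \<open>Averaging \<open>1 - \<phi>(\<xi> / a)\<close> over a Gaussian \<open>\<xi>\<close> gives the mean of \<open>1 - exp(- |y|\<^sup>2 / (2 a\<^sup>2))\<close>, which is at
  least \<open>1/3\<close> where \<open>|y| \<ge> a\<close>.\<close>

lemma char_tail_bound:
  assumes "0 < a"
  shows "measure P {y. a \<le> norm y} \<le> 3 * (\<integral>\<xi>. (1 - \<phi> (\<xi> /\<^sub>R a)) * gauss \<xi> \<partial>lborel)"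
proof -
  have [measurable]: "\<phi> \<in> borel_measurable borel"
  proof -
    have "(\<lambda>\<xi>. \<integral>y. cos (\<xi> \<bullet> y) \<partial>P) \<in> borel_measurable borel" by measurable
    then show ?thesis by (simp only: char_cos_sin(1))
  qed
  have "(\<integral>\<xi>. (1 - \<phi> (\<xi> /\<^sub>R a)) * gauss \<xi> \<partial>lborel)
    = (\<integral>\<xi>. \<integral>y. (1 - cos ((\<xi> /\<^sub>R a) \<bullet> y)) * gauss \<xi> \<partial>P \<partial>lborel)"
  proof (intro Bochner_Integration.integral_cong refl)
    fix \<xi> :: 'a
    have "integrable P (\<lambda>y. cos ((\<xi> /\<^sub>R a) \<bullet> y))"
      by (auto intro!: integrable_const_bound[where B=1])
    then show "(1 - \<phi> (\<xi> /\<^sub>R a)) * gauss \<xi> = (\<integral>y. (1 - cos ((\<xi> /\<^sub>R a) \<bullet> y)) * gauss \<xi> \<partial>P)"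
      using char_cos_sin(1)[of "\<xi> /\<^sub>R a"] prob_space by (simp del: inner_scaleR_left)
  qed
  also have "\<dots> = (\<integral>y. \<integral>\<xi>. (1 - cos ((\<xi> /\<^sub>R a) \<bullet> y)) * gauss \<xi> \<partial>lborel \<partial>P)"
  proof (rule Fubini_dominated)
    show "integrable lborel (\<lambda>\<xi>::'a. 2 * gauss \<xi>)" by (simp add: integrable_gauss)
    show "finite_measure P" by (rule finite_measure_axioms)
    show "sigma_finite_measure lborel" by (rule sigma_finite_lborel)
    show "(\<lambda>(y, \<xi>). (1 - cos ((\<xi> /\<^sub>R a) \<bullet> y)) * gauss \<xi>) \<in> borel_measurable (P \<Otimes>\<^sub>M lborel)"
      by measurable
    fix y \<xi> :: 'a
    have "\<bar>1 - cos ((\<xi> /\<^sub>R a) \<bullet> y)\<bar> \<le> 2" using cos_ge_minus_one[of "(\<xi> /\<^sub>R a) \<bullet> y"] cos_le_one[of "(\<xi> /\<^sub>R a) \<bullet> y"] by linarith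
    then show "\<bar>(1 - cos ((\<xi> /\<^sub>R a) \<bullet> y)) * gauss \<xi>\<bar> \<le> 2 * gauss \<xi>"
      unfolding abs_mult abs_gauss using gauss_pos[of \<xi>] by (intro mult_right_mono) auto
  qed
  also have "\<dots> = (\<integral>y. 1 - exp (- (norm y / a)\<^sup>2 / 2) \<partial>P)"
  proof (intro Bochner_Integration.integral_cong refl)
    fix y :: 'a
    have "integrable lborel (\<lambda>\<xi>::'a. cos ((y /\<^sub>R a) \<bullet> \<xi>) * gauss \<xi>)"
      by (rule Bochner_Integration.integrable_bound[OF integrable_gauss])
        (auto simp: abs_mult cos_gauss_le)
    moreover have "(1 - cos ((\<xi> /\<^sub>R a) \<bullet> y)) * gauss \<xi> = gauss \<xi> - cos ((y /\<^sub>R a) \<bullet> \<xi>) * gauss \<xi>" for \<xi>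
      by (simp add: left_diff_distrib inner_commute)
    ultimately have "(\<integral>\<xi>. (1 - cos ((\<xi> /\<^sub>R a) \<bullet> y)) * gauss \<xi> \<partial>lborel) = 1 - exp (- (norm (y /\<^sub>R a))\<^sup>2 / 2)"
      by (simp only: Bochner_Integration.integral_diff[OF integrable_gauss] gauss_fourier integral_gauss)
    moreover have "norm (y /\<^sub>R a) = norm y / a" using assms by (simp add: divide_inverse)
    ultimately show "(\<integral>\<xi>. (1 - cos ((\<xi> /\<^sub>R a) \<bullet> y)) * gauss \<xi> \<partial>lborel) = 1 - exp (- (norm y / a)\<^sup>2 / 2)"
      by (simp only:)
  qed
  also have "measure P {y. a \<le> norm y} \<le> 3 * \<dots>"
  proof -
    have e: "3 * (1 - exp (- (1 / 2))) \<ge> (1::real)"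
      using exp_ge_add_one_self[of "1/2"] by (simp add: exp_minus field_simps)
    have i: "integrable P (\<lambda>y. 1 - exp (- (norm y / a)\<^sup>2 / 2))"
      by (auto intro!: integrable_const_bound[where B=1])
    have "measure P {y. a \<le> norm y} = (\<integral>y. indicator {y. a \<le> norm y} y \<partial>P)" by simp
    also have "\<dots> \<le> (\<integral>y. 3 * (1 - exp (- (norm y / a)\<^sup>2 / 2)) \<partial>P)"
    proof (rule integral_mono, goal_cases)
      case (3 y)
      show "indicator {y. a \<le> norm y} y \<le> 3 * (1 - exp (- (norm y / a)\<^sup>2 / 2))"
      proof (cases "a \<le> norm y")
        case True
        then have "1 \<le> (norm y / a)\<^sup>2" using assms by simp
        then have "exp (- (norm y / a)\<^sup>2 / 2) \<le> exp (- (1 / 2))" by simp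
        then have "3 * (1 - exp (- (norm y / a)\<^sup>2 / 2)) \<ge> 1" using e unfolding right_diff_distrib by linarith
        then show ?thesis using True by simp
      qed auto
    next
      case 2
      show "integrable P (\<lambda>y. 3 * (1 - exp (- (norm y / a)\<^sup>2 / 2)))"
        by (rule integrable_mult_right[OF i])
    next
      case 1
      show "integrable P (indicator {y. a \<le> norm y} :: 'a \<Rightarrow> real)"
        by (intro integrable_const_bound[where B=1]) (auto simp: indicator_def)
    qed
    finally show ?thesis by (simp only: integral_mult_right_zero)
  qed
  finally show ?thesis .
qed

text \<open>Both sides are the density at \<open>x\<close> of \<open>P\<close> convolved with a centred normal law of standard deviation
  \<open>e\<close>. The Gaussian factor makes Fubini available.\<close>

lemma gauss_smoothing:
  assumes e: "0 < e" and int: "integrable lborel \<phi>"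
  shows "(2 * pi) powr (- (DIM('a) / 2)) * (\<integral>\<xi>. cos (x \<bullet> \<xi>) * \<phi> \<xi> * gauss (e *\<^sub>R \<xi>) \<partial>lborel)
    = (\<integral>y. gauss ((x - y) /\<^sub>R e) / e ^ DIM('a) \<partial>P)"
proof -
  have ig: "integrable lborel (\<lambda>\<xi>::'a. gauss (e *\<^sub>R \<xi>))"
    using integrable_lborel_affine[OF integrable_gauss, of e 0] e by simp
  have "(\<integral>\<xi>. cos (x \<bullet> \<xi>) * \<phi> \<xi> * gauss (e *\<^sub>R \<xi>) \<partial>lborel)
    = (\<integral>\<xi>. \<integral>y. cos (\<xi> \<bullet> (x - y)) * gauss (e *\<^sub>R \<xi>) \<partial>P \<partial>lborel)"
    by (simp only: char_cos_shift integral_mult_left_zero)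
  also have "\<dots> = (\<integral>y. \<integral>\<xi>. cos (\<xi> \<bullet> (x - y)) * gauss (e *\<^sub>R \<xi>) \<partial>lborel \<partial>P)"
  proof (rule Fubini_dominated[OF _ _ _ ig])
    show "\<bar>cos (\<xi> \<bullet> (x - y)) * gauss (e *\<^sub>R \<xi>)\<bar> \<le> gauss (e *\<^sub>R \<xi>)" for y \<xi>
      by (simp add: abs_mult cos_gauss_le)
  
    show "finite_measure P" by (rule finite_measure_axioms)
    show "sigma_finite_measure lborel" by (rule sigma_finite_lborel)
    show "(\<lambda>(y, \<xi>). cos (\<xi> \<bullet> (x - y)) * gauss (e *\<^sub>R \<xi>)) \<in> borel_measurable (P \<Otimes>\<^sub>M lborel)"
      by measurable
  qed
  also have "\<dots> = (\<integral>y. (2 * pi) powr (DIM('a) / 2) * (gauss ((x - y) /\<^sub>R e) / e ^ DIM('a)) \<partial>P)"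
  proof (intro Bochner_Integration.integral_cong refl)
    fix y
    have "(\<integral>\<xi>. cos (\<xi> \<bullet> (x - y)) * gauss (e *\<^sub>R \<xi>) \<partial>lborel) =
      inverse e ^ DIM('a) * (\<integral>\<xi>. cos (((x - y) /\<^sub>R e) \<bullet> \<xi>) * gauss \<xi> \<partial>lborel)"
      using e by (subst integral_lborel_affine[of _ "inverse e" 0]) (auto simp: inner_commute)
    also have "\<dots> = inverse e ^ DIM('a) * exp (- (norm ((x - y) /\<^sub>R e))\<^sup>2 / 2)"
      by (simp only: gauss_fourier)
    finally show "(\<integral>\<xi>. cos (\<xi> \<bullet> (x - y)) * gauss (e *\<^sub>R \<xi>) \<partial>lborel) = (2 * pi) powr (DIM('a) / 2) * (gauss ((x - y) /\<^sub>R e) / e ^ DIM('a))"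
      unfolding gauss_scaled[symmetric] by (simp only: divide_inverse power_inverse mult_ac)
  qed
  finally have "(\<integral>\<xi>. cos (x \<bullet> \<xi>) * \<phi> \<xi> * gauss (e *\<^sub>R \<xi>) \<partial>lborel)
    = (2 * pi) powr (DIM('a) / 2) * (\<integral>y. gauss ((x - y) /\<^sub>R e) / e ^ DIM('a) \<partial>P)"
    by (simp only: integral_mult_right_zero)
  moreover have "(2 * pi) powr (- (DIM('a) / 2)) * ((2 * pi) powr (DIM('a) / 2) * z) = z" for z
    by (simp add: mult.assoc[symmetric] powr_add[symmetric])
  ultimately show ?thesis by (simp only:)
qed

lemma gauss_smoothing_tendsto:
  assumes int: "integrable lborel \<phi>"
  shows "(\<lambda>n. \<integral>y. gauss ((x - y) /\<^sub>R (1 / real (Suc n))) / (1 / real (Suc n)) ^ DIM('a) \<partial>P) \<longlonglongrightarrow> inv_fourier \<phi> x"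
proof -
  have [measurable]: "\<phi> \<in> borel_measurable borel" using borel_measurable_integrable[OF int] by simp
  have g0: "gauss (0::'a) = (2 * pi) powr (- (DIM('a) / 2))" by (simp add: gauss_def)
  have gle: "gauss (z::'a) \<le> gauss (0::'a)" for z by (simp add: gauss_def)
  have lim0: "(\<lambda>n. gauss ((1 / real (Suc n)) *\<^sub>R \<xi>)) \<longlonglongrightarrow> gauss (0::'a)" for \<xi> :: 'a
  proof -
    have "(\<lambda>n. gauss ((1 / real (Suc n)) *\<^sub>R \<xi>)) \<longlonglongrightarrow> gauss (0 *\<^sub>R \<xi>)"
      unfolding gauss_def by (intro tendsto_intros LIMSEQ_inverse_real_of_nat[unfolded inverse_eq_divide]) auto
    then show ?thesis by simp
  qed
  have "(\<lambda>n. (\<integral>\<xi>. cos (x \<bullet> \<xi>) * \<phi> \<xi> * gauss ((1 / real (Suc n)) *\<^sub>R \<xi>) \<partial>lborel))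
    \<longlonglongrightarrow> (\<integral>\<xi>. cos (x \<bullet> \<xi>) * \<phi> \<xi> * gauss (0::'a) \<partial>lborel)"
  proof (rule integral_dominated_convergence[where w="\<lambda>\<xi>. \<bar>\<phi> \<xi>\<bar> * gauss (0::'a)"])
    show "integrable lborel (\<lambda>\<xi>. \<bar>\<phi> \<xi>\<bar> * gauss (0::'a))" using int by auto
    show "AE \<xi> in lborel. (\<lambda>n. cos (x \<bullet> \<xi>) * \<phi> \<xi> * gauss ((1 / real (Suc n)) *\<^sub>R \<xi>)) \<longlonglongrightarrow> cos (x \<bullet> \<xi>) * \<phi> \<xi> * gauss (0::'a)"
      by (intro AE_I2 tendsto_intros lim0)
    fix n
    have "\<bar>cos (x \<bullet> \<xi>) * \<phi> \<xi> * gauss ((1 / real (Suc n)) *\<^sub>R \<xi>)\<bar> \<le> (1 * \<bar>\<phi> \<xi>\<bar>) * gauss (0::'a)" for \<xi>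
      unfolding abs_mult using less_imp_le[OF gauss_pos] by (intro mult_mono) (auto simp: gauss_le_0)
    then show "AE \<xi> in lborel. norm (cos (x \<bullet> \<xi>) * \<phi> \<xi> * gauss ((1 / real (Suc n)) *\<^sub>R \<xi>)) \<le> \<bar>\<phi> \<xi>\<bar> * gauss (0::'a)"
      by simp
  qed auto
  then have "(\<lambda>n. (2 * pi) powr (- (DIM('a) / 2)) * (\<integral>\<xi>. cos (x \<bullet> \<xi>) * \<phi> \<xi> * gauss ((1 / real (Suc n)) *\<^sub>R \<xi>) \<partial>lborel))
    \<longlonglongrightarrow> (2 * pi) powr (- (DIM('a) / 2)) * (\<integral>\<xi>. cos (x \<bullet> \<xi>) * \<phi> \<xi> * gauss (0::'a) \<partial>lborel)"
    by (intro tendsto_intros)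
  also have "(2 * pi) powr (- (DIM('a) / 2)) * (\<integral>\<xi>. cos (x \<bullet> \<xi>) * \<phi> \<xi> * gauss (0::'a) \<partial>lborel) = inv_fourier \<phi> x"
    by (simp add: g0 inv_fourier_def powr_add[symmetric])
  finally show ?thesis
    by (subst (asm) gauss_smoothing[OF _ int]) auto
qed

lemma inv_fourier_nonneg: "integrable lborel \<phi> \<Longrightarrow> 0 \<le> inv_fourier \<phi> x"
  by (rule LIMSEQ_le_const[OF gauss_smoothing_tendsto])
    (auto intro!: integral_nonneg_AE divide_nonneg_nonneg AE_I2 less_imp_le[OF gauss_pos])

text \<open>Integrate \<open>h\<close> against the smoothed density and let the smoothing vanish: on the Fourier side the
  smoothed densities stay bounded and converge to \<open>inv_fourier \<phi>\<close>; on the other side \<open>h\<close> is averaged over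
  a shrinking neighbourhood.\<close>

lemma integral_inv_fourier:
  assumes int: "integrable lborel \<phi>" and h: "continuous_on UNIV h" "\<And>x. \<bar>h x\<bar> \<le> B" "integrable lborel h"
  shows "(\<integral>x. h x \<partial>P) = (\<integral>x. h x * inv_fourier \<phi> x \<partial>lborel)"
proof -
  have [measurable]: "\<phi> \<in> borel_measurable borel" using borel_measurable_integrable[OF int] by simp
  have [measurable]: "h \<in> borel_measurable borel" by (rule borel_measurable_continuous_onI[OF h(1)])
  have gle: "gauss (z::'a) \<le> gauss (0::'a)" for z by (simp add: gauss_def)
  let ?e = "\<lambda>n. 1 / real (Suc n)"
  define f where "f n x = (\<integral>y. gauss ((x - y) /\<^sub>R ?e n) / ?e n ^ DIM('a) \<partial>P)" for n x
  have [measurable]: "f n \<in> borel_measurable borel" for n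
    unfolding f_def[abs_def] by measurable
  have B: "0 \<le> B" using h(2)[of 0] by linarith
  have bd: "\<bar>f n x\<bar> \<le> (2 * pi) powr (- (DIM('a) / 2)) * ((\<integral>\<xi>. \<bar>\<phi> \<xi>\<bar> \<partial>lborel) * gauss (0::'a))" for n x
  proof -
    have b: "\<bar>cos (x \<bullet> \<xi>) * \<phi> \<xi> * gauss (?e n *\<^sub>R \<xi>)\<bar> \<le> (1 * \<bar>\<phi> \<xi>\<bar>) * gauss (0::'a)" for \<xi>
      unfolding abs_mult using less_imp_le[OF gauss_pos] by (intro mult_mono) (auto simp: gauss_le_0)
    have "\<bar>\<integral>\<xi>. cos (x \<bullet> \<xi>) * \<phi> \<xi> * gauss (?e n *\<^sub>R \<xi>) \<partial>lborel\<bar> \<le> (\<integral>\<xi>. \<bar>\<phi> \<xi>\<bar> * gauss (0::'a) \<partial>lborel)"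
      using b int by (intro abs_integral_le) auto
    then have "\<bar>(2 * pi) powr (- (DIM('a) / 2)) * (\<integral>\<xi>. cos (x \<bullet> \<xi>) * \<phi> \<xi> * gauss (?e n *\<^sub>R \<xi>) \<partial>lborel)\<bar>
       \<le> (2 * pi) powr (- (DIM('a) / 2)) * ((\<integral>\<xi>. \<bar>\<phi> \<xi>\<bar> \<partial>lborel) * gauss (0::'a))"
      by (simp add: abs_mult)
    then show ?thesis
      by (subst (asm) gauss_smoothing[OF _ int]) (auto simp: f_def)
  qed
  have "(\<lambda>n. \<integral>x. h x * f n x \<partial>lborel) \<longlonglongrightarrow> (\<integral>x. h x * inv_fourier \<phi> x \<partial>lborel)"
  proof (rule integral_dominated_convergence[where w="\<lambda>x. \<bar>h x\<bar> * ((2 * pi) powr (- (DIM('a) / 2)) * ((\<integral>\<xi>. \<bar>\<phi> \<xi>\<bar> \<partial>lborel) * gauss (0::'a)))"])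
    show "AE x in lborel. (\<lambda>n. h x * f n x) \<longlonglongrightarrow> h x * inv_fourier \<phi> x"
      unfolding f_def by (intro AE_I2 tendsto_intros gauss_smoothing_tendsto int)
    show "AE x in lborel. norm (h x * f n x) \<le> \<bar>h x\<bar> * ((2 * pi) powr (- (DIM('a) / 2)) * ((\<integral>\<xi>. \<bar>\<phi> \<xi>\<bar> \<partial>lborel) * gauss (0::'a)))" for n
      unfolding real_norm_def abs_mult by (intro AE_I2 mult_left_mono bd) auto
  qed (use h in auto)
  moreover have "(\<integral>x. h x * f n x \<partial>lborel) = (\<integral>y. \<integral>z. h (y + ?e n *\<^sub>R z) * gauss z \<partial>lborel \<partial>P)" for n
  proof -
    have "(\<integral>x. h x * f n x \<partial>lborel) = (\<integral>x. \<integral>y. h x * (gauss ((x - y) /\<^sub>R ?e n) / ?e n ^ DIM('a)) \<partial>P \<partial>lborel)"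
      by (simp add: f_def)
    also have "\<dots> = (\<integral>y. \<integral>x. h x * (gauss ((x - y) /\<^sub>R ?e n) / ?e n ^ DIM('a)) \<partial>lborel \<partial>P)"
    proof (rule Fubini_dominated[where k="\<lambda>x. \<bar>h x\<bar> * (gauss (0::'a) / ?e n ^ DIM('a))"])
      fix y x
      show "\<bar>h x * (gauss ((x - y) /\<^sub>R ?e n) / ?e n ^ DIM('a))\<bar> \<le> \<bar>h x\<bar> * (gauss (0::'a) / ?e n ^ DIM('a))"
        unfolding abs_mult abs_divide using gle gauss_pos[THEN less_imp_le]
        by (intro mult_left_mono divide_mono) auto

      show "finite_measure P" by (rule finite_measure_axioms)
      show "sigma_finite_measure lborel" by (rule sigma_finite_lborel)
      show "(\<lambda>(y, x). h x * (gauss ((x - y) /\<^sub>R ?e n) / ?e n ^ DIM('a))) \<in> borel_measurable (P \<Otimes>\<^sub>M lborel)"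
        by measurable
      show "integrable lborel (\<lambda>x. \<bar>h x\<bar> * (gauss (0::'a) / ?e n ^ DIM('a)))"
        using h(3) by (intro integrable_mult_left integrable_abs)
    qed
    also have "\<dots> = (\<integral>y. \<integral>z. h (y + ?e n *\<^sub>R z) * gauss z \<partial>lborel \<partial>P)"
    proof (rule Bochner_Integration.integral_cong[OF refl])
      fix y
      show "(\<integral>x. h x * (gauss ((x - y) /\<^sub>R ?e n) / ?e n ^ DIM('a)) \<partial>lborel) = (\<integral>z. h (y + ?e n *\<^sub>R z) * gauss z \<partial>lborel)"
        by (subst integral_lborel_affine[of _ "?e n" y]) auto
    qed
    finally show ?thesis .
  qed
  moreover have "(\<lambda>n. \<integral>y. \<integral>z. h (y + ?e n *\<^sub>R z) * gauss z \<partial>lborel \<partial>P) \<longlonglongrightarrow> (\<integral>y. h y \<partial>P)"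
  proof (rule integral_dominated_convergence[where w="\<lambda>_. B"])
    have hb: "\<bar>h (y + ?e n *\<^sub>R z) * gauss z\<bar> \<le> B * gauss z" for n y z
      unfolding abs_mult using h(2) gauss_pos[of z] B by (intro mult_mono) auto
    have "(\<lambda>n. \<integral>z. h (y + ?e n *\<^sub>R z) * gauss z \<partial>lborel) \<longlonglongrightarrow> (\<integral>z. h y * gauss (z::'a) \<partial>lborel)" for y
    proof (rule integral_dominated_convergence[where w="\<lambda>z::'a. B * gauss z"])
      have "(\<lambda>n. h (y + ?e n *\<^sub>R z)) \<longlonglongrightarrow> h y" for z
      proof (rule isCont_tendsto_compose[of y h])
        show "isCont h y" using h(1) by (simp add: continuous_on_eq_continuous_at)
        have "(\<lambda>n. y + ?e n *\<^sub>R z) \<longlonglongrightarrow> y + 0 *\<^sub>R z"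
          by (intro tendsto_intros LIMSEQ_inverse_real_of_nat[unfolded inverse_eq_divide])
        then show "(\<lambda>n. y + ?e n *\<^sub>R z) \<longlonglongrightarrow> y" by simp
      qed
      then show "AE z in lborel. (\<lambda>n. h (y + ?e n *\<^sub>R z) * gauss z) \<longlonglongrightarrow> h y * gauss z"
        by (intro AE_I2 tendsto_intros)
    qed (use hb integrable_gauss in auto)
    then show "AE y in P. (\<lambda>n. \<integral>z. h (y + ?e n *\<^sub>R z) * gauss z \<partial>lborel) \<longlonglongrightarrow> h y"
      by (simp add: integral_gauss)
    fix n
    have "\<bar>\<integral>z. h (y + ?e n *\<^sub>R z) * gauss z \<partial>lborel\<bar> \<le> B" for y
    proof -
      have "\<bar>\<integral>z. h (y + ?e n *\<^sub>R z) * gauss z \<partial>lborel\<bar> \<le> (\<integral>z. B * gauss (z::'a) \<partial>lborel)"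
        using hb integrable_gauss by (intro abs_integral_le) auto
      then show ?thesis by (simp add: integral_gauss)
    qed
    then show "AE y in P. norm (\<integral>z. h (y + ?e n *\<^sub>R z) * gauss z \<partial>lborel) \<le> B" by simp
  qed auto
  ultimately show ?thesis using LIMSEQ_unique by simp
qed

text \<open>Boxes determine a measure, and the indicator of a box is a bounded limit of continuous functions
  supported in the box.\<close>

theorem fourier_inversion:
  assumes int: "integrable lborel \<phi>"
  shows "P = density lborel (\<lambda>x. ennreal (inv_fourier \<phi> x))"
proof (rule measure_eqI_generator_eq)
  have [measurable]: "\<phi> \<in> borel_measurable borel" using borel_measurable_integrable[OF int] by simp
  let ?E = "range (\<lambda>(a, b). box a b::'a set)"
  let ?D = "density lborel (\<lambda>x. ennreal (inv_fourier \<phi> x))"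
  show "Int_stable ?E"
    by (auto simp: Int_stable_def box_Int_box)
  show "?E \<subseteq> Pow UNIV" "sets P = sigma_sets UNIV ?E" "sets ?D = sigma_sets UNIV ?E"
    by (simp_all add: borel_eq_box)
  let ?A = "\<lambda>n::nat. box (- (real n *\<^sub>R One)) (real n *\<^sub>R One) :: 'a set"
  show "range ?A \<subseteq> ?E" "(\<Union>i. ?A i) = UNIV"
    unfolding UN_box_eq_UNIV by auto
  show "emeasure P (?A i) \<noteq> \<infinity>" for i by simp
  fix U assume "U \<in> ?E"
  then obtain a b :: 'a where U: "U = box a b" by auto
  have openU: "open U" and fin: "emeasure lborel U < \<infinity>" 
    by (auto simp: U emeasure_lborel_box_eq)
  have "U \<noteq> UNIV" using not_bounded_UNIV[where 'a='a] bounded_box[of a b] by (auto simp: U)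
  then have ne: "- U \<noteq> {}" by blast
  have [measurable]: "U \<in> sets borel" using openU by simp
  \<comment> \<open>Continuous functions that increase to the indicator of \<open>U\<close>.\<close>
  define h where "h n x = min 1 (real n * infdist x (- U))" for n x
  have h_cont: "continuous_on UNIV (h n)" for n unfolding h_def by (intro continuous_intros)
  have h_bd: "\<bar>h n x\<bar> \<le> indicator U x" for n x
    by (auto simp: h_def indicator_def infdist_nonneg)
  have h_bd1: "\<bar>h n x\<bar> \<le> 1" for n x using h_bd[of n x] by (rule order_trans) (simp add: indicator_def)
  have [measurable]: "h n \<in> borel_measurable borel" for n by (rule borel_measurable_continuous_onI[OF h_cont])
  have h_lim: "(\<lambda>n. h n x) \<longlonglongrightarrow> indicator U x" for x
  proof (cases "x \<in> U")
    case True
    then have d: "0 < infdist x (- U)" using openU ne by (intro infdist_pos_not_in_closed) auto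
    obtain N where N: "real N * infdist x (- U) > 1" using d reals_Archimedean3 by blast
    have "h n x = 1" if "n \<ge> N" for n
    proof -
      have "real N * infdist x (- U) \<le> real n * infdist x (- U)" using that d by (intro mult_right_mono) auto
      then show ?thesis using N by (simp add: h_def)
    qed
    then show ?thesis using True by (intro tendsto_eventually) (auto simp: eventually_sequentially)
  next
    case False then show ?thesis by (simp add: h_def)
  qed
  have iU: "integrable lborel (indicator U :: 'a \<Rightarrow> real)" using fin by simp
  let ?C = "(2 * pi) powr (- real DIM('a)) * (\<integral>\<xi>. \<bar>\<phi> \<xi>\<bar> \<partial>lborel)"
  have bd: "\<bar>inv_fourier \<phi> x\<bar> \<le> ?C" for x
    using int by (intro abs_inv_fourier_le) auto
  have iUf: "integrable lborel (\<lambda>x. indicator U x * inv_fourier \<phi> x)"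
    using iU by (rule Bochner_Integration.integrable_bound[OF integrable_mult_right[of "?C"]])
      (auto intro!: AE_I2 order_trans[OF bd] simp: indicator_def)
  have "(\<lambda>n. \<integral>x. h n x \<partial>P) \<longlonglongrightarrow> (\<integral>x. indicator U x \<partial>P)"
    using h_bd1 h_lim by (intro integral_dominated_convergence[where w="\<lambda>_. 1"]) auto
  moreover have "(\<lambda>n. \<integral>x. h n x * inv_fourier \<phi> x \<partial>lborel) \<longlonglongrightarrow> (\<integral>x. indicator U x * inv_fourier \<phi> x \<partial>lborel)"
  proof (rule integral_dominated_convergence[where w="\<lambda>x. ?C * indicator U x"])
    show "AE x in lborel. (\<lambda>n. h n x * inv_fourier \<phi> x) \<longlonglongrightarrow> indicator U x * inv_fourier \<phi> x"
      by (intro AE_I2 tendsto_intros h_lim)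
    fix n
    have "\<bar>h n x * inv_fourier \<phi> x\<bar> \<le> indicator U x * ?C" for x
      unfolding abs_mult by (intro mult_mono h_bd bd) auto
    then show "AE x in lborel. norm (h n x * inv_fourier \<phi> x) \<le> ?C * indicator U x" by (simp add: mult.commute)
  qed (use iU in auto)
  moreover have "(\<integral>x. h n x \<partial>P) = (\<integral>x. h n x * inv_fourier \<phi> x \<partial>lborel)" for n
  proof (rule integral_inv_fourier[OF int h_cont h_bd1])
    show "integrable lborel (h n)"
      by (rule Bochner_Integration.integrable_bound[OF iU]) (use h_bd in auto)
  qed
  ultimately have "(\<integral>x. indicator U x \<partial>P) = (\<integral>x. indicator U x * inv_fourier \<phi> x \<partial>lborel)"
    using LIMSEQ_unique by simp
  then have "emeasure P U = ennreal (\<integral>x. indicator U x * inv_fourier \<phi> x \<partial>lborel)"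
    by (simp add: emeasure_eq_measure)
  also have "\<dots> = (\<integral>\<^sup>+x. ennreal (indicator U x * inv_fourier \<phi> x) \<partial>lborel)"
    by (rule nn_integral_eq_integral[OF iUf, symmetric]) (simp add: inv_fourier_nonneg[OF int])
  also have "\<dots> = emeasure ?D U"
    by (auto simp: emeasure_density indicator_def intro!: nn_integral_cong)
  finally show "emeasure P U = emeasure ?D U" .
qed

end

section \<open>The characteristic exponent near infinity\<close>

text \<open>The dominating function for the level-set integrals below.\<close>

lemma integrable_powr_near_0:
  assumes "- 1 < a" "0 \<le> (c::real)"
  shows "integrable lborel (\<lambda>l. indicator {0<..<c} l * l powr a)"
proof (rule Bochner_Integration.integrable_bound)
  have "(\<integral>\<^sup>+l. ennreal (indicator {0..c} l * l powr a) \<partial>lborel) = ennreal (c powr (a + 1) / (a + 1))"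
    by (rule nn_integral_has_integral_lebesgue[OF _ has_integral_powr_from_0[OF assms]]) simp
  then have "(\<integral>\<^sup>+l. ennreal (indicator {0..c} l * l powr a) \<partial>lborel) < \<infinity>" by simp
  then show "integrable lborel (\<lambda>l. indicator {0..c} l * l powr a)"
    by (intro integrableI_nonneg) auto
qed (auto simp: indicator_def)

lemma one_minus_cos_le_sq: "1 - cos (z::real) \<le> z\<^sup>2"
proof -
  have "\<bar>sin (z/2)\<bar>\<^sup>2 \<le> \<bar>z/2\<bar>\<^sup>2"
    by (intro power_mono abs_sin_x_le_abs_x) auto
  then have "1 - cos z \<le> 2 * (z/2)\<^sup>2" using cos_double_sin[of "z/2"] by (simp add: power_divide)
  also have "\<dots> \<le> z\<^sup>2" by (simp add: power_divide)
  finally show ?thesis .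
qed

lemma one_minus_cos_le: "1 - cos (z::real) \<le> 2 * min 1 (z\<^sup>2)"
proof (cases "1 \<le> z\<^sup>2")
  case True
  then show ?thesis using cos_ge_minus_one[of z] by simp
next
  case False
  then have "min 1 (z\<^sup>2) = z\<^sup>2" by simp
  then show ?thesis using one_minus_cos_le_sq[of z] zero_le_power2[of z] by linarith
qed

lemma min_one_sq_scale: "min 1 ((r * t)\<^sup>2) \<le> max 1 (r\<^sup>2) * min 1 (t\<^sup>2)" for r t :: real
proof (cases "1 \<le> t\<^sup>2")
  case False
  have "min 1 ((r * t)\<^sup>2) \<le> r\<^sup>2 * t\<^sup>2" by (simp add: power_mult_distrib)
  also have "\<dots> \<le> max 1 (r\<^sup>2) * t\<^sup>2" by (rule mult_right_mono) auto
  finally show ?thesis using False by simp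
qed simp

text \<open>The inequality behind the subadditivity of the square root of a characteristic exponent.\<close>

lemma one_minus_cos_add_le: "1 - cos (a + b :: real) \<le> 2 * (1 - cos a) + 2 * (1 - cos b)"
proof -
  define x y where "x = a/2" and "y = b/2"
  have "\<bar>sin (x + y)\<bar> \<le> \<bar>sin x\<bar> + \<bar>sin y\<bar>"
  proof -
    have "\<bar>sin (x + y)\<bar> \<le> \<bar>sin x\<bar> * \<bar>cos y\<bar> + \<bar>cos x\<bar> * \<bar>sin y\<bar>"
      unfolding sin_add abs_mult[symmetric] by (rule abs_triangle_ineq)
    also have "\<dots> \<le> \<bar>sin x\<bar> * 1 + 1 * \<bar>sin y\<bar>"
      by (intro add_mono mult_mono) auto
    finally show ?thesis by simp
  qed
  then have "\<bar>sin (x + y)\<bar>\<^sup>2 \<le> (\<bar>sin x\<bar> + \<bar>sin y\<bar>)\<^sup>2" by (intro power_mono) auto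
  also have "\<dots> \<le> 2 * (sin x)\<^sup>2 + 2 * (sin y)\<^sup>2"
    using sum_squares_bound[of "\<bar>sin x\<bar>" "\<bar>sin y\<bar>"] by (simp add: power2_sum)
  finally have "(sin (x + y))\<^sup>2 \<le> 2 * (sin x)\<^sup>2 + 2 * (sin y)\<^sup>2" by simp
  moreover have "1 - cos (2 * (x + y)) = 2 * (sin (x + y))\<^sup>2" "1 - cos (2 * x) = 2 * (sin x)\<^sup>2" "1 - cos (2 * y) = 2 * (sin y)\<^sup>2"
    by (simp_all add: cos_double_sin del: distrib_left_numeral)
  moreover have "2 * (x + y) = a + b" "2 * x = a" "2 * y = b" by (simp_all add: x_def y_def)
  ultimately show ?thesis by simp
qed

lemma cos_exponent_nonneg: "0 \<le> cos_exponent M x"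
  unfolding cos_exponent_def by (rule integral_nonneg_AE) simp

text \<open>Up to a constant this dominates the exponent at frequencies of size \<open>w\<close>, uniformly in the direction
  (\<open>cos_exponent_le_trunc\<close>), while its growth can be read off the tail of \<open>\<nu>\<close>.\<close>

definition trunc_moment :: "'a::euclidean_space measure \<Rightarrow> real \<Rightarrow> real" where
  "trunc_moment \<nu> w = (\<integral>y. min 1 ((w * norm y)\<^sup>2) \<partial>\<nu>)"

locale levy_meas =
  fixes \<nu> :: "'a::euclidean_space measure"
  assumes levy: "levy_measure \<nu>"
begin

lemma sets_nu[measurable_cong, simp]: "sets \<nu> = sets borel" using levy by (simp add: levy_measure_def)

lemma space_nu[simp]: "space \<nu> = UNIV"
  using sets_eq_imp_space_eq[OF sets_nu] by simp

lemma integrable_trunc: "integrable \<nu> (\<lambda>y. min 1 ((w * norm y)\<^sup>2))"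
proof (rule Bochner_Integration.integrable_bound)
  have "integrable \<nu> (\<lambda>y. min 1 ((norm y)\<^sup>2))"
    using levy by (intro integrableI_nonneg) (auto simp: levy_measure_def)
  then show "integrable \<nu> (\<lambda>y. max 1 (w\<^sup>2) * min 1 ((norm y)\<^sup>2))" by simp
  show "AE y in \<nu>. norm (min 1 ((w * norm y)\<^sup>2)) \<le> norm (max 1 (w\<^sup>2) * min 1 ((norm y)\<^sup>2))"
    using min_one_sq_scale by (simp add: abs_mult)
qed simp

lemma trunc_moment_mono: "0 \<le> v \<Longrightarrow> v \<le> w \<Longrightarrow> trunc_moment \<nu> v \<le> trunc_moment \<nu> w"
  unfolding trunc_moment_def
  by (intro integral_mono integrable_trunc min.mono power_mono mult_right_mono) auto

lemma trunc_moment_scale: "trunc_moment \<nu> (r * w) \<le> max 1 (r\<^sup>2) * trunc_moment \<nu> w"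
proof -
  have "min 1 ((r * w * norm y)\<^sup>2) \<le> max 1 (r\<^sup>2) * min 1 ((w * norm y)\<^sup>2)" for y :: 'a
    using min_one_sq_scale[of r "w * norm y"] by (simp only: mult.assoc)
  then show ?thesis unfolding trunc_moment_def
    by (subst integral_mult_right_zero[symmetric]) (intro integral_mono integrable_trunc integrable_mult_right)
qed

lemma one_minus_cos_le_trunc: "1 - cos (\<xi> \<bullet> y) \<le> 2 * min 1 ((norm \<xi> * norm y)\<^sup>2)" for \<xi> y :: 'a
proof -
  have "(\<xi> \<bullet> y)\<^sup>2 \<le> (norm \<xi> * norm y)\<^sup>2"
    using Cauchy_Schwarz_ineq2[of \<xi> y] by (intro power2_le_iff_abs_le[THEN iffD2]) auto
  then show ?thesis using one_minus_cos_le[of "\<xi> \<bullet> y"] by (auto simp: min_def split: if_splits)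
qed

lemma integrable_one_minus_cos: "integrable \<nu> (\<lambda>y. 1 - cos (\<xi> \<bullet> y))"
  by (rule Bochner_Integration.integrable_bound[OF integrable_mult_right[OF integrable_trunc[of "norm \<xi>"], of 2]])
    (use one_minus_cos_le_trunc in auto)

lemma cos_exponent_le_trunc: "cos_exponent \<nu> \<xi> \<le> 2 * trunc_moment \<nu> (norm \<xi>)"
  unfolding cos_exponent_def trunc_moment_def
  by (subst integral_mult_right_zero[symmetric])
    (intro integral_mono integrable_trunc integrable_mult_right integrable_one_minus_cos one_minus_cos_le_trunc)

lemma cos_exponent_add_le: "cos_exponent \<nu> (x + y) \<le> 2 * cos_exponent \<nu> x + 2 * cos_exponent \<nu> y"
proof -
  have "cos_exponent \<nu> (x + y) \<le> (\<integral>z. 2 * (1 - cos (x \<bullet> z)) + 2 * (1 - cos (y \<bullet> z)) \<partial>\<nu>)"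
    unfolding cos_exponent_def
    by (intro integral_mono integrable_one_minus_cos Bochner_Integration.integrable_add integrable_mult_right)
      (simp only: inner_add_left one_minus_cos_add_le)
  also have "\<dots> = 2 * cos_exponent \<nu> x + 2 * cos_exponent \<nu> y"
    unfolding cos_exponent_def
    by (subst Bochner_Integration.integral_add)
      (rule integrable_mult_right[OF integrable_one_minus_cos] | simp only: integral_mult_right_zero)+
  finally show ?thesis .
qed

lemma sigma_finite: "sigma_finite_measure \<nu>"
proof (rule sigma_finiteI_countable_integrable[of "{1::real}" _ "\<lambda>w y. min 1 ((w * norm y)\<^sup>2)" "{0}"])
  show "{0} \<in> null_sets \<nu>" using levy by (auto simp: levy_measure_def null_sets_def)
qed (use integrable_trunc[of 1] in auto)

lemma emeasure_tail: assumes "0 < s" shows "emeasure \<nu> (- cball 0 s) < \<infinity>"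
proof -
  have "emeasure \<nu> {y\<in>space \<nu>. 1/2 < min 1 ((1 / s * norm y)\<^sup>2)} < \<infinity>"
    by (rule layer_cake_integral(3)[OF sigma_finite integrable_trunc, where c=1]) auto
  moreover have "- cball 0 s \<subseteq> {y\<in>space \<nu>. 1/2 < min 1 ((1 / s * norm y)\<^sup>2)}"
  proof
    fix y :: 'a assume "y \<in> - cball 0 s"
    then have "1 \<le> 1 / s * norm y" using assms by (auto simp: field_simps)
    then have "1 \<le> (1 / s * norm y)\<^sup>2" by (rule one_le_power)
    then show "y \<in> {y\<in>space \<nu>. 1/2 < min 1 ((1 / s * norm y)\<^sup>2)}" by simp
  qed
  ultimately show ?thesis
    by (auto intro: order.strict_trans1[OF emeasure_mono])
qed

lemma ennreal_tail_fun: "0 < t \<Longrightarrow> ennreal (tail_fun \<nu> t) = emeasure \<nu> (- cball 0 (1 / t))"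
  using emeasure_tail[of "1/t"] by (simp add: tail_fun_def emeasure_eq_ennreal_measure)

lemma measure_le_tail_fun:
  assumes "0 < t" "S \<in> sets borel" "\<And>y. y \<in> S \<Longrightarrow> 1 < t * norm y"
  shows "measure \<nu> S \<le> tail_fun \<nu> t"
proof -
  have "emeasure \<nu> S \<le> emeasure \<nu> (- cball 0 (1 / t))"
    using assms(1) assms(3) by (intro emeasure_mono) (force simp: field_simps)+
  then show ?thesis using emeasure_tail[of "1/t"] assms
    by (simp add: tail_fun_def measure_def enn2real_mono)
qed

lemma tail_fun_mono: "mono (tail_fun \<nu>)"
proof (rule monoI)
  fix s t :: real assume "s \<le> t"
  show "tail_fun \<nu> s \<le> tail_fun \<nu> t"
  proof (cases "0 < s")
    case True
    show ?thesis unfolding tail_fun_def[of \<nu> s] using True \<open>s \<le> t\<close>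
    proof (simp, intro measure_le_tail_fun)
      fix y :: 'a assume "y \<in> - cball 0 (1 / s)"
      then have "1 < s * norm y" using True by (auto simp: field_simps)
      also have "\<dots> \<le> t * norm y" using \<open>s \<le> t\<close> by (rule mult_right_mono) simp
      finally show "1 < t * norm y" .
    qed auto
  qed (simp add: tail_fun_def)
qed

lemma tail_fun_nonneg: "0 \<le> tail_fun \<nu> t" by (simp add: tail_fun_def)

end

locale levy_rv = levy_meas \<nu> for \<nu> :: "'a::euclidean_space measure" +
  fixes \<alpha> :: real
  assumes rv_tail: "regularly_varying (tail_fun \<nu>) \<alpha>" and alpha: "0 < \<alpha>" "\<alpha> < 2"
begin

sublocale reg_var_mono "tail_fun \<nu>" \<alpha>
  by standard (use tail_fun_mono tail_fun_nonneg rv_tail alpha in auto)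

abbreviation "V \<equiv> tail_fun \<nu>"

text \<open>The level set \<open>{min 1 (w|y|)\<^sup>2 > l}\<close> is the complement of a ball and has measure \<open>V(w / \<surd>l)\<close>. The
  upper Potter bound turns the integral over \<open>l\<close> into \<open>V(w)\<close> times the integral of \<open>l\<^sup>-\<^sup>\<gamma>\<^sup>/\<^sup>2\<close> on the unit
  interval.\<close>

lemma trunc_moment_le_tail:
  obtains C w0 where "0 < C" "0 < w0" "\<And>w. w \<ge> w0 \<Longrightarrow> trunc_moment \<nu> w \<le> C * V w"
proof -
  define \<gamma> where "\<gamma> = (\<alpha> + 2) / 2"
  have \<gamma>: "\<alpha> < \<gamma>" "\<gamma> < 2" using alpha by (auto simp: \<gamma>_def)
  from potter_upper[OF \<gamma>(1)] obtain s0 where s0: "0 < s0" "\<And>s. s \<ge> s0 \<Longrightarrow> 0 < V s"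
    "\<And>s x. s \<ge> s0 \<Longrightarrow> 1 \<le> x \<Longrightarrow> V (s * x) \<le> 2 powr \<gamma> * x powr \<gamma> * V s" by blast
  let ?k = "\<lambda>l::real. indicator {0<..<1} l * l powr (- \<gamma> / 2)"
  have k: "integrable lborel ?k" using \<gamma> by (intro integrable_powr_near_0) auto
  define I where "I = (\<integral>l. ?k l \<partial>lborel)"
  have I: "0 \<le> I" unfolding I_def by (rule integral_nonneg_AE) simp
  show thesis
  proof (rule that[of "2 powr \<gamma> * I + 1" s0])
    fix w assume w: "s0 \<le> w"
    let ?m = "\<lambda>l. measure \<nu> {y\<in>space \<nu>. l < min 1 ((w * norm y)\<^sup>2)}"
    note lc = layer_cake_integral[OF sigma_finite integrable_trunc[of w], of 1]
    have [measurable]: "?m \<in> borel_measurable borel" by (rule lc(2)) auto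
    have bd: "indicator {0<..<1} l * ?m l \<le> (2 powr \<gamma> * V w) * ?k l" for l
    proof (cases "l \<in> {0<..<1}")
      case True
      have "?m l \<le> V (w * (1 / sqrt l))"
      proof (rule measure_le_tail_fun)
        fix y assume "y \<in> {y \<in> space \<nu>. l < min 1 ((w * norm y)\<^sup>2)}"
        then have "l < (w * norm y)\<^sup>2" by simp
        then have "sqrt l < sqrt ((w * norm y)\<^sup>2)" by (rule real_sqrt_less_mono)
        also have "\<dots> = w * norm y" using w s0 by simp
        finally show "1 < w * (1 / sqrt l) * norm y" using True by (simp add: field_simps)
      qed (use True w s0 in auto)
      also have "\<dots> \<le> 2 powr \<gamma> * (1 / sqrt l) powr \<gamma> * V w"
        using True by (intro s0(3) w) auto
      also have "(1 / sqrt l) powr \<gamma> = l powr (- \<gamma> / 2)"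
        using True by (simp add: powr_half_sqrt[symmetric] powr_powr powr_minus_divide[symmetric])
      finally show ?thesis using True by (simp add: mult_ac)
    qed simp
    have "trunc_moment \<nu> w = (\<integral>l. indicator {0<..<1} l * ?m l \<partial>lborel)"
      unfolding trunc_moment_def by (rule lc(1)) auto
    also have "\<dots> \<le> (\<integral>l. (2 powr \<gamma> * V w) * ?k l \<partial>lborel)"
    proof (rule integral_mono)
      show "integrable lborel (\<lambda>l. (2 powr \<gamma> * V w) * ?k l)" using k by (rule integrable_mult_right)
      then show "integrable lborel (\<lambda>l. indicator {0<..<1} l * ?m l)"
      proof (rule Bochner_Integration.integrable_bound)
        have "0 \<le> indicator {0<..<1} l * ?m l" for l by simp
        then show "AE l in lborel. norm (indicator {0<..<1} l * ?m l) \<le> norm ((2 powr \<gamma> * V w) * ?k l)"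
          unfolding real_norm_def
          by (intro AE_I2 order_trans[OF eq_refl[OF abs_of_nonneg] order_trans[OF bd abs_ge_self]])
      qed measurable
    qed (rule bd)
    also have "\<dots> = (2 powr \<gamma> * I) * V w" by (simp add: I_def)
    also have "\<dots> \<le> (2 powr \<gamma> * I + 1) * V w"
      using s0(2)[OF w] by (intro mult_right_mono) auto
    finally show "trunc_moment \<nu> w \<le> (2 powr \<gamma> * I + 1) * V w" .
  qed (use s0 I in \<open>auto intro: add_nonneg_pos\<close>)
qed


lemma cos_exponent_scale_bound:
  "0 \<le> s \<Longrightarrow> cos_exponent \<nu> (s *\<^sub>R \<xi>) \<le> 2 * trunc_moment \<nu> (s * norm \<xi>)"
  using cos_exponent_le_trunc[of "s *\<^sub>R \<xi>"] by simp

text \<open>Here vague convergence of the rescaled \<open>\<nu>\<close> to \<open>\<eta>\<close> is used, one superlevel set of \<open>1 - cos\<close> at a time.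
  The level \<open>l\<close> runs over \<open>(0, 2)\<close> only, and small \<open>l\<close>, where the small jumps enter, are controlled by
  the Potter bound.\<close>

lemma cos_exponent_tendsto:
  assumes eta: "tail_limit_measure \<nu> \<eta>" and sf: "sigma_finite_measure \<eta>"
    and int_eta: "integrable \<eta> (\<lambda>y. 1 - cos (\<xi> \<bullet> y))"
  shows "((\<lambda>s. cos_exponent \<nu> (s *\<^sub>R \<xi>) / V s) \<longlongrightarrow> cos_exponent \<eta> \<xi>) at_top"
proof -
  have sets_eta[measurable_cong, simp]: "sets \<eta> = sets borel" using eta by (simp add: tail_limit_measure_def)
  have [simp]: "space \<eta> = UNIV" using sets_eq_imp_space_eq[OF sets_eta] by simp
  define \<gamma> where "\<gamma> = (\<alpha> + 2) / 2"
  have \<gamma>: "\<alpha> < \<gamma>" "\<gamma> < 2" using alpha by (auto simp: \<gamma>_def)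
  from potter_upper[OF \<gamma>(1)] obtain s0 where s0: "0 < s0" "\<And>s. s \<ge> s0 \<Longrightarrow> 0 < V s"
    "\<And>s x. s \<ge> s0 \<Longrightarrow> 1 \<le> x \<Longrightarrow> V (s * x) \<le> 2 powr \<gamma> * x powr \<gamma> * V s" by blast
  \<comment> \<open>\<open>a / sqrt l \<ge> 1\<close> for all levels \<open>l < 2\<close>, as the Potter bound requires.\<close>
  define a where "a = norm \<xi> + 2"
  have a: "2 \<le> a" "norm \<xi> \<le> a" by (auto simp: a_def)
  let ?m = "\<lambda>s l. measure \<nu> {y\<in>space \<nu>. l < 1 - cos ((s *\<^sub>R \<xi>) \<bullet> y)}"
  let ?n = "\<lambda>l. measure \<eta> {y\<in>space \<eta>. l < 1 - cos (\<xi> \<bullet> y)}"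
  have c2: "1 - cos z \<le> (2::real)" for z using cos_ge_minus_one[of z] by linarith
  have c0: "0 \<le> 1 - cos (z::real)" for z by simp
  note lc = layer_cake_integral[OF sigma_finite integrable_one_minus_cos c0 c2]
  note lc_eta = layer_cake_integral[OF sf int_eta c0 c2]
  have [measurable]: "?m s \<in> borel_measurable borel" for s by (rule lc(2))
  have [measurable]: "?n \<in> borel_measurable borel" by (rule lc_eta(2))
  let ?k = "\<lambda>l::real. indicator {0<..<2} l * l powr (- \<gamma> / 2)"
  have k: "integrable lborel ?k" using \<gamma> by (intro integrable_powr_near_0) auto
  have "((\<lambda>s. \<integral>l. indicator {0<..<2} l * (?m s l / V s) \<partial>lborel) \<longlongrightarrow>
    (\<integral>l. indicator {0<..<2} l * ?n l \<partial>lborel)) at_top"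
  proof (rule integral_dominated_convergence_at_top)
    show "integrable lborel (\<lambda>l. (2 powr \<gamma> * a powr \<gamma>) * ?k l)" using k by (rule integrable_mult_right)
    show "\<forall>\<^sub>F s in at_top. AE l in lborel. norm (indicator {0<..<2} l * (?m s l / V s)) \<le> (2 powr \<gamma> * a powr \<gamma>) * ?k l"
      using eventually_ge_at_top[of s0]
    proof (eventually_elim, intro AE_I2)
      fix s l :: real assume s: "s0 \<le> s"
      show "norm (indicator {0<..<2} l * (?m s l / V s)) \<le> (2 powr \<gamma> * a powr \<gamma>) * ?k l"
      proof (cases "l \<in> {0<..<2}")
        case True
        then have "sqrt l \<le> sqrt (2\<^sup>2)" by (intro real_sqrt_le_mono) auto
        then have l: "0 < sqrt l" "sqrt l \<le> 2" using True by auto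
        have "?m s l \<le> V (s * (a / sqrt l))"
        proof (rule measure_le_tail_fun)
          fix y assume "y \<in> {y \<in> space \<nu>. l < 1 - cos ((s *\<^sub>R \<xi>) \<bullet> y)}"
          then have "l < 1 - cos ((s *\<^sub>R \<xi>) \<bullet> y)" by simp
          also have "\<dots> \<le> ((s *\<^sub>R \<xi>) \<bullet> y)\<^sup>2" by (rule one_minus_cos_le_sq)
          finally have "sqrt l < sqrt (((s *\<^sub>R \<xi>) \<bullet> y)\<^sup>2)" by (rule real_sqrt_less_mono)
          also have "\<dots> = \<bar>(s *\<^sub>R \<xi>) \<bullet> y\<bar>" by (rule real_sqrt_abs)
          also have "\<dots> \<le> norm (s *\<^sub>R \<xi>) * norm y" by (rule Cauchy_Schwarz_ineq2)
          also have "\<dots> \<le> s * a * norm y"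
            using s s0(1) a by (auto intro!: mult_right_mono)
          finally show "1 < s * (a / sqrt l) * norm y" using l by (simp add: field_simps)
        next
          show "{y \<in> space \<nu>. l < 1 - cos ((s *\<^sub>R \<xi>) \<bullet> y)} \<in> sets borel" by (simp only: space_nu) measurable
        qed (use s s0 a l in auto)
        also have "\<dots> \<le> 2 powr \<gamma> * (a / sqrt l) powr \<gamma> * V s"
          using l a by (intro s0(3) s) (auto simp: field_simps)
        also have "(a / sqrt l) powr \<gamma> = a powr \<gamma> * l powr (- \<gamma> / 2)"
          using True a by (simp add: powr_divide powr_half_sqrt[symmetric] powr_powr powr_minus_divide)
        finally show ?thesis using True s0(2)[OF s] by (simp add: field_simps)
      qed simp
    qed
    have "AE l in lborel. emeasure \<eta> {y\<in>space \<eta>. 1 - cos (\<xi> \<bullet> y) = l} = 0"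
      by (rule AE_level_set_null[OF sf]) measurable
    then show "AE l in lborel. ((\<lambda>s. indicator {0<..<2} l * (?m s l / V s)) \<longlongrightarrow> indicator {0<..<2} l * ?n l) at_top"
    proof eventually_elim
      case (elim l)
      show ?case
      proof (cases "l \<in> {0<..<2}")
        case True
        let ?G = "{y. l < 1 - cos (\<xi> \<bullet> y)}"
        have G: "?G \<in> sets borel" by measurable
        have opn: "open ?G" by (intro open_Collect_less continuous_intros)
        have "closure ?G \<subseteq> {y. l \<le> 1 - cos (\<xi> \<bullet> y)}"
          by (rule closure_minimal) (auto intro!: closed_Collect_le continuous_intros)
        then have fr: "frontier ?G \<subseteq> {y. 1 - cos (\<xi> \<bullet> y) = l}"
          using interior_open[OF opn] by (auto simp: frontier_def)
        have "emeasure \<eta> (frontier ?G) \<le> emeasure \<eta> {y. 1 - cos (\<xi> \<bullet> y) = l}"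
          by (rule emeasure_mono[OF fr]) measurable
        then have "emeasure \<eta> (frontier ?G) = 0" using elim by simp
        then have "((\<lambda>s. emeasure \<nu> ((\<lambda>x. s *\<^sub>R x) ` ?G) / emeasure \<nu> (- cball 0 s)) \<longlongrightarrow> emeasure \<eta> ?G) (at_right 0)"
          using eta G True by (auto simp: tail_limit_measure_def)
        from filterlim_compose[OF this filterlim_inverse_at_right_top]
        have "((\<lambda>s. emeasure \<nu> ((\<lambda>x. inverse s *\<^sub>R x) ` ?G) / emeasure \<nu> (- cball 0 (inverse s))) \<longlongrightarrow> emeasure \<eta> ?G) at_top" .
        also have "?this \<longleftrightarrow> ((\<lambda>s. ennreal (?m s l / V s)) \<longlongrightarrow> emeasure \<eta> ?G) at_top"
        proof (rule filterlim_cong[OF refl refl])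
          show "\<forall>\<^sub>F s in at_top. emeasure \<nu> ((\<lambda>x. inverse s *\<^sub>R x) ` ?G) / emeasure \<nu> (- cball 0 (inverse s)) = ennreal (?m s l / V s)"
            using eventually_ge_at_top[of s0]
          proof eventually_elim
            fix s assume s: "s0 \<le> s"
            have "(\<lambda>x. inverse s *\<^sub>R x) ` ?G = {y\<in>space \<nu>. l < 1 - cos ((s *\<^sub>R \<xi>) \<bullet> y)}" (is "?l = ?r")
            proof (intro equalityI subsetI)
              fix y assume "y \<in> ?r"
              then have "s *\<^sub>R y \<in> ?G" by simp
              moreover have "y = inverse s *\<^sub>R (s *\<^sub>R y)" using s s0 by simp
              ultimately show "y \<in> ?l" by (rule rev_image_eqI)
            next
              fix y assume "y \<in> ?l"
              then obtain x where x: "x \<in> ?G" "y = inverse s *\<^sub>R x" by blast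
              have "s *\<^sub>R y = x" using s s0 x(2) by simp
              then have "(s *\<^sub>R \<xi>) \<bullet> y = \<xi> \<bullet> x" by (metis inner_scaleR_left inner_scaleR_right)
              then show "y \<in> ?r" using x(1) by simp
            qed
            moreover have "emeasure \<nu> ?r = ennreal (?m s l)"
              using lc(3)[of l "s *\<^sub>R \<xi>"] True by (auto simp: emeasure_eq_ennreal_measure)
            moreover have "emeasure \<nu> (- cball 0 (inverse s)) = ennreal (V s)"
              using ennreal_tail_fun[of s] s s0 by (simp add: inverse_eq_divide)
            ultimately show "emeasure \<nu> ((\<lambda>x. inverse s *\<^sub>R x) ` ?G) / emeasure \<nu> (- cball 0 (inverse s)) = ennreal (?m s l / V s)"
              using s0(2)[OF s] by (simp add: divide_ennreal)
          qed
        qed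
        also have "emeasure \<eta> ?G = ennreal (?n l)"
          using lc_eta(3)[of l] True by (auto simp: emeasure_eq_ennreal_measure)
        finally have "((\<lambda>s. ?m s l / V s) \<longlongrightarrow> ?n l) at_top"
          by (subst (asm) tendsto_ennreal_iff) (auto simp: tail_fun_nonneg)
        then show ?thesis by (intro tendsto_intros)
      qed simp
    qed
  qed measurable
  also have "(\<integral>l. indicator {0<..<2} l * ?n l \<partial>lborel) = cos_exponent \<eta> \<xi>"
    unfolding cos_exponent_def by (rule lc_eta(1)[symmetric])
  also have "(\<lambda>s. \<integral>l. indicator {0<..<2} l * (?m s l / V s) \<partial>lborel) = (\<lambda>s. cos_exponent \<nu> (s *\<^sub>R \<xi>) / V s)"
  proof
    fix s
    have "cos_exponent \<nu> (s *\<^sub>R \<xi>) = (\<integral>l. indicator {0<..<2} l * ?m s l \<partial>lborel)"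
      unfolding cos_exponent_def by (rule lc(1))
    then show "(\<integral>l. indicator {0<..<2} l * (?m s l / V s) \<partial>lborel) = cos_exponent \<nu> (s *\<^sub>R \<xi>) / V s"
      by (simp only: times_divide_eq_right integral_divide_zero)
  qed
  finally show ?thesis .
qed

text \<open>Pointwise limits do not give a bound uniform in the direction, but near a fixed unit vector \<open>\<theta>\<^sub>0\<close> they
  do: \<open>\<psi>(s \<theta>\<^sub>0) \<le> 2 \<psi>(s \<theta>) + 2 \<psi>(s (\<theta>\<^sub>0 - \<theta>))\<close>, and the last term is at most \<open>C V(\<delta> s)\<close>, a small multiple
  of \<open>V(s)\<close>. Finitely many such neighbourhoods cover the sphere.\<close>

lemma cos_exponent_lower_bound:
  assumes lim: "\<And>\<xi>. norm \<xi> = 1 \<Longrightarrow> ((\<lambda>s. cos_exponent \<nu> (s *\<^sub>R \<xi>) / V s) \<longlongrightarrow> \<psi> \<xi>) at_top"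
    and pos: "\<And>\<xi>. norm \<xi> = 1 \<Longrightarrow> 0 < \<psi> \<xi>"
  obtains c s1 where "0 < c" "\<And>s \<theta>. s \<ge> s1 \<Longrightarrow> norm \<theta> = 1 \<Longrightarrow> c * V s \<le> cos_exponent \<nu> (s *\<^sub>R \<theta>)"
proof -
  from trunc_moment_le_tail obtain C w0 where C: "0 < C" "0 < w0"
    "\<And>w. w \<ge> w0 \<Longrightarrow> trunc_moment \<nu> w \<le> C * V w" by blast
  from ev_pos obtain s0 where s0: "0 < s0" "\<And>s. s \<ge> s0 \<Longrightarrow> 0 < V s" by blast
  have local: "\<exists>\<delta>>0. \<exists>s2. \<forall>s\<ge>s2. \<forall>\<theta>. norm (\<theta>0 - \<theta>) < \<delta> \<longrightarrow> \<psi> \<theta>0 / 8 * V s \<le> cos_exponent \<nu> (s *\<^sub>R \<theta>)"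
    if n: "norm \<theta>0 = 1" for \<theta>0
  proof -
    define m where "m = \<psi> \<theta>0"
    have m: "0 < m" using pos[OF n] by (simp add: m_def)
    \<comment> \<open>Then \<open>2 C V(\<delta> s)\<close> is at most \<open>(m/8) V(s)\<close> for large \<open>s\<close>, as \<open>V(\<delta> s) / V(s)\<close> tends to \<open>m / (32 C)\<close>.\<close>
    define \<delta> where "\<delta> = (m / (32 * C)) powr (1 / \<alpha>)"
    have \<delta>: "0 < \<delta>" "\<delta> powr \<alpha> = m / (32 * C)" using m C alpha by (auto simp: \<delta>_def powr_powr)
    have "eventually (\<lambda>s. V (\<delta> * s) / V s < m / (16 * C)) at_top"
      by (rule order_tendstoD(2)[OF ratio_tendsto[OF \<delta>(1)]]) (use \<delta> m C in \<open>simp add: field_simps\<close>)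
    moreover have "eventually (\<lambda>s. cos_exponent \<nu> (s *\<^sub>R \<theta>0) / V s > m / 2) at_top"
      by (rule order_tendstoD(1)[OF lim[OF n]]) (use m in \<open>simp add: m_def\<close>)
    ultimately have "eventually (\<lambda>s. \<forall>\<theta>. norm (\<theta>0 - \<theta>) < \<delta> \<longrightarrow> m / 8 * V s \<le> cos_exponent \<nu> (s *\<^sub>R \<theta>)) at_top"
      using eventually_ge_at_top[of s0] eventually_ge_at_top[of "w0 / \<delta>"]
    proof eventually_elim
      case (elim s)
      have V: "0 < V s" using s0 elim by simp
      show ?case
      proof (intro allI impI)
        fix \<theta> assume d: "norm (\<theta>0 - \<theta>) < \<delta>"
        have s: "0 < s" using elim s0 by simp
        have "cos_exponent \<nu> (s *\<^sub>R (\<theta>0 - \<theta>)) \<le> 2 * trunc_moment \<nu> (s * norm (\<theta>0 - \<theta>))"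
          using s by (intro cos_exponent_scale_bound) auto
        also have "trunc_moment \<nu> (s * norm (\<theta>0 - \<theta>)) \<le> trunc_moment \<nu> (\<delta> * s)"
          using s d by (intro trunc_moment_mono) auto
        also have "\<dots> \<le> C * V (\<delta> * s)" using elim \<delta> by (intro C(3)) (simp add: field_simps)
        also have "\<dots> \<le> C * (m / (16 * C) * V s)"
          using elim V C by (intro mult_left_mono) (auto simp: field_simps)
        finally have 1: "cos_exponent \<nu> (s *\<^sub>R (\<theta>0 - \<theta>)) \<le> m / 8 * V s" using C by simp
        have "m / 2 * V s \<le> cos_exponent \<nu> (s *\<^sub>R \<theta>0)" using elim V by (simp add: field_simps)
        also have "s *\<^sub>R \<theta>0 = s *\<^sub>R \<theta> + s *\<^sub>R (\<theta>0 - \<theta>)" by (simp add: algebra_simps)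
        also have "cos_exponent \<nu> \<dots> \<le> 2 * cos_exponent \<nu> (s *\<^sub>R \<theta>) + 2 * cos_exponent \<nu> (s *\<^sub>R (\<theta>0 - \<theta>))"
          by (rule cos_exponent_add_le)
        finally have "m / 2 * V s \<le> 2 * cos_exponent \<nu> (s *\<^sub>R \<theta>) + 2 * (m / 8 * V s)" using 1 by linarith
        then show "m / 8 * V s \<le> cos_exponent \<nu> (s *\<^sub>R \<theta>)" by (simp add: field_simps)
      qed
    qed
    then show ?thesis using \<delta>(1) unfolding eventually_at_top_linorder m_def by blast
  qed
  then obtain \<delta> s2 where ds: "\<And>\<theta>0. norm \<theta>0 = 1 \<Longrightarrow> 0 < \<delta> \<theta>0"
    "\<And>\<theta>0 s \<theta>. norm \<theta>0 = 1 \<Longrightarrow> s \<ge> s2 \<theta>0 \<Longrightarrow> norm (\<theta>0 - \<theta>) < \<delta> \<theta>0 \<Longrightarrow> \<psi> \<theta>0 / 8 * V s \<le> cos_exponent \<nu> (s *\<^sub>R \<theta>)"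
    by metis
  have "compact (sphere (0::'a) 1)" by simp
  moreover have "sphere (0::'a) 1 \<subseteq> (\<Union>\<theta>0\<in>sphere 0 1. ball \<theta>0 (\<delta> \<theta>0))" using ds(1) by force
  ultimately obtain T where T: "T \<subseteq> sphere (0::'a) 1" "finite T" "sphere 0 1 \<subseteq> (\<Union>\<theta>0\<in>T. ball \<theta>0 (\<delta> \<theta>0))"
    by (elim compactE_image) auto
  have "T \<noteq> {}" using T(3) by auto
  define c where "c = Min ((\<lambda>\<theta>0. \<psi> \<theta>0 / 8) ` T)"
  define s1 where "s1 = Max (insert s0 (s2 ` T))"
  show thesis
  proof (rule that[of c s1])
    show "0 < c" using T \<open>T \<noteq> {}\<close> pos by (auto simp: c_def)
    fix s \<theta> assume s: "s1 \<le> s" and \<theta>: "norm (\<theta>::'a) = 1"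
    then obtain \<theta>0 where t: "\<theta>0 \<in> T" "norm (\<theta>0 - \<theta>) < \<delta> \<theta>0" using T(3) by (force simp: dist_norm)
    have "s2 \<theta>0 \<le> s" using s t T(2) by (auto simp: s1_def)
    then have "\<psi> \<theta>0 / 8 * V s \<le> cos_exponent \<nu> (s *\<^sub>R \<theta>)" using t T(1) by (intro ds(2)) auto
    moreover have "c * V s \<le> \<psi> \<theta>0 / 8 * V s"
      using t(1) T(2) tail_fun_nonneg unfolding c_def by (intro mult_right_mono Min_le) auto
    ultimately show "c * V s \<le> cos_exponent \<nu> (s *\<^sub>R \<theta>)" by linarith
  qed
qed

end

section \<open>Convergence of integrals under uniform tail bounds\<close>

text \<open>Dominated convergence on balls, Fatou's lemma for the tail of the limit, and uniformly small tails for
  the rest.\<close>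

lemma integral_tendsto_of_uniform_tails:
  fixes h :: "nat \<Rightarrow> 'a::euclidean_space \<Rightarrow> real" and h' :: "'a \<Rightarrow> real"
  assumes [measurable]: "\<And>n. h n \<in> borel_measurable borel" "h' \<in> borel_measurable borel"
    and lim: "\<And>x. (\<lambda>n. h n x) \<longlonglongrightarrow> h' x"
    and near: "\<And>K. \<exists>B. eventually (\<lambda>n. \<forall>x. norm x < K \<longrightarrow> \<bar>h n x\<bar> \<le> B) sequentially"
    and tail: "\<And>e. 0 < e \<Longrightarrow> \<exists>K. eventually (\<lambda>n.
      (\<integral>\<^sup>+x. ennreal (indicator {x. K \<le> norm x} x * \<bar>h n x\<bar>) \<partial>lborel) \<le> ennreal e) sequentially"
  shows "integrable lborel h'" and "(\<lambda>n. \<integral>x. h n x \<partial>lborel) \<longlonglongrightarrow> (\<integral>x. h' x \<partial>lborel)"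
proof -
  define I where "I K x = (indicator {x::'a. K \<le> norm x} x :: real)" for K x
  define J where "J K x = (indicator {x::'a. norm x < K} x :: real)" for K x
  have [measurable]: "I K \<in> borel_measurable borel" "J K \<in> borel_measurable borel" for K
    unfolding I_def J_def by measurable
  have split: "f x = J K x * f x + I K x * f x" for K f x by (auto simp: I_def J_def indicator_def)
  have tail': "(\<integral>\<^sup>+x. ennreal (I K x * \<bar>h' x\<bar>) \<partial>lborel) \<le> ennreal e"
    if "eventually (\<lambda>n. (\<integral>\<^sup>+x. ennreal (I K x * \<bar>h n x\<bar>) \<partial>lborel) \<le> ennreal e) sequentially" for K e
  proof -
    have "(\<integral>\<^sup>+x. ennreal (I K x * \<bar>h' x\<bar>) \<partial>lborel) = (\<integral>\<^sup>+x. liminf (\<lambda>n. ennreal (I K x * \<bar>h n x\<bar>)) \<partial>lborel)"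
      by (intro nn_integral_cong lim_imp_Liminf[symmetric] tendsto_intros lim) auto
    also have "\<dots> \<le> liminf (\<lambda>n. \<integral>\<^sup>+x. ennreal (I K x * \<bar>h n x\<bar>) \<partial>lborel)"
      by (rule nn_integral_liminf) measurable
    also have "\<dots> \<le> liminf (\<lambda>n::nat. ennreal e)" by (rule Liminf_mono[OF that])
    finally show ?thesis by (simp add: Liminf_const)
  qed
  have intI: "integrable lborel (\<lambda>x. I K x * f x)" and absI: "\<bar>\<integral>x. I K x * f x \<partial>lborel\<bar> \<le> e"
    if "(\<integral>\<^sup>+x. ennreal (I K x * \<bar>f x\<bar>) \<partial>lborel) \<le> ennreal e" and [measurable]: "f \<in> borel_measurable borel"
      and e: "0 \<le> e" for K f e
  proof -
    have eq: "norm (I K x * f x) = I K x * \<bar>f x\<bar>" for x by (simp add: I_def abs_mult)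
    show i: "integrable lborel (\<lambda>x. I K x * f x)"
      unfolding integrable_iff_bounded eq using that(1) by (auto intro: le_less_trans)
    have "\<bar>\<integral>x. I K x * f x \<partial>lborel\<bar> \<le> (\<integral>x. norm (I K x * f x) \<partial>lborel)"
      using integral_norm_bound[of lborel "\<lambda>x. I K x * f x"] by simp
    also have "\<dots> = enn2real (\<integral>\<^sup>+x. ennreal (I K x * \<bar>f x\<bar>) \<partial>lborel)"
      unfolding eq by (rule integral_eq_nn_integral) (auto simp: I_def)
    also have "\<dots> \<le> e" using enn2real_mono[OF that(1)] e by simp
    finally show "\<bar>\<integral>x. I K x * f x \<partial>lborel\<bar> \<le> e" .
  qed
  have nearJ: "integrable lborel (\<lambda>x. J K x * h' x)"
    "eventually (\<lambda>n. integrable lborel (\<lambda>x. J K x * h n x)) sequentially"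
    "(\<lambda>n. \<integral>x. J K x * h n x \<partial>lborel) \<longlonglongrightarrow> (\<integral>x. J K x * h' x \<partial>lborel)" for K
  proof -
    obtain B where "eventually (\<lambda>n. \<forall>x. norm x < K \<longrightarrow> \<bar>h n x\<bar> \<le> B) sequentially" using near by blast
    then obtain N where N: "\<And>n x. n \<ge> N \<Longrightarrow> norm x < K \<Longrightarrow> \<bar>h n x\<bar> \<le> B"
      unfolding eventually_sequentially by blast
    have "emeasure lborel {x::'a. norm x < K} < \<infinity>"
      by (rule emeasure_bounded_finite) (auto simp: bounded_iff intro: less_imp_le)
    then have iJ: "integrable lborel (\<lambda>x. B * J K x)" unfolding J_def by simp
    have bd: "AE x in lborel. norm (J K x * h (n + N) x) \<le> B * J K x" for n
      using N[of "n + N"] by (intro AE_I2) (auto simp: J_def indicator_def)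
    have l: "AE x in lborel. (\<lambda>n. J K x * h (n + N) x) \<longlonglongrightarrow> J K x * h' x"
      by (intro AE_I2 tendsto_intros LIMSEQ_ignore_initial_segment lim)
    note dc = _ _ iJ l bd
    show "integrable lborel (\<lambda>x. J K x * h' x)" by (rule integrable_dominated_convergence[OF dc]) measurable
    have "integrable lborel (\<lambda>x. J K x * h (n + N) x)" for n
      by (rule integrable_dominated_convergence2[OF dc]) measurable
    then show "eventually (\<lambda>n. integrable lborel (\<lambda>x. J K x * h n x)) sequentially"
      unfolding eventually_sequentially by (intro exI[of _ N]) (metis le_add_diff_inverse2)
    have "(\<lambda>n. \<integral>x. J K x * h (n + N) x \<partial>lborel) \<longlonglongrightarrow> (\<integral>x. J K x * h' x \<partial>lborel)"
      by (rule integral_dominated_convergence[OF dc]) measurable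
    then show "(\<lambda>n. \<integral>x. J K x * h n x \<partial>lborel) \<longlonglongrightarrow> (\<integral>x. J K x * h' x \<partial>lborel)"
      by (rule LIMSEQ_offset)
  qed
  from tail[of 1] obtain K1 where "eventually (\<lambda>n. (\<integral>\<^sup>+x. ennreal (I K1 x * \<bar>h n x\<bar>) \<partial>lborel) \<le> ennreal 1) sequentially"
    unfolding I_def by auto
  from intI[OF tail'[OF this]] have "integrable lborel (\<lambda>x. I K1 x * h' x)" by simp
  from Bochner_Integration.integrable_add[OF nearJ(1)[of K1] this] show "integrable lborel h'"
    by (simp only: split[symmetric])
  show "(\<lambda>n. \<integral>x. h n x \<partial>lborel) \<longlonglongrightarrow> (\<integral>x. h' x \<partial>lborel)"
  proof (rule LIMSEQ_I)
    fix r :: real assume r: "0 < r"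
    from tail[of "r/4"] r obtain K where K: "eventually (\<lambda>n. (\<integral>\<^sup>+x. ennreal (I K x * \<bar>h n x\<bar>) \<partial>lborel) \<le> ennreal (r/4)) sequentially"
      unfolding I_def by auto
    have r4: "0 \<le> r/4" using r by simp
    have ev: "eventually (\<lambda>n. dist (\<integral>x. J K x * h n x \<partial>lborel) (\<integral>x. J K x * h' x \<partial>lborel) < r/4) sequentially"
      using r by (intro tendstoD nearJ) auto
    have "eventually (\<lambda>n. norm ((\<integral>x. h n x \<partial>lborel) - (\<integral>x. h' x \<partial>lborel)) < r) sequentially"
      using K nearJ(2)[of K] ev
    proof eventually_elim
      case (elim n)
      note t1 = intI[OF elim(1) _ r4] absI[OF elim(1) _ r4]
      note t2 = intI[OF tail'[OF K] _ r4] absI[OF tail'[OF K] _ r4]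
      have "(\<integral>x. h n x \<partial>lborel) = (\<integral>x. J K x * h n x \<partial>lborel) + (\<integral>x. I K x * h n x \<partial>lborel)"
        by (subst split[of "h n" _ K]) (intro Bochner_Integration.integral_add elim(2) t1(1); measurable)
      moreover have "(\<integral>x. h' x \<partial>lborel) = (\<integral>x. J K x * h' x \<partial>lborel) + (\<integral>x. I K x * h' x \<partial>lborel)"
        by (subst split[of h' _ K]) (intro Bochner_Integration.integral_add nearJ(1) t2(1); measurable)
      ultimately show ?case using t1(2) t2(2) elim(3) r by (simp add: dist_real_def abs_if split: if_splits)
    qed
    then show "\<exists>no. \<forall>n\<ge>no. norm ((\<integral>x. h n x \<partial>lborel) - (\<integral>x. h' x \<partial>lborel)) < r"
      unfolding eventually_sequentially .
  qed
qed

text \<open>Cut \<open>{|y| \<ge> K}\<close> into dyadic shells up to the level \<open>A\<close>. The shell \<open>|y| \<ge> 2\<^sup>k K\<close> contributes a multiple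
  of \<open>(2\<^sup>k K)\<^sup>\<beta>\<^sup>-\<^sup>\<gamma>\<close>, and these sum like a geometric series with ratio \<open>2\<^sup>\<beta>\<^sup>-\<^sup>\<gamma> < 1\<close>.\<close>

lemma truncated_moment_tail:
  fixes P :: "'a::euclidean_space measure"
  assumes P: "prob_space P" and sets_P[measurable_cong]: "sets P = sets borel"
    and tail: "\<And>x. 1 \<le> x \<Longrightarrow> x \<le> A \<Longrightarrow> measure P {y. x \<le> norm y} \<le> D * x powr (- \<gamma>)"
    and K: "1 \<le> K" "K \<le> A" and \<beta>: "0 \<le> \<beta>" "\<beta> < \<gamma>"
  shows "(\<integral>y. indicator {y. K \<le> norm y} y * min (norm y) A powr \<beta> \<partial>P)
    \<le> D * 2 powr \<beta> / (1 - 2 powr (\<beta> - \<gamma>)) * K powr (\<beta> - \<gamma>)"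
proof -
  interpret prob_space P by fact
  have sp[simp]: "space P = UNIV" using sets_eq_imp_space_eq[OF sets_P] by simp
  define q where "q = (2::real) powr (\<beta> - \<gamma>)"
  have "q < 2 powr 0" unfolding q_def using \<beta> by (subst powr_less_cancel_iff) auto
  then have q: "0 < q" "q < 1" by (auto simp: q_def)
  have "0 \<le> D * 1 powr (- \<gamma>)" using tail[of 1] K measure_nonneg[of P "{y. 1 \<le> norm y}"] by linarith
  then have D: "0 \<le> D" by simp
  from dyadic_cell[of "A / K"] K obtain n where n: "2 ^ n \<le> A / K" "A / K < 2 ^ Suc n" by (auto simp: field_simps)
  let ?s = "\<lambda>y::'a. \<Sum>k\<le>n. (2 ^ Suc k * K) powr \<beta> * indicator {y. 2 ^ k * K \<le> norm y} y"
  have dom: "indicator {y. K \<le> norm y} y * min (norm y) A powr \<beta> \<le> ?s y" for y :: 'a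
  proof (cases "K \<le> norm y")
    case True
    define z where "z = min (norm y) A"
    have z: "K \<le> z" "z \<le> A" "z \<le> norm y" using True K by (auto simp: z_def)
    from dyadic_cell[of "z / K"] z K obtain m where m: "2 ^ m \<le> z / K" "z / K < 2 ^ Suc m" by auto
    have "(2::real) ^ m \<le> z / K" by (rule m)
    also have "\<dots> \<le> A / K" using z K by (simp add: divide_right_mono)
    also have "\<dots> < 2 ^ Suc n" by (rule n(2))
    finally have "m < Suc n" by (rule power_less_imp_less_exp[rotated]) simp
    have "z powr \<beta> \<le> (2 ^ Suc m * K) powr \<beta>"
      using m K z \<beta> by (intro powr_mono2) (auto simp: field_simps)
    also have "\<dots> = (2 ^ Suc m * K) powr \<beta> * indicator {y. 2 ^ m * K \<le> norm y} y"
      using m K z by (auto simp: field_simps)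
    also have "\<dots> \<le> ?s y" using \<open>m < Suc n\<close> by (intro member_le_sum) auto
    finally show ?thesis using True by (simp add: z_def)
  qed (simp add: sum_nonneg)
  have i1: "integrable P (\<lambda>y. (2 ^ Suc k * K) powr \<beta> * indicator {y. 2 ^ k * K \<le> norm y} y)" for k
    by (intro integrable_mult_right integrable_const_bound[where B=1]) (auto simp: indicator_def)
  have "(\<integral>y. indicator {y. K \<le> norm y} y * min (norm y) A powr \<beta> \<partial>P) \<le> (\<integral>y. ?s y \<partial>P)"
  proof (rule integral_mono)
    show "integrable P (\<lambda>y. indicator {y. K \<le> norm y} y * min (norm y) A powr \<beta>)"
      using K \<beta> by (intro integrable_const_bound[where B="A powr \<beta>"])
        (auto simp: indicator_def intro!: powr_mono2)
  qed (intro Bochner_Integration.integrable_sum i1, rule dom)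
  also have "\<dots> = (\<Sum>k\<le>n. (2 ^ Suc k * K) powr \<beta> * measure P {y. 2 ^ k * K \<le> norm y})"
    by (subst Bochner_Integration.integral_sum[OF i1]) simp
  also have "\<dots> \<le> (\<Sum>k\<le>n. D * 2 powr \<beta> * K powr (\<beta> - \<gamma>) * q ^ k)"
  proof (rule sum_mono)
    fix k assume k: "k \<in> {..n}"
    have pos: "0 < 2 ^ k * K" using K by simp
    show "(2 ^ Suc k * K) powr \<beta> * measure P {y. 2 ^ k * K \<le> norm y} \<le> D * 2 powr \<beta> * K powr (\<beta> - \<gamma>) * q ^ k"
    proof -
      have "(2::real) ^ k \<le> 2 ^ n" using k by (intro power_increasing) auto
      then have "2 ^ k * K \<le> 2 ^ n * K" using K by (intro mult_right_mono) auto
      also have "\<dots> \<le> A" using n(1) K by (simp add: field_simps)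
      finally have "2 ^ k * K \<le> A" .
      moreover have "1 * 1 \<le> 2 ^ k * K" using K by (intro mult_mono) auto
      ultimately have "measure P {y. 2 ^ k * K \<le> norm y} \<le> D * (2 ^ k * K) powr (- \<gamma>)"
        by (intro tail) auto
      then have "(2 ^ Suc k * K) powr \<beta> * measure P {y. 2 ^ k * K \<le> norm y}
        \<le> (2 ^ Suc k * K) powr \<beta> * (D * (2 ^ k * K) powr (- \<gamma>))"
        by (rule mult_left_mono) simp
      also have "(2 ^ Suc k * K) powr \<beta> * (D * (2 ^ k * K) powr (- \<gamma>))
        = D * 2 powr \<beta> * ((2 ^ k * K) powr \<beta> * (2 ^ k * K) powr (- \<gamma>))"
      proof -
        have "(2 ^ Suc k * K) powr \<beta> = 2 powr \<beta> * (2 ^ k * K) powr \<beta>"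
          using K by (simp add: powr_mult mult.assoc)
        then show ?thesis by (simp only: mult_ac)
      qed
      also have "(2 ^ k * K) powr \<beta> * (2 ^ k * K) powr (- \<gamma>) = (2 ^ k * K) powr (\<beta> - \<gamma>)"
        by (simp add: powr_add[symmetric])
      also have "\<dots> = q ^ k * K powr (\<beta> - \<gamma>)"
      proof -
        have "((2::real) ^ k) powr (\<beta> - \<gamma>) = (2 powr real k) powr (\<beta> - \<gamma>)" by (simp only: powr_realpow[of 2 k] zero_less_numeral)
        also have "\<dots> = q ^ k" by (simp only: q_def powr_powr powr_power[of 2] mult.commute)
        finally show ?thesis using K by (simp add: powr_mult)
      qed
      finally show ?thesis by (simp add: mult_ac)
    qed
  qed
  also have "\<dots> = D * 2 powr \<beta> * K powr (\<beta> - \<gamma>) * (\<Sum>k\<le>n. q ^ k)" by (simp add: sum_distrib_left)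
  also have "\<dots> \<le> D * 2 powr \<beta> * K powr (\<beta> - \<gamma>) * (\<Sum>k. q ^ k)"
    using q D by (intro mult_left_mono sum_le_suminf summable_geometric) auto
  also have "(\<Sum>k. q ^ k) = 1 / (1 - q)" using q by (intro suminf_geometric) auto
  finally show ?thesis by (simp add: q_def)
qed

section \<open>The limit law\<close>

text \<open>The functions \<open>1 - cos (\<xi> \<bullet> y)\<close> are integrable, and for each \<open>y \<noteq> 0\<close> one of them is positive at \<open>y\<close>
  already with \<open>\<xi>\<close> among the multiples \<open>b / m\<close> of the basis vectors.\<close>

lemma limit_density_sigma_finite:
  fixes \<eta> :: "'a::euclidean_space measure"
  assumes eta: "tail_limit_measure \<nu> \<eta>" and p: "limit_density \<eta> p"
  shows "sigma_finite_measure \<eta>"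
proof (rule sigma_finiteI_countable_integrable)
  have sets_eta: "sets \<eta> = sets borel" and e0: "emeasure \<eta> {0} = 0"
    using eta by (auto simp: tail_limit_measure_def)
  let ?f = "\<lambda>(m::nat, b::'a) y. 1 - cos ((b /\<^sub>R real (Suc m)) \<bullet> y)"
  show "countable (UNIV \<times> (Basis :: 'a set) :: (nat \<times> 'a) set)" by (simp add: countable_finite)
  show "{0} \<in> null_sets \<eta>" using e0 sets_eta by (auto simp: null_sets_def)
  show "integrable \<eta> (?f i)" for i using p by (cases i) (simp add: limit_density_def del: inner_scaleR_left)
  fix y assume "y \<in> space \<eta> - {0}"
  then obtain b where b: "b \<in> Basis" "y \<bullet> b \<noteq> 0" by (auto simp: euclidean_eq_iff[of y 0])
  obtain m where m: "\<bar>y \<bullet> b\<bar> < real m" using reals_Archimedean2 by blast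
  define z where "z = \<bar>y \<bullet> b\<bar> / real (Suc m)"
  have z: "0 < z" "z \<le> pi"
  proof -
    show "0 < z" using b by (simp add: z_def)
    have "z \<le> 1" using m by (simp add: z_def)
    then show "z \<le> pi" using pi_gt3 by linarith
  qed
  have "cos z < cos 0" using z by (intro cos_monotone_0_pi) auto
  moreover have "(b /\<^sub>R real (Suc m)) \<bullet> y = z \<or> (b /\<^sub>R real (Suc m)) \<bullet> y = - z"
    by (auto simp: z_def inner_commute divide_inverse abs_if)
  ultimately have "0 < ?f (m, b) y" by auto
  then show "\<exists>i\<in>UNIV \<times> Basis. 0 < ?f i y" using b(1) by (intro bexI[of _ "(m, b)"]) auto
qed

context
  fixes \<eta> :: "'a::euclidean_space measure" and p :: "'a \<Rightarrow> real"
  assumes p: "limit_density \<eta> p"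
begin

lemma limit_density_measurable: "p \<in> borel_measurable borel"
  and limit_density_nonneg: "0 \<le> p x"
  using p by (auto simp: limit_density_def)

lemma limit_density_prob_space: "prob_space (density lborel (\<lambda>x. ennreal (p x)))"
  using p by (intro prob_spaceI) (simp add: emeasure_density limit_density_def)

lemma limit_density_char:
  "(\<integral>x. iexp (\<xi> \<bullet> x) \<partial>density lborel (\<lambda>x. ennreal (p x))) = of_real (exp (- cos_exponent \<eta> \<xi>))"
proof -
  note [measurable] = limit_density_measurable
  have "(\<integral>x. iexp (\<xi> \<bullet> x) \<partial>density lborel (\<lambda>x. ennreal (p x))) = (\<integral>x. p x *\<^sub>R iexp (\<xi> \<bullet> x) \<partial>lborel)"
    by (rule integral_density) (auto simp: limit_density_nonneg)
  also have "\<dots> = (\<integral>x. iexp (\<xi> \<bullet> x) * of_real (p x) \<partial>lborel)"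
    by (simp add: scaleR_conv_of_real mult.commute)
  finally show ?thesis using p by (simp add: limit_density_def)
qed

text \<open>If the exponent vanished at \<open>\<theta>\<close>, then \<open>cos (\<theta> \<bullet> x) = 1\<close> almost surely under \<open>p\<close>; but these \<open>x\<close> form
  countably many hyperplanes, which are Lebesgue null.\<close>

lemma limit_density_exponent_pos:
  assumes "\<theta> \<noteq> 0" shows "0 < cos_exponent \<eta> \<theta>"
proof (rule ccontr)
  note [measurable] = limit_density_measurable
  assume "\<not> 0 < cos_exponent \<eta> \<theta>"
  then have z: "cos_exponent \<eta> \<theta> = 0" using cos_exponent_nonneg[of \<eta> \<theta>] by linarith
  let ?P = "density lborel (\<lambda>x. ennreal (p x))"
  interpret P: prob_space ?P by (rule limit_density_prob_space)
  have "(\<integral>x. cos (\<theta> \<bullet> x) \<partial>?P) = 1"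
    using char_cos_sin(1)[OF P.prob_space_axioms _ limit_density_char, of \<theta>] z by simp
  moreover have ic: "integrable ?P (\<lambda>x. cos (\<theta> \<bullet> x))" by (intro P.integrable_const_bound[where B=1]) auto
  ultimately have "(\<integral>x. 1 - cos (\<theta> \<bullet> x) \<partial>?P) = 0" using P.prob_space by simp
  moreover have "integrable ?P (\<lambda>x. 1 - cos (\<theta> \<bullet> x))" using ic by simp
  ultimately have AE1: "AE x in ?P. 1 - cos (\<theta> \<bullet> x) = 0"
    by (subst (asm) integral_nonneg_eq_0_iff_AE) auto
  let ?N = "\<Union>k::int. {x. \<theta> \<bullet> x = of_int k * 2 * pi}"
  have "?N \<in> null_sets lborel"
  proof (rule null_sets_UN)
    fix k :: int
    have "negligible {x. \<theta> \<bullet> x = of_int k * 2 * pi}" using assms by (intro negligible_hyperplane) auto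
    moreover have "closed {x. \<theta> \<bullet> x = of_int k * 2 * pi}" by (rule closed_hyperplane)
    ultimately show "{x. \<theta> \<bullet> x = of_int k * 2 * pi} \<in> null_sets lborel"
      by (simp add: negligible_iff_null_sets null_sets_completion_iff borel_closed)
  qed
  then have "AE x in lborel. x \<notin> ?N" by (rule AE_not_in)
  moreover have "AE x in lborel. 0 < ennreal (p x) \<longrightarrow> 1 - cos (\<theta> \<bullet> x) = 0"
    using AE1 by (subst (asm) AE_density) auto
  ultimately have "AE x in lborel. ennreal (p x) = 0"
  proof eventually_elim
    case (elim x)
    show ?case
    proof (rule ccontr)
      assume "ennreal (p x) \<noteq> 0"
      then have "cos (\<theta> \<bullet> x) = 1" using elim(2) by (simp add: zero_less_iff_neq_zero)
      then show False using elim(1) by (auto simp: cos_one_2pi_int)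
    qed
  qed
  then have "(\<integral>\<^sup>+x. ennreal (p x) \<partial>lborel) = 0" by (subst nn_integral_0_iff_AE) auto
  then show False using p by (simp add: limit_density_def)
qed

lemma limit_density_eq_inv_fourier:
  assumes "integrable lborel (\<lambda>\<xi>. exp (- cos_exponent \<eta> \<xi>))"
  shows "AE x in lborel. p x = inv_fourier (\<lambda>\<xi>. exp (- cos_exponent \<eta> \<xi>)) x"
proof -
  note [measurable] = limit_density_measurable
  let ?\<phi> = "\<lambda>\<xi>. exp (- cos_exponent \<eta> \<xi>)"
  have [measurable]: "?\<phi> \<in> borel_measurable borel" using borel_measurable_integrable[OF assms] by simp
  have "density lborel (\<lambda>x. ennreal (p x)) = density lborel (\<lambda>x. ennreal (inv_fourier ?\<phi> x))"
    by (rule fourier_inversion[OF limit_density_prob_space _ limit_density_char assms]) simp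
  then have "AE x in lborel. ennreal (p x) = ennreal (inv_fourier ?\<phi> x)"
    by (subst (asm) sigma_finite_measure.density_unique_iff[OF sigma_finite_lborel]) auto
  then show ?thesis
  proof eventually_elim
    case (elim x)
    have "0 \<le> inv_fourier ?\<phi> x"
      by (rule inv_fourier_nonneg[OF limit_density_prob_space _ limit_density_char assms]) simp
    then show ?case using elim limit_density_nonneg[of x] by simp
  qed
qed

end

lemma inv_fourier_uminus: "inv_fourier \<phi> (- x) = inv_fourier \<phi> x"
  by (simp add: inv_fourier_def)

lemma inv_fourier_tendsto:
  fixes \<phi> :: "nat \<Rightarrow> 'a::euclidean_space \<Rightarrow> real"
  assumes [measurable]: "\<And>n. \<phi> n \<in> borel_measurable borel" "\<phi>' \<in> borel_measurable borel"
    and lim: "\<And>\<xi>. (\<lambda>n. \<phi> n \<xi>) \<longlonglongrightarrow> \<phi>' \<xi>"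
    and k: "integrable lborel k" "\<And>n \<xi>. \<bar>\<phi> n \<xi>\<bar> \<le> k \<xi>"
  shows "(\<lambda>n. inv_fourier (\<phi> n) x) \<longlonglongrightarrow> inv_fourier \<phi>' x"
  unfolding inv_fourier_def
proof (intro tendsto_mult_left integral_dominated_convergence[where w=k])
  show "AE \<xi> in lborel. (\<lambda>n. cos (x \<bullet> \<xi>) * \<phi> n \<xi>) \<longlonglongrightarrow> cos (x \<bullet> \<xi>) * \<phi>' \<xi>"
    by (intro AE_I2 tendsto_intros lim)
  show "AE \<xi> in lborel. norm (cos (x \<bullet> \<xi>) * \<phi> n \<xi>) \<le> k \<xi>" for n
  proof (rule AE_I2)
    fix \<xi>
    have "\<bar>cos (x \<bullet> \<xi>)\<bar> * \<bar>\<phi> n \<xi>\<bar> \<le> 1 * k \<xi>" using k(2) by (intro mult_mono) auto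
    then show "norm (cos (x \<bullet> \<xi>) * \<phi> n \<xi>) \<le> k \<xi>" by (simp add: abs_mult)
  qed
qed (use k in auto)

lemma integrable_max_sq_gauss:
  "integrable lborel (\<lambda>\<xi>::'a::euclidean_space. max 1 ((norm \<xi>)\<^sup>2) * gauss \<xi>)"
proof (rule Bochner_Integration.integrable_bound)
  show "integrable lborel (\<lambda>\<xi>::'a. 4 * gauss (0 + (1 / sqrt 2) *\<^sub>R \<xi>))"
    by (intro integrable_mult_right integrable_lborel_affine integrable_gauss) simp
  show "AE \<xi>::'a in lborel. norm (max 1 ((norm \<xi>)\<^sup>2) * gauss \<xi>) \<le> norm (4 * gauss (0 + (1 / sqrt 2) *\<^sub>R \<xi>))"
  proof (rule AE_I2)
    fix \<xi> :: 'a
    \<comment> \<open>Half of the Gaussian exponent absorbs the square; the other half is again a Gaussian.\<close>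
    define r where "r = (norm \<xi>)\<^sup>2 / 4"
    have "1 + r \<le> exp r" by (rule exp_ge_add_one_self)
    moreover have r: "0 \<le> r" "(norm \<xi>)\<^sup>2 = 4 * r" by (auto simp: r_def)
    ultimately have "1 \<le> 4 * exp r" "4 * r \<le> 4 * exp r" by linarith+
    then have "max 1 ((norm \<xi>)\<^sup>2) \<le> 4 * exp r" using r(2) by simp
    then have "max 1 ((norm \<xi>)\<^sup>2) * gauss \<xi> \<le> 4 * exp r * gauss \<xi>"
      using gauss_pos[of \<xi>] by (intro mult_right_mono) auto
    also have "4 * exp r * gauss \<xi> = 4 * ((2 * pi) powr (- (DIM('a) / 2)) * exp (- r))"
    proof -
      have "gauss \<xi> = (2 * pi) powr (- (DIM('a) / 2)) * exp (- 2 * r)"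
        by (simp add: gauss_def r_def)
      moreover have "exp r * exp (- 2 * r) = exp (- r)" by (simp add: exp_add[symmetric])
      ultimately show ?thesis by (simp add: mult.left_commute)
    qed
    also have "(2 * pi) powr (- (DIM('a) / 2)) * exp (- r) = gauss (0 + (1 / sqrt 2) *\<^sub>R \<xi>)"
      by (simp add: gauss_def r_def power_divide)
    finally show "norm (max 1 ((norm \<xi>)\<^sup>2) * gauss \<xi>) \<le> norm (4 * gauss (0 + (1 / sqrt 2) *\<^sub>R \<xi>))"
      using gauss_pos[of \<xi>] by (simp add: abs_mult)
  qed
qed simp


section \<open>The rescaled process\<close>

lemma inverse_Suc_at_right_0: "filterlim (\<lambda>n. inverse (real (Suc n))) (at_right 0) sequentially"
  by (rule filterlim_compose[OF filterlim_inverse_at_right_top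
        filterlim_compose[OF filterlim_real_sequentially filterlim_Suc]])

locale scaled_levy = levy_rv \<nu> \<alpha> for \<nu> :: "'a::euclidean_space measure" and \<alpha> :: real +
  fixes M :: "'w measure" and X :: "real \<Rightarrow> 'w \<Rightarrow> 'a" and \<eta> :: "'a measure" and p :: "'a \<Rightarrow> real"
  assumes process: "symmetric_levy_process M X \<nu>"
    and eta: "tail_limit_measure \<nu> \<eta>"
    and p: "limit_density \<eta> p"
begin

abbreviation "\<psi> \<equiv> cos_exponent \<nu>"

definition u :: "real \<Rightarrow> real" where "u t = gen_inverse V (1 / t)"

definition scaled_char :: "real \<Rightarrow> 'a \<Rightarrow> real" where
  "scaled_char t \<xi> = exp (- (t * \<psi> (u t *\<^sub>R \<xi>)))"

definition limit_char :: "'a \<Rightarrow> real" where "limit_char \<xi> = exp (- cos_exponent \<eta> \<xi>)"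

definition scaled_law :: "real \<Rightarrow> 'a measure" where
  "scaled_law t = distr M borel (\<lambda>\<omega>. u t *\<^sub>R X t \<omega>)"

lemma prob_space_M: "prob_space M"
  using process by (simp add: symmetric_levy_process_def levy_process_def)

lemma X_measurable: "0 \<le> t \<Longrightarrow> X t \<in> borel_measurable M"
  using process by (simp add: symmetric_levy_process_def levy_process_def)

lemma prob_space_scaled_law: "0 \<le> t \<Longrightarrow> prob_space (scaled_law t)"
  unfolding scaled_law_def using X_measurable[of t] prob_space_M
  by (intro prob_space.prob_space_distr) auto

lemma sets_scaled_law: "sets (scaled_law t) = sets borel"
  by (simp add: scaled_law_def)

lemma char_scaled_law:
  assumes "0 \<le> t" shows "(\<integral>x. iexp (\<xi> \<bullet> x) \<partial>scaled_law t) = of_real (scaled_char t \<xi>)"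
proof -
  note [measurable] = X_measurable[OF assms]
  have "(\<integral>x. iexp (\<xi> \<bullet> x) \<partial>scaled_law t) = (\<integral>\<omega>. iexp ((u t *\<^sub>R \<xi>) \<bullet> X t \<omega>) \<partial>M)"
    unfolding scaled_law_def by (subst integral_distr) auto
  also have "\<dots> = of_real (exp (- t * \<psi> (u t *\<^sub>R \<xi>)))"
    using process assms unfolding symmetric_levy_process_def by blast
  finally show ?thesis by (simp add: scaled_char_def)
qed

lemma psi_measurable[measurable]: "\<psi> \<in> borel_measurable borel"
proof -
  interpret sigma_finite_measure \<nu> by (rule sigma_finite)
  show ?thesis unfolding cos_exponent_def[abs_def] by measurable
qed

lemma scaled_char_measurable[measurable]: "scaled_char t \<in> borel_measurable borel"
  unfolding scaled_char_def[abs_def] by measurable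

lemma u_at_top: "filterlim u at_top (at_right 0)"
  unfolding u_def[abs_def] by (rule gen_inverse_at_top)

lemma tV_tendsto: "((\<lambda>t. t * V (u t)) \<longlongrightarrow> 1) (at_right 0)"
  unfolding u_def by (rule V_gen_inverse)

lemma psi_tendsto: "((\<lambda>s. \<psi> (s *\<^sub>R \<xi>) / V s) \<longlongrightarrow> cos_exponent \<eta> \<xi>) at_top"
  using p by (intro cos_exponent_tendsto[OF eta limit_density_sigma_finite[OF eta p]])
    (simp add: limit_density_def)

lemma scaled_char_tendsto: "((\<lambda>t. scaled_char t \<xi>) \<longlongrightarrow> limit_char \<xi>) (at_right 0)"
proof -
  from ev_pos obtain s0 where s0: "\<And>s. s \<ge> s0 \<Longrightarrow> 0 < V s" by blast
  have "((\<lambda>t. (t * V (u t)) * (\<psi> (u t *\<^sub>R \<xi>) / V (u t))) \<longlongrightarrow> 1 * cos_exponent \<eta> \<xi>) (at_right 0)"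
    by (intro tendsto_mult tV_tendsto filterlim_compose[OF psi_tendsto u_at_top])
  also have "?this \<longleftrightarrow> ((\<lambda>t. t * \<psi> (u t *\<^sub>R \<xi>)) \<longlongrightarrow> cos_exponent \<eta> \<xi>) (at_right 0)"
  proof (rule filterlim_cong)
    have "eventually (\<lambda>t. s0 \<le> u t) (at_right 0)" using u_at_top by (simp add: filterlim_at_top)
    then show "eventually (\<lambda>t. (t * V (u t)) * (\<psi> (u t *\<^sub>R \<xi>) / V (u t)) = t * \<psi> (u t *\<^sub>R \<xi>)) (at_right 0)"
      by eventually_elim (use s0 in force)
  qed auto
  finally show ?thesis unfolding scaled_char_def limit_char_def by (intro tendsto_intros)
qed

text \<open>For \<open>|\<xi>| \<ge> 1\<close> the uniform lower bound gives \<open>t \<psi>(u \<xi>) \<ge> c t V(u |\<xi>|)\<close>; this is at least a multiple of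
  \<open>|\<xi>| t V(u)\<close> by the lower Potter bound with exponent \<open>1 < \<alpha>\<close>, and \<open>t V(u)\<close> tends to 1.\<close>

lemma scaled_char_dominated:
  assumes "1 < \<alpha>"
  obtains c where "0 < c" "eventually (\<lambda>t. \<forall>\<xi>. scaled_char t \<xi> \<le> exp (c - c * norm \<xi>)) (at_right 0)"
proof -
  have "0 < cos_exponent \<eta> \<theta>" if "norm \<theta> = 1" for \<theta>
    using that by (intro limit_density_exponent_pos[OF p]) auto
  from cos_exponent_lower_bound[OF psi_tendsto this] obtain c s1 where c: "0 < c"
    "\<And>s \<theta>. s \<ge> s1 \<Longrightarrow> norm \<theta> = 1 \<Longrightarrow> c * V s \<le> \<psi> (s *\<^sub>R \<theta>)" by blast
  from potter_lower[OF assms] obtain s0 where s0: "0 < s0" "\<And>s. s \<ge> s0 \<Longrightarrow> 0 < V s"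
    "\<And>s x. s \<ge> s0 \<Longrightarrow> 1 \<le> x \<Longrightarrow> x powr 1 * V s \<le> 2 powr 1 * V (s * x)" by (auto simp del: powr_one)
  have ev: "eventually (\<lambda>t. 0 < t \<and> 1/2 < t * V (u t) \<and> max s0 s1 \<le> u t) (at_right 0)"
    using order_tendstoD(1)[OF tV_tendsto, of "1/2"] u_at_top
    by (intro eventually_conj eventually_at_right_less) (auto simp: filterlim_at_top simp del: max.bounded_iff)
  show thesis
  proof (rule that[of "c / 4"])
    show "eventually (\<lambda>t. \<forall>\<xi>. scaled_char t \<xi> \<le> exp (c / 4 - c / 4 * norm \<xi>)) (at_right 0)"
      using ev
    proof (eventually_elim, intro allI)
      fix t and \<xi> :: 'a assume t: "0 < t \<and> 1/2 < t * V (u t) \<and> max s0 s1 \<le> u t"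
      show "scaled_char t \<xi> \<le> exp (c / 4 - c / 4 * norm \<xi>)"
      proof (cases "norm \<xi> < 1")
        case True
        have "0 \<le> t * \<psi> (u t *\<^sub>R \<xi>)"
          using t by (intro mult_nonneg_nonneg cos_exponent_nonneg) auto
        moreover have "0 \<le> c / 4 - c / 4 * norm \<xi>" using True c by simp
        ultimately show ?thesis unfolding scaled_char_def by simp
      next
        case False
        define x where "x = norm \<xi>"
        have x: "1 \<le> x" using False by (simp add: x_def)
        define \<theta> where "\<theta> = \<xi> /\<^sub>R x"
        have \<theta>: "norm \<theta> = 1" "\<xi> = x *\<^sub>R \<theta>" 
        proof -
          have "\<xi> \<noteq> 0" using False by auto
          then show "norm \<theta> = 1" "\<xi> = x *\<^sub>R \<theta>" by (simp_all add: \<theta>_def x_def)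
        qed
        have "u t * 1 \<le> u t * x" using x t s0(1) by (intro mult_left_mono) auto
        then have ux: "s1 \<le> u t * x" using t by simp
        have "c / 4 * x = c * (1/2 * x) / 2" by simp
        also have "\<dots> \<le> c * (t * V (u t) * x) / 2"
          using c t x by (intro divide_right_mono mult_left_mono mult_right_mono) auto
        also have "\<dots> = t * (c * (x * V (u t) / 2))" by simp
        also have "\<dots> \<le> t * (c * V (u t * x))"
          using s0(3)[of "u t" x] x t c by (intro mult_left_mono) auto
        also have "\<dots> \<le> t * \<psi> ((u t * x) *\<^sub>R \<theta>)"
          using t by (intro mult_left_mono c(2) ux \<theta>) auto
        also have "(u t * x) *\<^sub>R \<theta> = u t *\<^sub>R \<xi>" by (simp add: \<theta>(2))
        finally have "c / 4 * x \<le> t * \<psi> (u t *\<^sub>R \<xi>)" .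
        then show ?thesis unfolding scaled_char_def x_def using c by simp
      qed
    qed
  qed (use c in auto)
qed

text \<open>The restriction \<open>x \<le> u / w\<close> keeps \<open>u / x\<close> in the range where \<open>V\<close> behaves like a power. It cannot be
  dropped: the assumptions say nothing about the large jumps of the process.\<close>

lemma scaled_law_tail:
  assumes "0 \<le> \<gamma>" "\<gamma> < \<alpha>"
  obtains D w where "0 < D" "0 < w"
    "eventually (\<lambda>t. \<forall>x. 1 \<le> x \<longrightarrow> x \<le> u t / w \<longrightarrow>
       measure (scaled_law t) {y. x \<le> norm y} \<le> D * x powr (- \<gamma>)) (at_right 0)"
proof -
  from trunc_moment_le_tail obtain C w0 where C: "0 < C" "0 < w0"
    "\<And>w. w \<ge> w0 \<Longrightarrow> trunc_moment \<nu> w \<le> C * V w" by blast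
  from potter_lower[OF assms(2,1)] obtain s0 where s0: "0 < s0" "\<And>s. s \<ge> s0 \<Longrightarrow> 0 < V s"
    "\<And>s x. s \<ge> s0 \<Longrightarrow> 1 \<le> x \<Longrightarrow> x powr \<gamma> * V s \<le> 2 powr \<gamma> * V (s * x)" by blast
  define G where "G = (\<integral>\<xi>. max 1 ((norm \<xi>)\<^sup>2) * gauss (\<xi>::'a) \<partial>lborel)"
  have "(\<integral>\<xi>. gauss (\<xi>::'a) \<partial>lborel) \<le> G" unfolding G_def
  proof (intro integral_mono integrable_gauss integrable_max_sq_gauss)
    show "gauss \<xi> \<le> max 1 ((norm \<xi>)\<^sup>2) * gauss \<xi>" for \<xi> :: 'a
      using mult_right_mono[of 1 "max 1 ((norm \<xi>)\<^sup>2)" "gauss \<xi>"] gauss_pos[of \<xi>] by simp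
  qed
  then have G: "1 \<le> G" by (simp add: integral_gauss)
  have ev: "eventually (\<lambda>t. 0 < t \<and> t * V (u t) < 2) (at_right 0)"
    using order_tendstoD(2)[OF tV_tendsto, of 2] eventually_at_right_less[of 0] by (auto elim: eventually_elim2)
  show thesis
  proof (rule that[of "12 * C * G * 2 powr \<gamma>" "max w0 s0"])
    show "eventually (\<lambda>t. \<forall>x. 1 \<le> x \<longrightarrow> x \<le> u t / max w0 s0 \<longrightarrow>
       measure (scaled_law t) {y. x \<le> norm y} \<le> 12 * C * G * 2 powr \<gamma> * x powr (- \<gamma>)) (at_right 0)"
      using ev
    proof (eventually_elim, intro allI impI)
      fix t x :: real assume t: "0 < t \<and> t * V (u t) < 2" and x: "1 \<le> x" "x \<le> u t / max w0 s0"
      have m0: "0 < max w0 s0" using C by simp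
      have ux: "max w0 s0 \<le> u t / x" using x m0 by (simp add: field_simps del: max.bounded_iff)
      then have ux': "w0 \<le> u t / x" "s0 \<le> u t / x" by auto
      have "0 < u t / x" using ux m0 by linarith
      then have u0: "0 < u t" using x by (simp add: zero_less_divide_iff)
      let ?T = "trunc_moment \<nu> (u t / x)"
      have bound: "(1 - scaled_char t (\<xi> /\<^sub>R x)) * gauss \<xi> \<le> (2 * t * ?T) * (max 1 ((norm \<xi>)\<^sup>2) * gauss \<xi>)" for \<xi>
      proof -
        have "1 - scaled_char t (\<xi> /\<^sub>R x) \<le> t * \<psi> (u t *\<^sub>R (\<xi> /\<^sub>R x))"
          using exp_ge_add_one_self[of "- (t * \<psi> (u t *\<^sub>R (\<xi> /\<^sub>R x)))"]
          unfolding scaled_char_def by linarith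
        also have "\<dots> = t * \<psi> ((u t / x) *\<^sub>R \<xi>)" by (simp add: divide_inverse)
        also have "\<dots> \<le> t * (2 * trunc_moment \<nu> (norm \<xi> * (u t / x)))"
          using t u0 x cos_exponent_scale_bound[of "u t / x" \<xi>] by (intro mult_left_mono) (auto simp: mult.commute)
        also have "\<dots> \<le> t * (2 * (max 1 ((norm \<xi>)\<^sup>2) * ?T))"
          using t by (intro mult_left_mono trunc_moment_scale) auto
        finally have "(1 - scaled_char t (\<xi> /\<^sub>R x)) * gauss \<xi> \<le> (t * (2 * (max 1 ((norm \<xi>)\<^sup>2) * ?T))) * gauss \<xi>"
          using gauss_pos[of \<xi>] by (intro mult_right_mono) auto
        then show ?thesis by (simp only: mult_ac)
      qed
      have "measure (scaled_law t) {y. x \<le> norm y} \<le> 3 * (\<integral>\<xi>. (1 - scaled_char t (\<xi> /\<^sub>R x)) * gauss \<xi> \<partial>lborel)"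
        using t x by (intro char_tail_bound[OF prob_space_scaled_law sets_scaled_law char_scaled_law]) auto
      also have "(\<integral>\<xi>. (1 - scaled_char t (\<xi> /\<^sub>R x)) * gauss \<xi> \<partial>lborel)
        \<le> (\<integral>\<xi>. (2 * t * ?T) * (max 1 ((norm \<xi>)\<^sup>2) * gauss (\<xi>::'a)) \<partial>lborel)"
      proof (rule integral_mono)
        show "integrable lborel (\<lambda>\<xi>. (2 * t * ?T) * (max 1 ((norm \<xi>)\<^sup>2) * gauss (\<xi>::'a)))"
          by (rule integrable_mult_right[OF integrable_max_sq_gauss])
        have "\<bar>(1 - scaled_char t (\<xi> /\<^sub>R x)) * gauss \<xi>\<bar> \<le> gauss \<xi>" for \<xi>
        proof -
          have "0 \<le> t * \<psi> (u t *\<^sub>R (\<xi> /\<^sub>R x))"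
            using t by (intro mult_nonneg_nonneg cos_exponent_nonneg) auto
          then have "\<bar>1 - scaled_char t (\<xi> /\<^sub>R x)\<bar> \<le> 1"
            unfolding scaled_char_def by (simp only: abs_if exp_le_one_iff) (simp add: not_less)
          then have "\<bar>1 - scaled_char t (\<xi> /\<^sub>R x)\<bar> * gauss \<xi> \<le> 1 * gauss \<xi>"
            using gauss_pos[of \<xi>] by (intro mult_right_mono) auto
          then show ?thesis by (simp add: abs_mult)
        qed
        then show "integrable lborel (\<lambda>\<xi>. (1 - scaled_char t (\<xi> /\<^sub>R x)) * gauss \<xi>)"
          by (intro Bochner_Integration.integrable_bound[OF integrable_gauss]) auto
      qed (rule bound)
      also have "\<dots> = 2 * t * ?T * G" by (simp only: G_def integral_mult_right_zero)
      also have "\<dots> \<le> 2 * t * (C * V (u t / x)) * G"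
        using t G ux' by (intro mult_right_mono mult_left_mono C(3)) auto
      also have "\<dots> = 2 * C * G * (t * V (u t / x))" by simp
      also have "t * V (u t / x) \<le> 2 * 2 powr \<gamma> * x powr (- \<gamma>)"
      proof -
        have "x powr \<gamma> * V (u t / x) \<le> 2 powr \<gamma> * V (u t / x * x)"
          using ux' x by (intro s0(3)) auto
        also have "u t / x * x = u t" using x by simp
        finally have "x powr \<gamma> * V (u t / x) \<le> 2 powr \<gamma> * V (u t)" .
        then have "t * (x powr \<gamma> * V (u t / x)) \<le> t * (2 powr \<gamma> * V (u t))"
          using t by (intro mult_left_mono) auto
        also have "\<dots> = 2 powr \<gamma> * (t * V (u t))" by simp
        also have "\<dots> \<le> 2 powr \<gamma> * 2" using t by (intro mult_left_mono) auto
        finally show ?thesis using x by (simp add: powr_minus field_simps)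
      qed
      finally show "measure (scaled_law t) {y. x \<le> norm y} \<le> 12 * C * G * 2 powr \<gamma> * x powr (- \<gamma>)"
        using C G by (simp add: mult_left_mono mult_ac)
    qed
  qed (use C G in auto)
qed


lemma limit_char_measurable[measurable]: "limit_char \<in> borel_measurable borel"
proof -
  have "(\<lambda>n. scaled_char (inverse (real (Suc n))) \<xi>) \<longlonglongrightarrow> limit_char \<xi>" for \<xi>
    by (rule filterlim_compose[OF scaled_char_tendsto inverse_Suc_at_right_0])
  from borel_measurable_LIMSEQ_real[OF this scaled_char_measurable] show ?thesis .
qed

lemma integrable_dominator: "0 < c \<Longrightarrow> integrable lborel (\<lambda>\<xi>::'a. exp (c - c * norm \<xi>))"
  using integrable_mult_right[OF integrable_exp_neg_norm[of c], of "exp c"] by (simp add: exp_diff exp_minus divide_inverse)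

lemma integrable_limit_char:
  assumes "1 < \<alpha>" shows "integrable lborel limit_char"
proof -
  from scaled_char_dominated[OF assms] obtain c where c: "0 < c"
    "eventually (\<lambda>t. \<forall>\<xi>. scaled_char t \<xi> \<le> exp (c - c * norm \<xi>)) (at_right 0)" by blast
  have "limit_char \<xi> \<le> exp (c - c * norm \<xi>)" for \<xi>
    by (rule tendsto_upperbound[OF scaled_char_tendsto]) (use c(2) in \<open>auto elim: eventually_mono\<close>)
  then show ?thesis
    by (intro Bochner_Integration.integrable_bound[OF integrable_dominator[OF c(1)]])
      (auto simp: limit_char_def)
qed

definition scaled_density :: "real \<Rightarrow> 'a \<Rightarrow> real" where
  "scaled_density t = inv_fourier (scaled_char t)"

lemma scaled_density_measurable[measurable]: "scaled_density t \<in> borel_measurable borel"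
  unfolding scaled_density_def by measurable

lemma scaled_density_uminus: "scaled_density t (- x) = scaled_density t x"
  by (simp add: scaled_density_def inv_fourier_uminus)

lemma scaled_law_density:
  assumes t: "0 \<le> t" and c: "0 < c" "\<And>\<xi>. scaled_char t \<xi> \<le> exp (c - c * norm \<xi>)"
  shows "scaled_law t = density lborel (\<lambda>x. ennreal (scaled_density t x))" "0 \<le> scaled_density t x"
proof -
  have i: "integrable lborel (scaled_char t)"
    using c(2) by (intro Bochner_Integration.integrable_bound[OF integrable_dominator[OF c(1)]])
      (auto simp: scaled_char_def)
  note 1 = prob_space_scaled_law[OF t] sets_scaled_law char_scaled_law[OF t]
  show "scaled_law t = density lborel (\<lambda>x. ennreal (scaled_density t x))"
    unfolding scaled_density_def by (rule fourier_inversion[OF 1 i])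
  show "0 \<le> scaled_density t x"
    unfolding scaled_density_def by (rule inv_fourier_nonneg[OF 1 i])
qed

lemma expectation_scaled_law:
  fixes F :: "'a \<Rightarrow> real"
  assumes t: "0 \<le> t" "u t \<noteq> 0" and [measurable]: "F \<in> borel_measurable borel"
  shows "(\<integral>\<omega>. F (X t \<omega>) \<partial>M) = (\<integral>y. F (y /\<^sub>R u t) \<partial>scaled_law t)"
  unfolding scaled_law_def using X_measurable[OF t(1)] t(2)
  by (subst integral_distr) auto

lemma expectation_density:
  fixes F :: "'a \<Rightarrow> real"
  assumes t: "0 \<le> t" "u t \<noteq> 0" and [measurable]: "F \<in> borel_measurable borel"
    and c: "0 < c" "\<And>\<xi>. scaled_char t \<xi> \<le> exp (c - c * norm \<xi>)"
  shows "(\<integral>\<omega>. F (X t \<omega>) \<partial>M) = (\<integral>y. F (y /\<^sub>R u t) * scaled_density t y \<partial>lborel)"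
proof -
  have "(\<integral>\<omega>. F (X t \<omega>) \<partial>M) = (\<integral>y. F (y /\<^sub>R u t) \<partial>density lborel (\<lambda>x. ennreal (scaled_density t x)))"
    unfolding expectation_scaled_law[OF t assms(3)] scaled_law_density(1)[OF t(1) c] ..
  also have "\<dots> = (\<integral>y. scaled_density t y *\<^sub>R F (y /\<^sub>R u t) \<partial>lborel)"
    by (rule integral_density) (auto simp: scaled_law_density(2)[OF t(1) c])
  finally show ?thesis by (simp add: mult.commute)
qed

text \<open>Symmetry of \<open>X\<^sub>t\<close>, read off the evenness of its density.\<close>

lemma expectation_uminus:
  fixes F :: "'a \<Rightarrow> real"
  assumes t: "0 \<le> t" "u t \<noteq> 0" and [measurable]: "F \<in> borel_measurable borel"
    and c: "0 < c" "\<And>\<xi>. scaled_char t \<xi> \<le> exp (c - c * norm \<xi>)"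
  shows "(\<integral>\<omega>. F (- X t \<omega>) \<partial>M) = (\<integral>\<omega>. F (X t \<omega>) \<partial>M)"
proof -
  have m: "(\<lambda>x. F (- x)) \<in> borel_measurable borel" by measurable
  have "(\<integral>y. F (y /\<^sub>R u t) * scaled_density t y \<partial>lborel) = (\<integral>y. F (- (y /\<^sub>R u t)) * scaled_density t y \<partial>lborel)"
    by (subst integral_lborel_affine[of _ "-1" 0]) (auto simp: scaled_density_uminus)
  then show ?thesis
    using expectation_density[OF t m c] expectation_density[OF t assms(3) c] by simp
qed

text \<open>The analytic core. The densities of \<open>u X\<^sub>t\<close> converge pointwise and boundedly, which allows dominated
  convergence on balls although \<open>\<rho>\<close> may be discontinuous; the tail and moment estimates above deal with
  the complements of the balls.\<close>

theorem scaled_expectation_tendsto: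
  fixes Q \<rho> :: "'a \<Rightarrow> real"
  assumes \<alpha>1: "1 < \<alpha>" and \<beta>: "0 \<le> \<beta>" "\<beta> < \<alpha>"
    and [measurable]: "Q \<in> borel_measurable borel"
    and QL: "\<And>x. \<bar>Q x\<bar> \<le> L * norm x powr \<beta>" and QB: "\<And>x. \<bar>Q x\<bar> \<le> B"
    and Q_lim: "\<And>y. ((\<lambda>v. v powr \<beta> * Q (y /\<^sub>R v)) \<longlongrightarrow> \<rho> y) at_top"
  shows "integrable lborel (\<lambda>y. \<rho> y * p y)"
    and "((\<lambda>t. u t powr \<beta> * (\<integral>\<omega>. Q (X t \<omega>) \<partial>M)) \<longlongrightarrow> (\<integral>y. \<rho> y * p y \<partial>lborel)) (at_right 0)"
proof -
  \<comment> \<open>A tail exponent strictly between \<open>\<beta>\<close> and \<open>\<alpha>\<close>: below \<open>\<alpha>\<close> for the tail bound, above \<open>\<beta>\<close> for its integrability.\<close>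
  define \<gamma> where "\<gamma> = (\<alpha> + \<beta>) / 2"
  have \<gamma>: "\<beta> < \<gamma>" "\<gamma> < \<alpha>" "0 \<le> \<gamma>" using \<beta> alpha by (auto simp: \<gamma>_def)
  from scaled_char_dominated[OF \<alpha>1] obtain c where c: "0 < c"
    "eventually (\<lambda>t. \<forall>\<xi>. scaled_char t \<xi> \<le> exp (c - c * norm \<xi>)) (at_right 0)" by blast
  from scaled_law_tail[OF \<gamma>(3,2)] obtain D w where D: "0 < D" "0 < w"
    "eventually (\<lambda>t. \<forall>x. 1 \<le> x \<longrightarrow> x \<le> u t / w \<longrightarrow>
       measure (scaled_law t) {y. x \<le> norm y} \<le> D * x powr (- \<gamma>)) (at_right 0)" by blast
  have ev: "eventually (\<lambda>t. 0 < t \<and> 0 < u t \<and> (\<forall>\<xi>. scaled_char t \<xi> \<le> exp (c - c * norm \<xi>)) \<and>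
    (\<forall>x. 1 \<le> x \<longrightarrow> x \<le> u t / w \<longrightarrow>
       measure (scaled_law t) {y. x \<le> norm y} \<le> D * x powr (- \<gamma>))) (at_right 0)"
    using u_at_top by (intro eventually_conj eventually_at_right_less c(2) D(3)) (simp add: filterlim_at_top_dense)
  define k where "k = (\<lambda>\<xi>::'a. exp (c - c * norm \<xi>))"
  have k: "integrable lborel k" unfolding k_def by (rule integrable_dominator[OF c(1)])
  define f where "f = inv_fourier limit_char"
  have [measurable]: "f \<in> borel_measurable borel" unfolding f_def by measurable
  have L0: "0 \<le> L"
  proof -
    obtain b :: 'a where "b \<in> Basis" using nonempty_Basis by blast
    then show ?thesis using QL[of b] abs_ge_zero[of "Q b"] by (simp del: abs_ge_zero)
  qed
  have B0: "0 \<le> B" using QB[of 0] by linarith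
  have \<rho>_meas[measurable]: "\<rho> \<in> borel_measurable borel"
  proof (rule borel_measurable_LIMSEQ_real)
    show "(\<lambda>n. real n powr \<beta> * Q (y /\<^sub>R real n)) \<longlonglongrightarrow> \<rho> y" for y
      by (rule filterlim_compose[OF Q_lim filterlim_real_sequentially])
  qed measurable
  have main: "integrable lborel (\<lambda>y. \<rho> y * f y) \<and>
    (\<lambda>n. u (T n) powr \<beta> * (\<integral>\<omega>. Q (X (T n) \<omega>) \<partial>M)) \<longlonglongrightarrow> (\<integral>y. \<rho> y * f y \<partial>lborel)"
    if T: "filterlim T (at_right 0) sequentially" for T :: "nat \<Rightarrow> real"
  proof -
    from eventually_compose_filterlim[OF ev T] obtain N where N:
      "\<And>n. n \<ge> N \<Longrightarrow> 0 < T n \<and> 0 < u (T n) \<and> (\<forall>\<xi>. scaled_char (T n) \<xi> \<le> exp (c - c * norm \<xi>)) \<and>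
       (\<forall>x. 1 \<le> x \<longrightarrow> x \<le> u (T n) / w \<longrightarrow>
         measure (scaled_law (T n)) {y. x \<le> norm y} \<le> D * x powr (- \<gamma>))"
      unfolding eventually_sequentially by blast
    define S where "S n = T (n + N)" for n
    have S: "0 < S n" "0 < u (S n)" "scaled_char (S n) \<xi> \<le> k \<xi>"
      "1 \<le> x \<Longrightarrow> x \<le> u (S n) / w \<Longrightarrow> measure (scaled_law (S n)) {y. x \<le> norm y} \<le> D * x powr (- \<gamma>)" for n \<xi> x
      using N[of "n + N"] by (auto simp: S_def k_def)
    have S_lim: "filterlim S (at_right 0) sequentially"
      unfolding S_def by (rule filterlim_compose[OF T filterlim_add_const_nat_at_top])
    have uS: "filterlim (\<lambda>n. u (S n)) at_top sequentially" by (rule filterlim_compose[OF u_at_top S_lim])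
    have char_abs: "\<bar>scaled_char (S n) \<xi>\<bar> \<le> k \<xi>" for n \<xi> using S(3)[of n \<xi>] by (simp add: scaled_char_def)
    have char_lim: "(\<lambda>n. scaled_char (S n) \<xi>) \<longlonglongrightarrow> limit_char \<xi>" for \<xi>
      by (rule filterlim_compose[OF scaled_char_tendsto S_lim])
    have f_lim: "(\<lambda>n. scaled_density (S n) x) \<longlonglongrightarrow> f x" for x
      unfolding scaled_density_def f_def by (rule inv_fourier_tendsto[OF _ _ char_lim k char_abs]) measurable
    have f_nonneg: "0 \<le> scaled_density (S n) x" for n x
      using S(1,3)[of n] c(1) by (intro scaled_law_density(2)[of _ c]) (auto simp: k_def)
    define B1 where "B1 = (2 * pi) powr (- real DIM('a)) * (\<integral>\<xi>. k \<xi> \<partial>lborel)"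
    have f_bd: "\<bar>scaled_density (S n) x\<bar> \<le> B1" for n x
      unfolding scaled_density_def B1_def by (rule abs_inv_fourier_le[OF _ k char_abs]) measurable
    define h where "h n y = u (S n) powr \<beta> * Q (y /\<^sub>R u (S n)) * scaled_density (S n) y" for n y
    have hm[measurable]: "h n \<in> borel_measurable borel" for n unfolding h_def by measurable
    have q_bd: "\<bar>u (S n) powr \<beta> * Q (y /\<^sub>R u (S n))\<bar> \<le> L * norm y powr \<beta>" for n y
    proof -
      have "\<bar>u (S n) powr \<beta> * Q (y /\<^sub>R u (S n))\<bar> \<le> u (S n) powr \<beta> * (L * norm (y /\<^sub>R u (S n)) powr \<beta>)"
        unfolding abs_mult by (intro mult_mono QL) auto
      also have "\<dots> = L * norm y powr \<beta>"
        using S(2)[of n] by (simp add: powr_mult powr_divide inverse_eq_divide field_simps)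
      finally show ?thesis .
    qed
    \<comment> \<open>The first summand serves \<open>|y| \<le> u / w\<close>, the second the rest, where only \<open>|Q| \<le> B\<close> helps.\<close>
    define C1 where "C1 = L + B * w powr \<beta>"
    have C1: "0 \<le> C1" using L0 B0 by (simp add: C1_def)
    have q_bd2: "\<bar>u (S n) powr \<beta> * Q (y /\<^sub>R u (S n))\<bar> \<le> C1 * min (norm y) (u (S n) / w) powr \<beta>" for n y
    proof (cases "norm y \<le> u (S n) / w")
      case True
      have "L * norm y powr \<beta> \<le> C1 * norm y powr \<beta>" using B0 by (intro mult_right_mono) (auto simp: C1_def)
      then show ?thesis using q_bd[of n y] True by simp
    next
      case False
      have "\<bar>u (S n) powr \<beta> * Q (y /\<^sub>R u (S n))\<bar> \<le> u (S n) powr \<beta> * B"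
        unfolding abs_mult by (intro mult_mono QB) auto
      also have "\<dots> = B * w powr \<beta> * (u (S n) / w) powr \<beta>"
        using S(2)[of n] D(2) by (simp add: powr_divide)
      also have "\<dots> \<le> C1 * (u (S n) / w) powr \<beta>" using L0 by (intro mult_right_mono) (auto simp: C1_def)
      finally show ?thesis using False by simp
    qed
    have "integrable lborel (\<lambda>y. \<rho> y * f y)" and
      "(\<lambda>n. \<integral>y. h n y \<partial>lborel) \<longlonglongrightarrow> (\<integral>y. \<rho> y * f y \<partial>lborel)"
    proof -
      have 1: "(\<lambda>n. h n y) \<longlonglongrightarrow> \<rho> y * f y" for y
        unfolding h_def by (intro tendsto_mult f_lim filterlim_compose[OF Q_lim uS])
      have 2: "\<exists>B. eventually (\<lambda>n. \<forall>y. norm y < K \<longrightarrow> \<bar>h n y\<bar> \<le> B) sequentially" for K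
      proof (intro exI always_eventually allI impI)
        fix n and y :: 'a assume y: "norm y < K"
        have "\<bar>h n y\<bar> \<le> (L * norm y powr \<beta>) * B1"
          unfolding h_def abs_mult[of "_ * _"] using L0 by (intro mult_mono q_bd f_bd) auto
        also have "\<dots> \<le> (L * K powr \<beta>) * B1"
          using y L0 \<beta> order_trans[OF abs_ge_zero f_bd] by (intro mult_right_mono mult_left_mono powr_mono2) auto
        finally show "\<bar>h n y\<bar> \<le> L * K powr \<beta> * B1" .
      qed
      have 3: "\<exists>K. eventually (\<lambda>n. (\<integral>\<^sup>+y. ennreal (indicator {y. K \<le> norm y} y * \<bar>h n y\<bar>) \<partial>lborel) \<le> ennreal e) sequentially"
        if e: "0 < e" for e
      proof -
        define D1 where "D1 = D * 2 powr \<beta> / (1 - 2 powr (\<beta> - \<gamma>))"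
        have "((\<lambda>K. C1 * (D1 * K powr (\<beta> - \<gamma>))) \<longlongrightarrow> C1 * (D1 * 0)) at_top"
          using \<gamma> by (intro tendsto_mult_left tendsto_neg_powr filterlim_ident) auto
        then have "eventually (\<lambda>K. C1 * (D1 * K powr (\<beta> - \<gamma>)) < e \<and> 1 \<le> K) at_top"
          using e by (intro eventually_conj order_tendstoD(2)[of _ 0] eventually_ge_at_top) auto
        then obtain K where K: "C1 * (D1 * K powr (\<beta> - \<gamma>)) < e" "1 \<le> K"
          unfolding eventually_at_top_linorder by blast
        have "eventually (\<lambda>n. K * w \<le> u (S n)) sequentially" using uS by (simp add: filterlim_at_top)
        then have "eventually (\<lambda>n. (\<integral>\<^sup>+y. ennreal (indicator {y. K \<le> norm y} y * \<bar>h n y\<bar>) \<partial>lborel) \<le> ennreal e) sequentially"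
        proof eventually_elim
          case (elim n)
          let ?A = "u (S n) / w"
          let ?P = "scaled_law (S n)"
          have A: "K \<le> ?A" using elim D(2) by (simp add: field_simps)
          have P: "prob_space ?P" using S(1)[of n] by (intro prob_space_scaled_law) auto
          interpret P: prob_space ?P by fact
          have sP[measurable_cong]: "sets ?P = sets borel" by (rule sets_scaled_law)
          have dens: "?P = density lborel (\<lambda>x. ennreal (scaled_density (S n) x))"
            using S(1,3)[of n] c(1) by (intro scaled_law_density(1)[of _ c]) (auto simp: k_def)
          have "(\<integral>\<^sup>+y. ennreal (indicator {y. K \<le> norm y} y * \<bar>h n y\<bar>) \<partial>lborel)
            = (\<integral>\<^sup>+y. ennreal (scaled_density (S n) y) * ennreal (indicator {y. K \<le> norm y} y * \<bar>u (S n) powr \<beta> * Q (y /\<^sub>R u (S n))\<bar>) \<partial>lborel)"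
            by (intro nn_integral_cong) (simp add: h_def abs_mult f_nonneg ennreal_mult[symmetric] mult_ac)
          also have "\<dots> = (\<integral>\<^sup>+y. ennreal (indicator {y. K \<le> norm y} y * \<bar>u (S n) powr \<beta> * Q (y /\<^sub>R u (S n))\<bar>) \<partial>?P)"
            unfolding dens by (rule nn_integral_density[symmetric]) measurable
          also have "\<dots> \<le> (\<integral>\<^sup>+y. ennreal (C1 * (indicator {y. K \<le> norm y} y * min (norm y) ?A powr \<beta>)) \<partial>?P)"
          proof (intro nn_integral_mono ennreal_leI)
            fix y
            have "indicator {y. K \<le> norm y} y * \<bar>u (S n) powr \<beta> * Q (y /\<^sub>R u (S n))\<bar> \<le> indicator {y. K \<le> norm y} y * (C1 * min (norm y) ?A powr \<beta>)"
              by (intro mult_left_mono q_bd2) simp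
            then show "indicator {y. K \<le> norm y} y * \<bar>u (S n) powr \<beta> * Q (y /\<^sub>R u (S n))\<bar> \<le> C1 * (indicator {y. K \<le> norm y} y * min (norm y) ?A powr \<beta>)"
              by (simp only: mult.left_commute)
          qed
          also have "\<dots> = ennreal (\<integral>y. C1 * (indicator {y. K \<le> norm y} y * min (norm y) ?A powr \<beta>) \<partial>?P)"
          proof (rule nn_integral_eq_integral)
            have "integrable ?P (\<lambda>y. indicator {y. K \<le> norm y} y * min (norm y) ?A powr \<beta>)"
              using A K \<beta> by (intro P.integrable_const_bound[where B="?A powr \<beta>"])
                (auto simp: indicator_def intro!: powr_mono2)
            then show "integrable ?P (\<lambda>y. C1 * (indicator {y. K \<le> norm y} y * min (norm y) ?A powr \<beta>))"
              by (rule integrable_mult_right)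
          qed (use C1 in auto)
          also have "\<dots> \<le> ennreal e"
          proof (rule ennreal_leI)
            have "(\<integral>y. indicator {y. K \<le> norm y} y * min (norm y) ?A powr \<beta> \<partial>?P) \<le> D1 * K powr (\<beta> - \<gamma>)"
              unfolding D1_def using A K \<beta> \<gamma> S(4)
              by (intro truncated_moment_tail[OF P sP]) auto
            then have "C1 * (\<integral>y. indicator {y. K \<le> norm y} y * min (norm y) ?A powr \<beta> \<partial>?P) \<le> C1 * (D1 * K powr (\<beta> - \<gamma>))"
              using C1 by (rule mult_left_mono)
            then show "(\<integral>y. C1 * (indicator {y. K \<le> norm y} y * min (norm y) ?A powr \<beta>) \<partial>?P) \<le> e"
              using K(1) by (simp only: integral_mult_right_zero)
          qed
          finally show ?case .
        qed
        then show ?thesis by blast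
      qed
      have m: "(\<lambda>y. \<rho> y * f y) \<in> borel_measurable borel" by measurable
      show "integrable lborel (\<lambda>y. \<rho> y * f y)"
        by (rule integral_tendsto_of_uniform_tails(1)[OF hm m 1 2 3])
      show "(\<lambda>n. \<integral>y. h n y \<partial>lborel) \<longlonglongrightarrow> (\<integral>y. \<rho> y * f y \<partial>lborel)"
        by (rule integral_tendsto_of_uniform_tails(2)[OF hm m 1 2 3])
    qed
    moreover have "(\<integral>y. h n y \<partial>lborel) = u (S n) powr \<beta> * (\<integral>\<omega>. Q (X (S n) \<omega>) \<partial>M)" for n
    proof -
      have "(\<integral>\<omega>. Q (X (S n) \<omega>) \<partial>M) = (\<integral>y. Q (y /\<^sub>R u (S n)) * scaled_density (S n) y \<partial>lborel)"
        using S[of n] c(1) by (intro expectation_density[of _ _ c]) (auto simp: k_def)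
      then show ?thesis unfolding h_def mult.assoc by (simp only: integral_mult_right_zero)
    qed
    ultimately have "(\<lambda>n. u (T (n + N)) powr \<beta> * (\<integral>\<omega>. Q (X (T (n + N)) \<omega>) \<partial>M)) \<longlonglongrightarrow> (\<integral>y. \<rho> y * f y \<partial>lborel)"
      by (simp add: S_def)
    then have "(\<lambda>n. u (T n) powr \<beta> * (\<integral>\<omega>. Q (X (T n) \<omega>) \<partial>M)) \<longlonglongrightarrow> (\<integral>y. \<rho> y * f y \<partial>lborel)"
      by (rule LIMSEQ_offset)
    then show ?thesis using \<open>integrable lborel (\<lambda>y. \<rho> y * f y)\<close> by blast
  qed
  note T0 = inverse_Suc_at_right_0
  note [measurable] = limit_density_measurable[OF p]
  have "AE y in lborel. p y = f y"
    using limit_density_eq_inv_fourier[OF p integrable_limit_char[OF \<alpha>1, unfolded limit_char_def[abs_def]]]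
    unfolding f_def limit_char_def[abs_def] .
  then have AE: "AE y in lborel. \<rho> y * f y = \<rho> y * p y" by eventually_elim simp
  have eq: "(\<integral>y. \<rho> y * f y \<partial>lborel) = (\<integral>y. \<rho> y * p y \<partial>lborel)"
    by (rule integral_cong_AE) (use AE in auto)
  show "integrable lborel (\<lambda>y. \<rho> y * p y)"
    using main[OF T0] by (subst integrable_cong_AE[of _ _ "\<lambda>y. \<rho> y * f y"]) (use AE in auto)
  show "((\<lambda>t. u t powr \<beta> * (\<integral>\<omega>. Q (X t \<omega>) \<partial>M)) \<longlongrightarrow> (\<integral>y. \<rho> y * p y \<partial>lborel)) (at_right 0)"
    unfolding tendsto_at_iff_sequentially comp_def eq[symmetric]
  proof (intro allI impI)
    fix T :: "nat \<Rightarrow> real" assume T: "\<forall>i. T i \<in> {0<..} - {0}" "T \<longlonglongrightarrow> 0"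
    then have "filterlim T (at_right 0) sequentially"
      unfolding filterlim_at by (intro conjI always_eventually allI) blast+
    from main[OF this] show "(\<lambda>n. u (T n) powr \<beta> * (\<integral>\<omega>. Q (X (T n) \<omega>) \<partial>M)) \<longlonglongrightarrow> (\<integral>y. \<rho> y * f y \<partial>lborel)"
      by blast
  qed
qed

end

section \<open>Heat content\<close>

lemma abs_shift_avg_le:
  assumes mu: "finite_measure \<mu>" and B: "\<And>x. \<bar>g x\<bar> \<le> B"
  shows "\<bar>shift_avg g \<mu> x\<bar> \<le> B * measure \<mu> (space \<mu>)"
proof -
  interpret finite_measure \<mu> by fact
  have "\<bar>shift_avg g \<mu> x\<bar> \<le> (\<integral>y. B \<partial>\<mu>)"
    unfolding shift_avg_def using B by (intro abs_integral_le) auto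
  then show ?thesis by (simp add: mult.commute)
qed

lemma borel_measurable_shift_avg:
  fixes g :: "'a::euclidean_space \<Rightarrow> real"
  assumes mu: "finite_measure \<mu>" and [measurable_cong]: "sets \<mu> = sets borel"
    and [measurable]: "g \<in> borel_measurable borel"
  shows "shift_avg g \<mu> \<in> borel_measurable borel"
proof -
  interpret finite_measure \<mu> by fact
  show ?thesis unfolding shift_avg_def[abs_def] by measurable
qed

lemma heat_content_eq:
  fixes g :: "'a::euclidean_space \<Rightarrow> real"
  assumes M: "prob_space M" and X[measurable]: "X t \<in> borel_measurable M"
    and mu: "finite_measure \<mu>" and [measurable_cong]: "sets \<mu> = sets borel"
    and [measurable]: "g \<in> borel_measurable borel" and B: "\<And>x. \<bar>g x\<bar> \<le> B"
  shows "heat_content M X g \<mu> t = (\<integral>\<omega>. shift_avg g \<mu> (X t \<omega>) \<partial>M)"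
proof -
  interpret prob_space M by fact
  have "(\<integral>\<omega>. \<integral>x. g (x + X t \<omega>) \<partial>\<mu> \<partial>M) = heat_content M X g \<mu> t"
    unfolding heat_content_def
  proof (rule Fubini_dominated[OF mu])
    show "sigma_finite_measure M" by (rule sigma_finite_measure_axioms)
    show "(\<lambda>(x, \<omega>). g (x + X t \<omega>)) \<in> borel_measurable (\<mu> \<Otimes>\<^sub>M M)" by measurable
    show "integrable M (\<lambda>_. B)" by simp
  qed (rule B)
  then show ?thesis unfolding shift_avg_def by (simp only: add.commute)
qed

text \<open>The direction of \<open>y\<close> stays fixed, and the radius \<open>|y| / v\<close> of \<open>y / v\<close> tends to 0 from the right. At
  \<open>y = 0\<close> both sides vanish whatever \<open>R\<close> is there.\<close>

lemma radial_scaling_limit: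
  fixes Q R :: "'a::euclidean_space \<Rightarrow> real"
  assumes lim: "((\<lambda>t. SUP \<theta>\<in>sphere 0 1. ereal \<bar>Q (t *\<^sub>R \<theta>) / t powr \<beta> - R \<theta>\<bar>) \<longlongrightarrow> 0) (at_right 0)"
    and Q0: "Q 0 = 0"
  shows "((\<lambda>v. v powr \<beta> * Q (y /\<^sub>R v)) \<longlongrightarrow> R (y /\<^sub>R norm y) * norm y powr \<beta>) at_top"
proof (cases "y = 0")
  case True
  then show ?thesis using Q0 by simp
next
  case False
  define \<theta> where "\<theta> = y /\<^sub>R norm y"
  have \<theta>: "\<theta> \<in> sphere 0 1" "y = norm y *\<^sub>R \<theta>" using False by (auto simp: \<theta>_def)
  have "((\<lambda>t. ereal \<bar>Q (t *\<^sub>R \<theta>) / t powr \<beta> - R \<theta>\<bar>) \<longlongrightarrow> ereal 0) (at_right 0)"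
    unfolding zero_ereal_def[symmetric]
  proof (rule tendsto_sandwich[OF always_eventually always_eventually tendsto_const lim])
    show "\<forall>t. ereal \<bar>Q (t *\<^sub>R \<theta>) / t powr \<beta> - R \<theta>\<bar> \<le> (SUP \<theta>\<in>sphere 0 1. ereal \<bar>Q (t *\<^sub>R \<theta>) / t powr \<beta> - R \<theta>\<bar>)"
      using \<theta>(1) by (intro allI SUP_upper)
  qed simp
  then have "((\<lambda>t. \<bar>Q (t *\<^sub>R \<theta>) / t powr \<beta> - R \<theta>\<bar>) \<longlongrightarrow> 0) (at_right 0)" by (simp only: lim_ereal)
  then have "((\<lambda>t. Q (t *\<^sub>R \<theta>) / t powr \<beta>) \<longlongrightarrow> R \<theta>) (at_right 0)"
    by (subst (asm) tendsto_rabs_zero_iff) (rule LIM_zero_cancel)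
  moreover have "filterlim (\<lambda>v. norm y * inverse v) (at_right 0) at_top"
    using False tendsto_mult_right_zero[OF tendsto_inverse_0_at_top[OF filterlim_ident], of "norm y"]
    by (auto simp: filterlim_at eventually_at_top_dense intro!: exI[of _ 0])
  ultimately have "((\<lambda>v. Q ((norm y * inverse v) *\<^sub>R \<theta>) / (norm y * inverse v) powr \<beta>) \<longlongrightarrow> R \<theta>) at_top"
    by (rule filterlim_compose)
  then have "((\<lambda>v. Q ((norm y * inverse v) *\<^sub>R \<theta>) / (norm y * inverse v) powr \<beta> * norm y powr \<beta>) \<longlongrightarrow> R \<theta> * norm y powr \<beta>) at_top"
    by (rule tendsto_mult_right)
  then show ?thesis unfolding \<theta>_def[symmetric]
  proof (rule Lim_transform_eventually)
    show "eventually (\<lambda>v. Q ((norm y * inverse v) *\<^sub>R \<theta>) / (norm y * inverse v) powr \<beta> * norm y powr \<beta> = v powr \<beta> * Q (y /\<^sub>R v)) at_top"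
      using eventually_gt_at_top[of 0]
    proof eventually_elim
      case (elim v)
      have "y /\<^sub>R v = (norm y * inverse v) *\<^sub>R \<theta>" by (subst \<theta>(2)) (simp add: mult.commute)
      moreover have "norm y powr \<beta> = (norm y * inverse v) powr \<beta> * v powr \<beta>"
      proof -
        have "norm y * inverse v * v = norm y" using elim by simp
        then show ?thesis using elim by (simp only: powr_mult[symmetric])
      qed
      moreover have "(norm y * inverse v) powr \<beta> \<noteq> 0" using elim False by simp
      ultimately show ?case by simp
    qed
  qed
qed

theorem theorem3:
  fixes \<beta> \<alpha> L :: real
    and M :: "'w measure"
    and X :: "real \<Rightarrow> 'w \<Rightarrow> 'a::euclidean_space"
    and \<nu> \<eta> \<mu> :: "'a measure"
    and g r R\<^sub>\<beta> p\<^sub>\<eta> :: "'a \<Rightarrow> real"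
    and V :: "real \<Rightarrow> real"
  assumes beta: "1 \<le> \<beta>" "\<beta> < 2"
    and X: "symmetric_levy_process M X \<nu>"
    and eta: "tail_limit_measure \<nu> \<eta>"
    and V: "V = tail_fun \<nu>"
    and alpha: "\<beta> < \<alpha>" "\<alpha> < 2"
    and regvar: "regularly_varying V \<alpha>"
    and g: "g \<in> borel_measurable borel" "bounded (range g)"
    and mu: "finite_measure \<mu>" "sets \<mu> = sets borel"
    and r: "r = shift_avg g \<mu>"
    and R_lim: "((\<lambda>t. SUP \<theta>\<in>sphere 0 1.
           ereal \<bar>(r (t *\<^sub>R \<theta>) + r (- t *\<^sub>R \<theta>) - 2 * r 0) / t powr \<beta> - R\<^sub>\<beta> \<theta>\<bar>) \<longlongrightarrow> 0) (at_right 0)"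
    and L: "L > 0" "\<And>x. \<bar>r x + r (- x) - 2 * r 0\<bar> \<le> L * norm x powr \<beta>"
    and p: "limit_density \<eta> p\<^sub>\<eta>"
  shows "integrable lborel (\<lambda>x. R\<^sub>\<beta> (x /\<^sub>R norm x) * norm x powr \<beta> * p\<^sub>\<eta> x) \<and>
     ((\<lambda>t. gen_inverse V (1 / t) powr \<beta> * (heat_content M X g \<mu> t - heat_content M X g \<mu> 0))
        \<longlongrightarrow> 1 / 2 * (\<integral>x. R\<^sub>\<beta> (x /\<^sub>R norm x) * norm x powr \<beta> * p\<^sub>\<eta> x \<partial>lborel)) (at_right 0) \<and>
     (\<forall>q. limit_density \<eta> q \<longrightarrow> (AE x in lborel. q x = p\<^sub>\<eta> x))"
proof -
  have \<alpha>1: "1 < \<alpha>" and \<beta>0: "0 \<le> \<beta>" and \<beta>\<alpha>: "\<beta> < \<alpha>" using beta alpha by auto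
  interpret scaled_levy \<nu> \<alpha> M X \<eta> p\<^sub>\<eta>
  proof unfold_locales
    show "levy_measure \<nu>" using X by (simp add: symmetric_levy_process_def)
    show "regularly_varying (tail_fun \<nu>) \<alpha>" using regvar V by simp
  qed (use beta alpha X eta p in auto)
  interpret M: prob_space M by (rule prob_space_M)
  obtain B where B: "\<And>x. \<bar>g x\<bar> \<le> B" using g(2) by (auto simp: bounded_iff)
  define Q where "Q x = r x + r (- x) - 2 * r 0" for x
  define Br where "Br = B * measure \<mu> (space \<mu>)"
  have r_bd: "\<bar>r x\<bar> \<le> Br" for x unfolding r Br_def by (rule abs_shift_avg_le[OF mu(1) B])
  have r_meas[measurable]: "r \<in> borel_measurable borel"
    unfolding r by (rule borel_measurable_shift_avg[OF mu g(1)])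
  have Q_meas[measurable]: "Q \<in> borel_measurable borel" unfolding Q_def by measurable
  have Q_bd: "\<bar>Q x\<bar> \<le> 4 * Br" for x
    using r_bd[of x] r_bd[of "- x"] r_bd[of 0] unfolding Q_def by linarith
  have Q_lim: "((\<lambda>v. v powr \<beta> * Q (y /\<^sub>R v)) \<longlongrightarrow> R\<^sub>\<beta> (y /\<^sub>R norm y) * norm y powr \<beta>) at_top" for y
    using R_lim by (intro radial_scaling_limit) (simp_all add: Q_def)
  note main = scaled_expectation_tendsto[OF \<alpha>1 \<beta>0 \<beta>\<alpha> Q_meas L(2)[folded Q_def] Q_bd Q_lim]
  have heat: "heat_content M X g \<mu> t = (\<integral>\<omega>. r (X t \<omega>) \<partial>M)" if "0 \<le> t" for t
    unfolding r by (rule heat_content_eq[where B=B and X=X and t=t, OF prob_space_M X_measurable[OF that] mu g(1)]) (rule B)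
  have heat0: "heat_content M X g \<mu> 0 = r 0"
  proof -
    have "AE \<omega> in M. X 0 \<omega> = 0" using X by (simp add: symmetric_levy_process_def levy_process_def)
    then have "(\<integral>\<omega>. r (X 0 \<omega>) \<partial>M) = (\<integral>\<omega>. r 0 \<partial>M)"
      using X_measurable[of 0] by (intro integral_cong_AE) auto
    then show ?thesis by (simp add: heat M.prob_space)
  qed
  from scaled_char_dominated[OF \<alpha>1] obtain c where c: "0 < c"
    "eventually (\<lambda>t. \<forall>\<xi>. scaled_char t \<xi> \<le> exp (c - c * norm \<xi>)) (at_right 0)" by blast
  have "eventually (\<lambda>t. 0 < u t) (at_right 0)" using u_at_top by (simp add: filterlim_at_top_dense)
  then have "eventually (\<lambda>t. 1 / 2 * (u t powr \<beta> * (\<integral>\<omega>. Q (X t \<omega>) \<partial>M)) =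
     gen_inverse V (1 / t) powr \<beta> * (heat_content M X g \<mu> t - heat_content M X g \<mu> 0)) (at_right 0)"
    using c(2) eventually_at_right_less[of 0]
  proof eventually_elim
    case (elim t)
    note [measurable] = X_measurable[of t]
    have t: "0 \<le> t" using elim by simp
    have ir: "integrable M (\<lambda>\<omega>. r (X t \<omega>))" "integrable M (\<lambda>\<omega>. r (- X t \<omega>))"
      using t r_bd by (auto intro!: M.integrable_const_bound[where B=Br])
    have "(\<integral>\<omega>. Q (X t \<omega>) \<partial>M) = (\<integral>\<omega>. r (X t \<omega>) \<partial>M) + (\<integral>\<omega>. r (- X t \<omega>) \<partial>M) - 2 * r 0"
      unfolding Q_def using ir by (simp add: M.prob_space)
    also have "(\<integral>\<omega>. r (- X t \<omega>) \<partial>M) = (\<integral>\<omega>. r (X t \<omega>) \<partial>M)"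
      using elim by (intro expectation_uminus[OF t _ r_meas c(1)]) auto
    finally have "(\<integral>\<omega>. Q (X t \<omega>) \<partial>M) = 2 * (heat_content M X g \<mu> t - heat_content M X g \<mu> 0)"
      by (simp add: heat0 heat[OF t])
    then show ?case by (simp add: u_def V)
  qed
  with tendsto_mult_left[OF main(2), of "1/2"]
  have "((\<lambda>t. gen_inverse V (1 / t) powr \<beta> * (heat_content M X g \<mu> t - heat_content M X g \<mu> 0))
        \<longlongrightarrow> 1 / 2 * (\<integral>x. R\<^sub>\<beta> (x /\<^sub>R norm x) * norm x powr \<beta> * p\<^sub>\<eta> x \<partial>lborel)) (at_right 0)"
    by (rule Lim_transform_eventually)
  moreover have "AE x in lborel. q x = p\<^sub>\<eta> x" if q: "limit_density \<eta> q" for q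
    using limit_density_eq_inv_fourier[OF q integrable_limit_char[OF \<alpha>1, unfolded limit_char_def[abs_def]]]
      limit_density_eq_inv_fourier[OF p integrable_limit_char[OF \<alpha>1, unfolded limit_char_def[abs_def]]]
    by eventually_elim simp
  ultimately show ?thesis using main(1) by blast
qed

end
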